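(* Let $\nabla$ be an analytic connection on a connected and simply connected manifold $\mathcal{M}$ of dimension $n$ and let $x\in \mathcal{M}$ be a fixed point. Let $k_0$ be an integer with $0\le k_0\le n^2$ such that $\mathfrak{L}_{k_0}=\mathfrak{L}_k$ for all $k\ge k_0$. If $\mathfrak{L}_{k_0} = 0$, then for any integer $0 \le p \le n$, there is a pseudo-Riemannian metric $\mathsf{g}$ on $\mathcal{M}$ of signature $(p,n-p)$ such that $\nabla$ is the Levi-Civita connection of $\mathsf{g}$.
   Context: A connection means a torsion-free affine connection $\nabla$ ($\nabla_XY-\nabla_YX=[X,Y]$). Its curvature tensor is $R(X,Y)Z=\nabla_X\nabla_YZ-\nabla_Y\nabla_XZ-\nabla_{[X,Y]}Z$, and $\nabla^jR$ denotes its $j$-th iterated covariant derivative. For $x\in\mathcal{M}$ and an integer $k\ge 0$, $\mathfrak{L}_k$ is the Lie subalgebra of $\mathrm{End}(\mathbb{T}_x\mathcal{M})$ generated by the linear maps $X_{v_1,\dots,v_{j+2}}:\mathbb{T}_x\mathcal{M}\to\mathbb{T}_x\mathcal{M}$, $X_{v_1,\dots,v_{j+2}}(u)=(\nabla^jR(v_1,v_2))(u,v_3,\dots,v_{j+2})$, where $v_1,\dots,v_{j+2}\in\mathbb{T}_x\mathcal{M}$ and $0\le j\le k$; here $v_1,v_2$ are the two arguments of the curvature operator, $u$ is the vector it acts on, and $v_3,\dots,v_{j+2}$ are the directions of covariant differentiation. *)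

theory Defs
  imports "HOL-Analysis.Analysis"
begin

section \<open>Smooth and real-analytic maps between open sets of Euclidean spaces\<close>

primrec Ck_on :: "nat \<Rightarrow> 'a::real_normed_vector set \<Rightarrow> ('a \<Rightarrow> 'b::real_normed_vector) \<Rightarrow> bool" where
  "Ck_on 0 S f \<longleftrightarrow> continuous_on S f"
| "Ck_on (Suc k) S f \<longleftrightarrow>
     (\<forall>x\<in>S. f differentiable at x) \<and> (\<forall>v. Ck_on k S (\<lambda>x. frechet_derivative f (at x) v))"

text \<open>Only used for open sets.\<close>

definition smooth_on :: "'a::real_normed_vector set \<Rightarrow> ('a \<Rightarrow> 'b::real_normed_vector) \<Rightarrow> bool" where
  "smooth_on S f \<longleftrightarrow> (\<forall>k. Ck_on k S f)"

text \<open>Power series are indexed by multi-indices; \<open>has_sum\<close> is unconditional summation.\<close>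

definition real_analytic_at :: "real^'n \<Rightarrow> (real^'n \<Rightarrow> 'b::real_normed_vector) \<Rightarrow> bool" where
  "real_analytic_at a f \<longleftrightarrow>
     (\<exists>r>0. \<exists>coef :: ('n \<Rightarrow> nat) \<Rightarrow> 'b. \<forall>z\<in>ball a r.
        ((\<lambda>\<alpha>. (\<Prod>i\<in>UNIV. (z $ i - a $ i) ^ \<alpha> i) *\<^sub>R coef \<alpha>) has_sum f z) UNIV)"

definition real_analytic_on :: "(real^'n) set \<Rightarrow> (real^'n \<Rightarrow> 'b::real_normed_vector) \<Rightarrow> bool" where
  "real_analytic_on S f \<longleftrightarrow> (\<forall>a\<in>S. real_analytic_at a f)"


section \<open>Analytic manifolds\<close>

text \<open>
  A manifold is the whole of a Hausdorff, second countable topological type \<open>'m\<close>,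
  with an (analytic, not necessarily maximal) atlas modelled on \<open>real^'n\<close>.
  A chart is a pair of a domain and a coordinate map, the latter being relevant
  on the domain only.
\<close>

type_synonym ('m, 'n) chart = "'m set \<times> ('m \<Rightarrow> real^'n)"

abbreviation dom_chart :: "('m, 'n::finite) chart \<Rightarrow> 'm set" where
  "dom_chart c \<equiv> fst c"

abbreviation map_chart :: "('m, 'n::finite) chart \<Rightarrow> 'm \<Rightarrow> real^'n" where
  "map_chart c \<equiv> snd c"

abbreviation ran_chart :: "('m, 'n::finite) chart \<Rightarrow> (real^'n) set" where
  "ran_chart c \<equiv> map_chart c ` dom_chart c"

abbreviation inv_chart :: "('m, 'n::finite) chart \<Rightarrow> real^'n \<Rightarrow> 'm" where
  "inv_chart c \<equiv> inv_into (dom_chart c) (map_chart c)"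

definition is_chart :: "('m::topological_space, 'n::finite) chart \<Rightarrow> bool" where
  "is_chart c \<longleftrightarrow> open (dom_chart c) \<and> open (ran_chart c) \<and>
     homeomorphism (dom_chart c) (ran_chart c) (map_chart c) (inv_chart c)"

definition analytic_atlas ::
    "('m::{t2_space,second_countable_topology}, 'n::finite) chart set \<Rightarrow> bool" where
  "analytic_atlas A \<longleftrightarrow>
     (\<forall>c\<in>A. is_chart c) \<and> (\<Union>c\<in>A. dom_chart c) = UNIV \<and>
     (\<forall>c\<in>A. \<forall>d\<in>A. real_analytic_on (map_chart c ` (dom_chart c \<inter> dom_chart d))
                                    (map_chart d \<circ> inv_chart c))"

definition smooth_function ::
    "('m::topological_space, 'n::finite) chart set \<Rightarrow> ('m \<Rightarrow> real) \<Rightarrow> bool" where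
  "smooth_function A f \<longleftrightarrow> (\<forall>c\<in>A. smooth_on (ran_chart c) (f \<circ> inv_chart c))"


section \<open>Tangent vectors and vector fields\<close>

text \<open>
  One chart \<open>chart_at A p\<close> is chosen around each point \<open>p\<close>, and the tangent space at \<open>p\<close>
  is realised as \<open>real^'n\<close> by taking components in that chart. The components
  of the same tangent vector in any other chart are obtained by applying the derivative
  of the transition map. The choice may jump from point to point, so a map
  \<open>'m \<Rightarrow> real^'n\<close> is a smooth vector field when its components in every chart
  of the atlas are smooth, not when it is smooth as a map into \<open>real^'n\<close>.
\<close>

definition chart_at :: "('m, 'n::finite) chart set \<Rightarrow> 'm \<Rightarrow> ('m, 'n) chart" where
  "chart_at A p = (SOME c. c \<in> A \<and> p \<in> dom_chart c)"

definition tangent_comp ::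
    "('m, 'n::finite) chart set \<Rightarrow> ('m, 'n) chart \<Rightarrow> 'm \<Rightarrow> real^'n \<Rightarrow> real^'n" where
  "tangent_comp A c p v =
     frechet_derivative (map_chart c \<circ> inv_chart (chart_at A p))
       (at (map_chart (chart_at A p) p)) v"

definition field_comp ::
    "('m, 'n::finite) chart set \<Rightarrow> ('m, 'n) chart \<Rightarrow> ('m \<Rightarrow> real^'n) \<Rightarrow> real^'n \<Rightarrow> real^'n" where
  "field_comp A c X z = tangent_comp A c (inv_chart c z) (X (inv_chart c z))"

definition vector_field ::
    "('m::topological_space, 'n::finite) chart set \<Rightarrow> ('m \<Rightarrow> real^'n) \<Rightarrow> bool" where
  "vector_field A X \<longleftrightarrow> (\<forall>c\<in>A. smooth_on (ran_chart c) (field_comp A c X))"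

text \<open>The derivative \<open>X f\<close> of a function along a vector field.\<close>

definition field_deriv ::
    "('m, 'n::finite) chart set \<Rightarrow> ('m \<Rightarrow> real^'n) \<Rightarrow> ('m \<Rightarrow> real) \<Rightarrow> 'm \<Rightarrow> real" where
  "field_deriv A X f p =
     frechet_derivative (f \<circ> inv_chart (chart_at A p)) (at (map_chart (chart_at A p) p)) (X p)"

text \<open>
  In coordinates, \<open>[X, Y]\<^sup>k = X\<^sup>i \<partial>\<^sub>i Y\<^sup>k - Y\<^sup>i \<partial>\<^sub>i X\<^sup>k\<close>; at \<open>p\<close> this is
  evaluated in \<open>chart_at A p\<close>, in which the components of \<open>X\<close> at \<open>p\<close> are \<open>X p\<close> itself.
\<close>

definition lie_bracket ::
    "('m, 'n::finite) chart set \<Rightarrow> ('m \<Rightarrow> real^'n) \<Rightarrow> ('m \<Rightarrow> real^'n) \<Rightarrow> 'm \<Rightarrow> real^'n" where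
  "lie_bracket A X Y p =
     (let c = chart_at A p; z = map_chart c p in
        frechet_derivative (field_comp A c Y) (at z) (X p)
      - frechet_derivative (field_comp A c X) (at z) (Y p))"


section \<open>Connections\<close>

type_synonym ('m, 'n) connection = "('m \<Rightarrow> real^'n) \<Rightarrow> ('m \<Rightarrow> real^'n) \<Rightarrow> 'm \<Rightarrow> real^'n"

definition affine_connection ::
    "('m::topological_space, 'n::finite) chart set \<Rightarrow> ('m, 'n) connection \<Rightarrow> bool" where
  "affine_connection A nabla \<longleftrightarrow>
     (\<forall>X Y. vector_field A X \<longrightarrow> vector_field A Y \<longrightarrow> vector_field A (nabla X Y)) \<and>
     (\<forall>X X' Y p. vector_field A X \<longrightarrow> vector_field A X' \<longrightarrow> vector_field A Y \<longrightarrow>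
        nabla (\<lambda>q. X q + X' q) Y p = nabla X Y p + nabla X' Y p) \<and>
     (\<forall>f X Y p. smooth_function A f \<longrightarrow> vector_field A X \<longrightarrow> vector_field A Y \<longrightarrow>
        nabla (\<lambda>q. f q *\<^sub>R X q) Y p = f p *\<^sub>R nabla X Y p) \<and>
     (\<forall>X Y Y' p. vector_field A X \<longrightarrow> vector_field A Y \<longrightarrow> vector_field A Y' \<longrightarrow>
        nabla X (\<lambda>q. Y q + Y' q) p = nabla X Y p + nabla X Y' p) \<and>
     (\<forall>f X Y p. smooth_function A f \<longrightarrow> vector_field A X \<longrightarrow> vector_field A Y \<longrightarrow>
        nabla X (\<lambda>q. f q *\<^sub>R Y q) p = field_deriv A X f p *\<^sub>R Y p + f p *\<^sub>R nabla X Y p)"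

definition torsion_free ::
    "('m::topological_space, 'n::finite) chart set \<Rightarrow> ('m, 'n) connection \<Rightarrow> bool" where
  "torsion_free A nabla \<longleftrightarrow>
     (\<forall>X Y p. vector_field A X \<longrightarrow> vector_field A Y \<longrightarrow>
        nabla X Y p - nabla Y X p = lie_bracket A X Y p)"

text \<open>
  \<open>\<Gamma> i j\<close> is the vector of Christoffel symbols \<open>(\<Gamma>\<^sup>k\<^sub>i\<^sub>j)\<^sub>k\<close> of the connection in the chart \<open>c\<close>:
  \<open>(\<nabla>\<^sub>X Y)\<^sup>k = X\<^sup>i \<partial>\<^sub>i Y\<^sup>k + \<Gamma>\<^sup>k\<^sub>i\<^sub>j X\<^sup>i Y\<^sup>j\<close>.
\<close>

definition christoffel_symbols ::
    "('m::topological_space, 'n::finite) chart set \<Rightarrow> ('m, 'n) connection \<Rightarrow> ('m, 'n) chart \<Rightarrow>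
     ('n \<Rightarrow> 'n \<Rightarrow> real^'n \<Rightarrow> real^'n) \<Rightarrow> bool" where
  "christoffel_symbols A nabla c \<Gamma> \<longleftrightarrow>
     (\<forall>X Y. vector_field A X \<longrightarrow> vector_field A Y \<longrightarrow>
       (\<forall>z\<in>ran_chart c.
          field_comp A c (nabla X Y) z =
            frechet_derivative (field_comp A c Y) (at z) (field_comp A c X z)
          + (\<Sum>i\<in>UNIV. \<Sum>j\<in>UNIV.
               (field_comp A c X z $ i * field_comp A c Y z $ j) *\<^sub>R \<Gamma> i j z)))"

definition analytic_connection ::
    "('m::topological_space, 'n::finite) chart set \<Rightarrow> ('m, 'n) connection \<Rightarrow> bool" where
  "analytic_connection A nabla \<longleftrightarrow>
     affine_connection A nabla \<and> torsion_free A nabla \<and>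
     (\<forall>c\<in>A. \<exists>\<Gamma>. christoffel_symbols A nabla c \<Gamma> \<and>
                  (\<forall>i j. real_analytic_on (ran_chart c) (\<Gamma> i j)))"


section \<open>Curvature and its covariant derivatives\<close>

definition curvature ::
    "('m, 'n::finite) chart set \<Rightarrow> ('m, 'n) connection \<Rightarrow>
     ('m \<Rightarrow> real^'n) \<Rightarrow> ('m \<Rightarrow> real^'n) \<Rightarrow> ('m \<Rightarrow> real^'n) \<Rightarrow> 'm \<Rightarrow> real^'n" where
  "curvature A nabla X Y Z p =
     nabla X (nabla Y Z) p - nabla Y (nabla X Z) p - nabla (lie_bracket A X Y) Z p"

text \<open>
  A vector-valued covariant tensor field is a function of the list of its arguments
  (vector fields). Covariant differentiation appends one argument, the direction \<open>W\<close>: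
  \<open>(\<nabla>T)(Y\<^sub>1,\<dots>,Y\<^sub>m,W) = \<nabla>\<^sub>W (T(Y\<^sub>1,\<dots>,Y\<^sub>m)) - \<Sum>\<^sub>i T(Y\<^sub>1,\<dots>,\<nabla>\<^sub>W Y\<^sub>i,\<dots>,Y\<^sub>m)\<close>.
\<close>

type_synonym ('m, 'n) tensor = "('m \<Rightarrow> real^'n) list \<Rightarrow> 'm \<Rightarrow> real^'n"

definition cov_deriv ::
    "('m, 'n::finite) connection \<Rightarrow> ('m, 'n) tensor \<Rightarrow> ('m, 'n) tensor" where
  "cov_deriv nabla T Vs p =
     (let W = last Vs; Ys = butlast Vs in
        nabla W (T Ys) p - (\<Sum>i<length Ys. T (Ys[i := nabla W (Ys ! i)]) p))"

definition curvature_tensor ::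
    "('m, 'n::finite) chart set \<Rightarrow> ('m, 'n) connection \<Rightarrow> ('m, 'n) tensor" where
  "curvature_tensor A nabla Vs = curvature A nabla (Vs ! 0) (Vs ! 1) (Vs ! 2)"

text \<open>
  The \<open>j\<close>-th covariant derivative of the curvature; its value on
  \<open>[V\<^sub>1, V\<^sub>2, U, V\<^sub>3, \<dots>, V\<^sub>j\<^sub>+\<^sub>2]\<close> is \<open>(\<nabla>\<^sup>j R(V\<^sub>1, V\<^sub>2))(U, V\<^sub>3, \<dots>, V\<^sub>j\<^sub>+\<^sub>2)\<close>.
\<close>

definition curvature_deriv ::
    "('m, 'n::finite) chart set \<Rightarrow> ('m, 'n) connection \<Rightarrow> nat \<Rightarrow> ('m, 'n) tensor" where
  "curvature_deriv A nabla j = (cov_deriv nabla ^^ j) (curvature_tensor A nabla)"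

text \<open>
  Evaluation of a tensor field on tangent vectors at a point: extend the vectors to
  vector fields. For tensorial \<open>T\<close> the result does not depend on the extensions.
\<close>

definition extend_vector ::
    "('m::topological_space, 'n::finite) chart set \<Rightarrow> 'm \<Rightarrow> real^'n \<Rightarrow> 'm \<Rightarrow> real^'n" where
  "extend_vector A x v = (SOME V. vector_field A V \<and> V x = v)"

definition tensor_at ::
    "('m::topological_space, 'n::finite) chart set \<Rightarrow> ('m, 'n) tensor \<Rightarrow> 'm \<Rightarrow>
     (real^'n) list \<Rightarrow> real^'n" where
  "tensor_at A T x vs = T (map (extend_vector A x) vs) x"


section \<open>The Lie algebras generated by the curvature at a point\<close>

definition lie_subalgebra :: "('v::real_vector \<Rightarrow> 'v) set \<Rightarrow> bool" where
  "lie_subalgebra S \<longleftrightarrow>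
     (\<forall>f\<in>S. linear f) \<and> (\<lambda>u. 0) \<in> S \<and>
     (\<forall>f\<in>S. \<forall>g\<in>S. (\<lambda>u. f u + g u) \<in> S) \<and>
     (\<forall>a. \<forall>f\<in>S. (\<lambda>u. a *\<^sub>R f u) \<in> S) \<and>
     (\<forall>f\<in>S. \<forall>g\<in>S. (\<lambda>u. f (g u) - g (f u)) \<in> S)"

definition curvature_endo ::
    "('m::topological_space, 'n::finite) chart set \<Rightarrow> ('m, 'n) connection \<Rightarrow> 'm \<Rightarrow> nat \<Rightarrow>
     real^'n \<Rightarrow> real^'n \<Rightarrow> (real^'n) list \<Rightarrow> real^'n \<Rightarrow> real^'n" where
  "curvature_endo A nabla x j v1 v2 vs u =
     tensor_at A (curvature_deriv A nabla j) x (v1 # v2 # u # vs)"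

definition curvature_lie_algebra ::
    "('m::topological_space, 'n::finite) chart set \<Rightarrow> ('m, 'n) connection \<Rightarrow> 'm \<Rightarrow> nat \<Rightarrow>
     (real^'n \<Rightarrow> real^'n) set" where
  "curvature_lie_algebra A nabla x k =
     lie_subalgebra hull {curvature_endo A nabla x j v1 v2 vs | j v1 v2 vs. j \<le> k \<and> length vs = j}"


section \<open>Pseudo-Riemannian metrics\<close>

text \<open>Signature \<open>(p, q)\<close>: \<open>p\<close> positive and \<open>q\<close> negative squares.\<close>

definition has_signature :: "(real^'n \<Rightarrow> real^'n \<Rightarrow> real) \<Rightarrow> nat \<Rightarrow> nat \<Rightarrow> bool" where
  "has_signature B p q \<longleftrightarrow>
     (\<exists>(b :: 'n \<Rightarrow> real^'n) P.
        inj b \<and> independent (range b) \<and> card P = p \<and> card (- P) = q \<and>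
        (\<forall>i j. B (b i) (b j) = (if i \<noteq> j then 0 else if i \<in> P then 1 else - 1)))"

definition pseudo_riemannian_metric ::
    "('m::topological_space, 'n::finite) chart set \<Rightarrow>
     ('m \<Rightarrow> real^'n \<Rightarrow> real^'n \<Rightarrow> real) \<Rightarrow> bool" where
  "pseudo_riemannian_metric A g \<longleftrightarrow>
     (\<forall>q. bilinear (g q) \<and> (\<forall>u v. g q u v = g q v u) \<and>
          (\<forall>u. (\<forall>v. g q u v = 0) \<longrightarrow> u = 0)) \<and>
     (\<forall>X Y. vector_field A X \<longrightarrow> vector_field A Y \<longrightarrow> smooth_function A (\<lambda>q. g q (X q) (Y q)))"

definition metric_signature :: "('m \<Rightarrow> real^'n \<Rightarrow> real^'n \<Rightarrow> real) \<Rightarrow> nat \<Rightarrow> nat \<Rightarrow> bool" where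
  "metric_signature g p q \<longleftrightarrow> (\<forall>x. has_signature (g x) p q)"

definition levi_civita_connection ::
    "('m::topological_space, 'n::finite) chart set \<Rightarrow>
     ('m \<Rightarrow> real^'n \<Rightarrow> real^'n \<Rightarrow> real) \<Rightarrow> ('m, 'n) connection \<Rightarrow> bool" where
  "levi_civita_connection A g nabla \<longleftrightarrow>
     affine_connection A nabla \<and> torsion_free A nabla \<and>
     (\<forall>X Y Z p. vector_field A X \<longrightarrow> vector_field A Y \<longrightarrow> vector_field A Z \<longrightarrow>
        field_deriv A X (\<lambda>q. g q (Y q) (Z q)) p =
          g p (nabla X Y p) (Z p) + g p (Y p) (nabla X Z p))"

end

theory Submission
  imports Defs
begin

text \<open>
  Since all the Lie algebras vanish, so do all \<open>\<nabla>\<^sup>j R\<close> at \<open>x\<close>. Knowing this for every \<open>j\<close> at once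
  shows, by induction on \<open>k\<close>, that the components of \<open>R\<close> in a chart vanish to order \<open>k\<close> at \<open>x\<close>,
  because a derivative of \<open>\<nabla>\<^sup>j R(Y\<^sub>1, \<dots>)\<close> is a combination of \<open>\<nabla>\<^sup>j\<^sup>+\<^sup>1 R\<close> and \<open>\<nabla>\<^sup>j R\<close>. Being
  analytic along line segments, \<open>R\<close> vanishes near \<open>x\<close>, and then everywhere by connectedness.
  The connection being flat, the equation \<open>d\<theta>(Y) = \<theta>(\<nabla>Y)\<close> for parallel covectors is integrable, so
  it has local solutions with arbitrary initial value; by simple connectedness
  there is no monodromy and the solutions are global. Let \<open>\<theta>\<^sub>k\<close> be the parallel covectors that form a
  basis at \<open>x\<close>, hence everywhere: \<open>\<Sum>\<^sub>k \<plusminus> \<theta>\<^sub>k \<otimes> \<theta>\<^sub>k\<close> is a parallel metric, of any signature desired.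
\<close>

section \<open>Smooth functions\<close>

text \<open>\<open>nabla\<close> acts on globally defined fields, whereas components live in a
  chart. The bridge is a bump function: in a chart, the test fields are \<open>\<psi>\<close> times
  a constant vector with \<open>\<psi>\<close> positive at the point in question, and
  \<open>\<psi>\<close> is divided out of the resulting identities. Parallel covectors serve better
  than parallel vectors because a metric is a quadratic polynomial in covectors: smoothness and
  compatibility pass to it by the product rule, with no frame to invert. Analyticity enters through
  restrictions to lines only. There, power series in one variable supply both facts that matter: a
  function which is \<open>O(t^k)\<close> for every \<open>k\<close> vanishes near 0, and the zeros
  are either isolated or fill a neighbourhood. The equation for parallel covectors is solved along
  rays. That the endpoint values depend differentiably on the ray is shown by a direct estimate, in
  which integrability removes the linear part of the error.\<close>

lemma frechet_derivative_cong_open: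
  assumes "open S" "x \<in> S" "\<And>y. y \<in> S \<Longrightarrow> f y = g y"
  shows "frechet_derivative f (at x) = frechet_derivative g (at x)"
proof -
  have "(f has_derivative D) (at x) \<longleftrightarrow> (g has_derivative D) (at x)" for D
    using assms has_derivative_transform_within_open[of f D x UNIV S g]
      has_derivative_transform_within_open[of g D x UNIV S f] by auto
  then show ?thesis unfolding frechet_derivative_def by simp
qed

lemma differentiable_cong_open:
  assumes "open S" "x \<in> S" "\<And>y. y \<in> S \<Longrightarrow> f y = g y"
  shows "f differentiable at x \<longleftrightarrow> g differentiable at x"
  using assms has_derivative_transform_within_open[of f _ x UNIV S g]
      has_derivative_transform_within_open[of g _ x UNIV S f] unfolding differentiable_def by metis

lemma has_derivative_frechet:
  "f differentiable at x \<Longrightarrow> (f has_derivative frechet_derivative f (at x)) (at x)"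
  using frechet_derivative_works by blast

lemma frechet_eqI: "(f has_derivative f') (at x) \<Longrightarrow> frechet_derivative f (at x) = f'"
  using frechet_derivative_at by metis

lemma Ck_on_cong:
  assumes "open S" "\<And>x. x \<in> S \<Longrightarrow> f x = g x"
  shows "Ck_on k S f \<longleftrightarrow> Ck_on k S g"
  using assms(2)
proof (induction k arbitrary: f g)
  case 0 then show ?case by (auto cong: continuous_on_cong)
next
  case (Suc k)
  have "\<And>v. Ck_on k S (\<lambda>x. frechet_derivative f (at x) v) \<longleftrightarrow> Ck_on k S (\<lambda>x. frechet_derivative g (at x) v)"
    by (rule Suc.IH) (use frechet_derivative_cong_open[OF assms(1) _ Suc.prems] in simp)
  moreover have "\<And>x. x \<in> S \<Longrightarrow> f differentiable at x \<longleftrightarrow> g differentiable at x"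
    by (rule differentiable_cong_open[OF assms(1) _ Suc.prems])
  ultimately show ?case by simp
qed

lemma Ck_on_subset: "Ck_on k S f \<Longrightarrow> T \<subseteq> S \<Longrightarrow> Ck_on k T f"
proof (induction k arbitrary: f)
  case 0 then show ?case by (auto intro: continuous_on_subset)
next
  case (Suc k) then show ?case by (simp) blast
qed

lemma Ck_on_SucD: "Ck_on (Suc k) S f \<Longrightarrow> Ck_on k S f"
proof (induction k arbitrary: f)
  case 0 then show ?case
    by (auto intro!: continuous_at_imp_continuous_on differentiable_imp_continuous_within)
next
  case (Suc k) then show ?case by simp
qed

text \<open>Lets a derivative be given by a formula, so that the inductions below never have to
  manipulate \<open>frechet_derivative\<close> of a compound function.\<close>

lemma Ck_on_SucI:
  assumes "open S" "\<And>x. x \<in> S \<Longrightarrow> (f has_derivative f' x) (at x)" "\<And>v. Ck_on k S (\<lambda>x. f' x v)"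
  shows "Ck_on (Suc k) S f"
proof -
  have "Ck_on k S (\<lambda>x. frechet_derivative f (at x) v)" for v
    by (rule iffD1[OF Ck_on_cong[OF assms(1)] assms(3)[of v]]) (use frechet_eqI[OF assms(2)] in simp)
  then show ?thesis using assms(2) by (auto simp: differentiable_def)
qed

lemma Ck_on_local:
  assumes "\<And>x. x \<in> S \<Longrightarrow> \<exists>U. open U \<and> x \<in> U \<and> Ck_on k U f"
  shows "Ck_on k S f"
  using assms
proof (induction k arbitrary: f)
  case 0
  then show ?case
    by (auto intro!: continuous_at_imp_continuous_on) (metis continuous_on_eq_continuous_at)
next
  case (Suc k)
  have "f differentiable at x" if "x \<in> S" for x using Suc.prems[OF that] by auto
  moreover have "Ck_on k S (\<lambda>x. frechet_derivative f (at x) v)" for v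
    by (rule Suc.IH) (use Suc.prems in fastforce)
  ultimately show ?case by simp
qed

lemma Ck_on_const: "open S \<Longrightarrow> Ck_on k S (\<lambda>x. c)"
proof (induction k arbitrary: c)
  case (Suc k) then show ?case by (intro Ck_on_SucI[where f'="\<lambda>x v. 0"]) auto
qed simp

lemma Ck_on_bounded_linear: "open S \<Longrightarrow> bounded_linear f \<Longrightarrow> Ck_on k S f"
proof (induction k)
  case 0 then show ?case by (simp add: linear_continuous_on)
next
  case (Suc k) then show ?case
    by (intro Ck_on_SucI[where f'="\<lambda>x. f"]) (auto intro: bounded_linear_imp_has_derivative Ck_on_const)
qed

lemma Ck_on_add: "open S \<Longrightarrow> Ck_on k S f \<Longrightarrow> Ck_on k S g \<Longrightarrow> Ck_on k S (\<lambda>x. f x + g x)"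
proof (induction k arbitrary: f g)
  case 0 then show ?case by (simp add: continuous_on_add)
next
  case (Suc k) then show ?case
    by (intro Ck_on_SucI[where f'="\<lambda>x v. frechet_derivative f (at x) v + frechet_derivative g (at x) v"])
       (auto intro!: has_derivative_add has_derivative_frechet)
qed

lemma Ck_on_sum:
  assumes "open S" "\<And>i. i \<in> I \<Longrightarrow> Ck_on k S (f i)" shows "Ck_on k S (\<lambda>x. \<Sum>i\<in>I. f i x)"
  using assms(2)
  by (induction I rule: infinite_finite_induct) (auto intro!: Ck_on_const Ck_on_add assms(1))

text \<open>The Leibniz rule expresses the derivative by two terms of the same bilinear form, so one
  induction serves for real, scalar and inner products.\<close>

lemma Ck_on_bilinear:
  assumes B: "bounded_bilinear B" and S: "open S"
  shows "Ck_on k S f \<Longrightarrow> Ck_on k S g \<Longrightarrow> Ck_on k S (\<lambda>x. B (f x) (g x))"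
proof (induction k arbitrary: f g)
  case 0 then show ?case using bounded_bilinear.continuous_on[OF B] by auto
next
  case (Suc k)
  show ?case
  proof (intro Ck_on_SucI[OF S, where f'="\<lambda>x v. B (f x) (frechet_derivative g (at x) v) + B (frechet_derivative f (at x) v) (g x)"])
    fix x assume "x \<in> S"
    then show "((\<lambda>x. B (f x) (g x)) has_derivative (\<lambda>v. B (f x) (frechet_derivative g (at x) v) + B (frechet_derivative f (at x) v) (g x))) (at x)"
      using Suc.prems by (auto intro!: bounded_bilinear.FDERIV[OF B] has_derivative_frechet)
  next
    fix v show "Ck_on k S (\<lambda>x. B (f x) (frechet_derivative g (at x) v) + B (frechet_derivative f (at x) v) (g x))"
      using Suc.prems Ck_on_SucD[OF Suc.prems(1)] Ck_on_SucD[OF Suc.prems(2)] by (intro Ck_on_add S Suc.IH) auto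
  qed
qed

lemma Ck_on_linear_compose:
  assumes B: "bounded_linear h" and S: "open S"
  shows "Ck_on k S f \<Longrightarrow> Ck_on k S (\<lambda>x. h (f x))"
proof (induction k arbitrary: f)
  case 0 then show ?case using bounded_linear.continuous_on[OF B] by auto
next
  case (Suc k) then show ?case
    by (intro Ck_on_SucI[OF S, where f'="\<lambda>x v. h (frechet_derivative f (at x) v)"])
       (auto intro!: bounded_linear.has_derivative[OF B] has_derivative_frechet)
qed

text \<open>\<open>Ck_on\<close> speaks of derivatives in fixed directions. When the direction
  varies with the point, this expansion reduces the matter to finitely many fixed ones.\<close>

lemma frechet_euclidean_sum:
  fixes f :: "'a::euclidean_space \<Rightarrow> 'b::real_normed_vector"
  assumes "f differentiable at x"
  shows "frechet_derivative f (at x) v = (\<Sum>b\<in>Basis. (v \<bullet> b) *\<^sub>R frechet_derivative f (at x) b)"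
proof -
  have l: "linear (frechet_derivative f (at x))" using assms by (rule linear_frechet_derivative)
  have "frechet_derivative f (at x) v = frechet_derivative f (at x) (\<Sum>b\<in>Basis. (v \<bullet> b) *\<^sub>R b)"
    by (simp add: euclidean_representation)
  also have "\<dots> = (\<Sum>b\<in>Basis. (v \<bullet> b) *\<^sub>R frechet_derivative f (at x) b)"
    by (simp add: linear_sum[OF l] linear_scale[OF l] o_def)
  finally show ?thesis .
qed

lemma Ck_on_frechet_apply:
  fixes f :: "'a::euclidean_space \<Rightarrow> 'b::real_normed_vector"
  assumes "open S" "Ck_on (Suc k) S f" "Ck_on k S g"
  shows "Ck_on k S (\<lambda>x. frechet_derivative f (at x) (g x))"
proof -
  have "Ck_on k S (\<lambda>x. \<Sum>b\<in>Basis. (g x \<bullet> b) *\<^sub>R frechet_derivative f (at x) b)"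
    using assms by (intro Ck_on_sum Ck_on_bilinear[OF bounded_bilinear_scaleR]
      Ck_on_linear_compose[OF bounded_linear_inner_left]) auto
  then show ?thesis
    by (rule iffD1[OF Ck_on_cong[OF assms(1)], rotated]) (use assms(2) in \<open>auto intro: frechet_euclidean_sum[symmetric]\<close>)
qed

text \<open>By the chain rule the derivative of \<open>f\<close> at \<open>g x\<close> is applied to
  a direction that depends on \<open>x\<close>. After expansion in the basis only the compositions
  of \<open>g\<close> with fixed partial derivatives of \<open>f\<close> remain, and these fall
  under the induction hypothesis.\<close>

lemma Ck_on_compose:
  fixes f :: "'b::euclidean_space \<Rightarrow> 'c::real_normed_vector"
  assumes "open S" "open T"
  shows "Ck_on k T f \<Longrightarrow> Ck_on k S g \<Longrightarrow> g ` S \<subseteq> T \<Longrightarrow> Ck_on k S (\<lambda>x. f (g x))"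
proof (induction k arbitrary: f)
  case 0 then show ?case using continuous_on_compose2 by auto
next
  case (Suc k)
  show ?case
  proof (rule Ck_on_SucI[OF assms(1), where f'="\<lambda>x v. frechet_derivative f (at (g x)) (frechet_derivative g (at x) v)"])
    fix x assume "x \<in> S"
    then show "((\<lambda>x. f (g x)) has_derivative (\<lambda>v. frechet_derivative f (at (g x)) (frechet_derivative g (at x) v))) (at x)"
      using Suc.prems by (intro has_derivative_compose[where f=g and g=f] has_derivative_frechet) auto
  next
    fix v
    have "Ck_on k S (\<lambda>x. \<Sum>b\<in>Basis. (frechet_derivative g (at x) v \<bullet> b) *\<^sub>R frechet_derivative f (at (g x)) b)"
      using Suc.prems Ck_on_SucD[OF Suc.prems(2)] assms
      by (intro Ck_on_sum Ck_on_bilinear[OF bounded_bilinear_scaleR] Suc.IH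
       Ck_on_linear_compose[OF bounded_linear_inner_left]) auto
    then show "Ck_on k S (\<lambda>x. frechet_derivative f (at (g x)) (frechet_derivative g (at x) v))"
      by (rule iffD1[OF Ck_on_cong[OF assms(1)], rotated])
         (use Suc.prems in \<open>auto intro!: frechet_euclidean_sum[symmetric]\<close>)
  qed
qed

lemma Ck_on_components:
  fixes f :: "'a::real_normed_vector \<Rightarrow> 'b::euclidean_space"
  assumes "open S" "\<And>b. b \<in> Basis \<Longrightarrow> Ck_on k S (\<lambda>x. f x \<bullet> b)"
  shows "Ck_on k S f"
proof -
  have "Ck_on k S (\<lambda>x. \<Sum>b\<in>Basis. (f x \<bullet> b) *\<^sub>R b)"
    using assms by (intro Ck_on_sum Ck_on_bilinear[OF bounded_bilinear_scaleR] Ck_on_const) auto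
  then show ?thesis by (simp add: euclidean_representation)
qed

lemma smooth_on_cong: "open S \<Longrightarrow> (\<And>x. x \<in> S \<Longrightarrow> f x = g x) \<Longrightarrow> smooth_on S f \<Longrightarrow> smooth_on S g"
  unfolding smooth_on_def using Ck_on_cong[of S f g] by blast

lemma smooth_on_subset: "smooth_on S f \<Longrightarrow> T \<subseteq> S \<Longrightarrow> smooth_on T f"
  unfolding smooth_on_def using Ck_on_subset by blast

lemma smooth_on_local:
  "(\<And>x. x \<in> S \<Longrightarrow> \<exists>U. open U \<and> x \<in> U \<and> smooth_on U f) \<Longrightarrow> smooth_on S f"
  unfolding smooth_on_def by (metis Ck_on_local)

lemma smooth_on_const: "open S \<Longrightarrow> smooth_on S (\<lambda>x. c)"
  unfolding smooth_on_def by (simp add: Ck_on_const)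

lemma smooth_on_id: "open S \<Longrightarrow> smooth_on S (\<lambda>x. x)"
  unfolding smooth_on_def by (simp add: Ck_on_bounded_linear bounded_linear_ident)

lemma smooth_on_add: "open S \<Longrightarrow> smooth_on S f \<Longrightarrow> smooth_on S g \<Longrightarrow> smooth_on S (\<lambda>x. f x + g x)"
  unfolding smooth_on_def by (simp add: Ck_on_add)

lemma smooth_on_sum:
  "open S \<Longrightarrow> (\<And>i. i \<in> I \<Longrightarrow> smooth_on S (f i)) \<Longrightarrow> smooth_on S (\<lambda>x. \<Sum>i\<in>I. f i x)"
  unfolding smooth_on_def by (simp add: Ck_on_sum)

lemma smooth_on_bilinear:
  "bounded_bilinear B \<Longrightarrow> open S \<Longrightarrow> smooth_on S f \<Longrightarrow> smooth_on S g \<Longrightarrow> smooth_on S (\<lambda>x. B (f x) (g x))"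
  unfolding smooth_on_def by (simp add: Ck_on_bilinear)

lemmas smooth_on_scaleR = smooth_on_bilinear[OF bounded_bilinear_scaleR]
lemmas smooth_on_mult = smooth_on_bilinear[OF bounded_bilinear_mult]
lemmas smooth_on_inner = smooth_on_bilinear[OF bounded_bilinear_inner]

lemma smooth_on_linear_compose:
  "bounded_linear h \<Longrightarrow> open S \<Longrightarrow> smooth_on S f \<Longrightarrow> smooth_on S (\<lambda>x. h (f x))"
  unfolding smooth_on_def by (simp add: Ck_on_linear_compose)

lemmas smooth_on_nth = smooth_on_linear_compose[OF bounded_linear_vec_nth]
lemmas smooth_on_uminus = smooth_on_linear_compose[OF bounded_linear_minus[OF bounded_linear_ident]]

lemma smooth_on_diff: "open S \<Longrightarrow> smooth_on S f \<Longrightarrow> smooth_on S g \<Longrightarrow> smooth_on S (\<lambda>x. f x - g x)"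
  using smooth_on_add[of S f "\<lambda>x. - g x"] smooth_on_uminus[of S g] by simp

lemma smooth_on_compose:
  fixes f :: "'b::euclidean_space \<Rightarrow> 'c::real_normed_vector"
  shows "open S \<Longrightarrow> open T \<Longrightarrow> smooth_on T f \<Longrightarrow> smooth_on S g \<Longrightarrow> g ` S \<subseteq> T \<Longrightarrow> smooth_on S (\<lambda>x. f (g x))"
  unfolding smooth_on_def by (simp add: Ck_on_compose)

lemma smooth_on_frechet_apply:
  fixes f :: "'a::euclidean_space \<Rightarrow> 'b::real_normed_vector"
  shows "open S \<Longrightarrow> smooth_on S f \<Longrightarrow> smooth_on S g \<Longrightarrow> smooth_on S (\<lambda>x. frechet_derivative f (at x) (g x))"
  unfolding smooth_on_def by (simp add: Ck_on_frechet_apply del: Ck_on.simps)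

lemma smooth_on_frechet: "smooth_on S f \<Longrightarrow> smooth_on S (\<lambda>x. frechet_derivative f (at x) v)"
  unfolding smooth_on_def by (metis Ck_on.simps(2))

lemma smooth_on_components:
  fixes f :: "'a::real_normed_vector \<Rightarrow> 'b::euclidean_space"
  assumes "open S" "\<And>b. b \<in> Basis \<Longrightarrow> smooth_on S (\<lambda>x. f x \<bullet> b)"
  shows "smooth_on S f"
  using assms unfolding smooth_on_def by (auto intro: Ck_on_components)

lemma smooth_on_vecI:
  fixes f :: "'a::real_normed_vector \<Rightarrow> real^'k"
  assumes "open S" "\<And>i. smooth_on S (\<lambda>x. f x $ i)"
  shows "smooth_on S f"
  by (rule smooth_on_components) (use assms in \<open>auto simp: Basis_vec_def inner_axis\<close>)

lemma smooth_on_differentiable: "smooth_on S f \<Longrightarrow> x \<in> S \<Longrightarrow> f differentiable at x"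
  unfolding smooth_on_def by (metis Ck_on.simps(2))

lemma smooth_on_has_derivative:
  "smooth_on S f \<Longrightarrow> x \<in> S \<Longrightarrow> (f has_derivative frechet_derivative f (at x)) (at x)"
  by (simp add: smooth_on_differentiable has_derivative_frechet)

lemma smooth_on_continuous: "smooth_on S f \<Longrightarrow> continuous_on S f"
  unfolding smooth_on_def by (metis Ck_on.simps(1))

section \<open>Symmetry of second derivatives and first-order Taylor estimates\<close>

lemma has_derivative_along_line:
  assumes "f differentiable at (x + s *\<^sub>R u)"
  shows "((\<lambda>s. f (x + s *\<^sub>R u)) has_vector_derivative frechet_derivative f (at (x + s *\<^sub>R u)) u) (at s within T)"
proof -
  have "((\<lambda>s. f (x + s *\<^sub>R u)) has_derivative (\<lambda>h. frechet_derivative f (at (x + s *\<^sub>R u)) (h *\<^sub>R u))) (at s within T)"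
    by (rule has_derivative_compose[of "\<lambda>s. x + s *\<^sub>R u" "\<lambda>h. h *\<^sub>R u" s T f "frechet_derivative f (at (x + s *\<^sub>R u))"])
       (auto intro!: derivative_eq_intros has_derivative_frechet assms)
  then show ?thesis
    by (simp add: has_vector_derivative_def linear_scale[OF linear_frechet_derivative[OF assms]])
qed

text \<open>Mean value theorem applied twice to the second difference of \<open>f\<close>.\<close>

lemma second_difference:
  fixes f :: "'a::real_normed_vector \<Rightarrow> real"
  assumes S: "smooth_on S f" and t: "0 < t"
    and sub: "\<And>a b. \<lbrakk>0 \<le> a; a \<le> t; 0 \<le> b; b \<le> t\<rbrakk> \<Longrightarrow> x + a *\<^sub>R u + b *\<^sub>R v \<in> S"
  shows "\<exists>a b. 0 < a \<and> a < t \<and> 0 < b \<and> b < t \<and>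
    f (x + t *\<^sub>R u + t *\<^sub>R v) - f (x + t *\<^sub>R u) - f (x + t *\<^sub>R v) + f x
      = t\<^sup>2 * frechet_derivative (\<lambda>y. frechet_derivative f (at y) u) (at (x + a *\<^sub>R u + b *\<^sub>R v)) v"
proof -
  let ?g = "\<lambda>s. f ((x + t *\<^sub>R v) + s *\<^sub>R u) - f (x + s *\<^sub>R u)"
  let ?g' = "\<lambda>s. frechet_derivative f (at ((x + t *\<^sub>R v) + s *\<^sub>R u)) u - frechet_derivative f (at (x + s *\<^sub>R u)) u"
  have d: "(?g has_field_derivative ?g' s) (at s)" if "0 \<le> s" "s \<le> t" for s
    unfolding has_real_derivative_iff_has_vector_derivative
    by (intro has_vector_derivative_diff has_derivative_along_line smooth_on_differentiable[OF S])
       (use sub[of s t] sub[of s 0] that t in \<open>auto simp: algebra_simps\<close>)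
  obtain a where a: "0 < a" "a < t" "?g t - ?g 0 = (t - 0) * ?g' a"
    using MVT2[OF t, of ?g ?g'] d by auto
  let ?F = "\<lambda>y. frechet_derivative f (at y) u"
  have d2: "((\<lambda>b. ?F ((x + a *\<^sub>R u) + b *\<^sub>R v)) has_field_derivative frechet_derivative ?F (at ((x + a *\<^sub>R u) + b *\<^sub>R v)) v) (at b)"
    if "0 \<le> b" "b \<le> t" for b
    unfolding has_real_derivative_iff_has_vector_derivative
    by (intro has_derivative_along_line smooth_on_differentiable[OF smooth_on_frechet[OF S]])
       (use sub[of a b] that a in auto)
  obtain b where b: "0 < b" "b < t"
     "?F ((x + a *\<^sub>R u) + t *\<^sub>R v) - ?F ((x + a *\<^sub>R u) + 0 *\<^sub>R v) = (t - 0) * frechet_derivative ?F (at ((x + a *\<^sub>R u) + b *\<^sub>R v)) v"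
    using MVT2[OF t, of "\<lambda>b. ?F ((x + a *\<^sub>R u) + b *\<^sub>R v)" "\<lambda>b. frechet_derivative ?F (at ((x + a *\<^sub>R u) + b *\<^sub>R v)) v"] d2 by auto
  have e: "x + t *\<^sub>R v + a *\<^sub>R u = x + a *\<^sub>R u + t *\<^sub>R v" "x + t *\<^sub>R v + t *\<^sub>R u = x + t *\<^sub>R u + t *\<^sub>R v" by simp_all
  have "f (x + t *\<^sub>R u + t *\<^sub>R v) - f (x + t *\<^sub>R u) - f (x + t *\<^sub>R v) + f x = ?g t - ?g 0"
    unfolding e by simp
  also have "\<dots> = t * ?g' a" using a(3) by simp
  also have "\<dots> = t * (?F ((x + a *\<^sub>R u) + t *\<^sub>R v) - ?F ((x + a *\<^sub>R u) + 0 *\<^sub>R v))"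
    unfolding e by simp
  also have "\<dots> = t\<^sup>2 * frechet_derivative ?F (at (x + a *\<^sub>R u + b *\<^sub>R v)) v"
    unfolding b(3) by (simp add: power2_eq_square)
  finally have "f (x + t *\<^sub>R u + t *\<^sub>R v) - f (x + t *\<^sub>R u) - f (x + t *\<^sub>R v) + f x
    = t\<^sup>2 * frechet_derivative ?F (at (x + a *\<^sub>R u + b *\<^sub>R v)) v" .
  then show ?thesis using a(1,2) b(1,2) by blast
qed

text \<open>The second difference is symmetric in \<open>u\<close> and \<open>v\<close>, so the two
  mixed derivatives take equal values at points arbitrarily close to \<open>x\<close>; continuity
  forces equality at \<open>x\<close> itself.\<close>

lemma frechet_second_symmetric_real:
  fixes f :: "'a::real_normed_vector \<Rightarrow> real"
  assumes S: "smooth_on S f" and o: "open S" and x: "x \<in> S"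
  shows "frechet_derivative (\<lambda>y. frechet_derivative f (at y) u) (at x) v
       = frechet_derivative (\<lambda>y. frechet_derivative f (at y) v) (at x) u"
proof (rule ccontr)
  define F where "F u v y = frechet_derivative (\<lambda>y. frechet_derivative f (at y) u) (at y) v" for u v y
  assume "\<not> ?thesis"
  then have ne: "F u v x \<noteq> F v u x" by (simp add: F_def)
  \<comment> \<open>Half the gap: two equal numbers cannot both lie strictly within \<open>e\<close>
    of the two distinct limits.\<close>
  define e where "e = \<bar>F u v x - F v u x\<bar> / 2"
  have e: "e > 0" using ne by (simp add: e_def)
  have c: "continuous (at x) (F u v)" for u v
    unfolding F_def using smooth_on_continuous[OF smooth_on_frechet[OF smooth_on_frechet[OF S]]] o x
    by (simp add: continuous_on_eq_continuous_at)
  obtain d1 where d1: "d1 > 0" "\<And>y. dist y x < d1 \<Longrightarrow> dist (F u v y) (F u v x) < e"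
    using c[of u v] e unfolding continuous_at_eps_delta by metis
  obtain d2 where d2: "d2 > 0" "\<And>y. dist y x < d2 \<Longrightarrow> dist (F v u y) (F v u x) < e"
    using c[of v u] e unfolding continuous_at_eps_delta by metis
  obtain d3 where d3: "d3 > 0" "ball x d3 \<subseteq> S" using o x openE by blast
  define d where "d = min d1 (min d2 d3)"
  have d: "d > 0" using d1 d2 d3 by (simp add: d_def)
  \<comment> \<open>The parallelogram with sides \<open>t *\<^sub>R u\<close> and
    \<open>t *\<^sub>R v\<close> then has all its points within \<open>d / 2\<close> of
    \<open>x\<close>; the summand 1 keeps the denominator positive when \<open>u\<close> and
    \<open>v\<close> are 0.\<close>
  define t where "t = d / (2 * (norm u + norm v + 1))"
  have n: "norm u + norm v + 1 > 0" by (smt (verit) norm_ge_zero)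
  have t: "t > 0" using d n by (simp add: t_def)
  have close: "dist (x + a *\<^sub>R u + b *\<^sub>R v) x < d" if "0 \<le> a" "a \<le> t" "0 \<le> b" "b \<le> t" for a b
  proof -
    have "dist (x + a *\<^sub>R u + b *\<^sub>R v) x = norm (a *\<^sub>R u + b *\<^sub>R v)" by (simp add: dist_norm add.assoc)
    also have "\<dots> \<le> a * norm u + b * norm v" using that by (intro norm_triangle_le) auto
    also have "\<dots> \<le> t * norm u + t * norm v" using that by (intro add_mono mult_right_mono) auto
    also have "\<dots> \<le> t * (norm u + norm v + 1)" using t by (simp add: algebra_simps)
    finally have "dist (x + a *\<^sub>R u + b *\<^sub>R v) x \<le> t * (norm u + norm v + 1)" .
    moreover have "t * (2 * (norm u + norm v + 1)) = d" unfolding t_def using n by simp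
    ultimately show ?thesis using d by linarith
  qed
  have cl2: "dist (x + b *\<^sub>R v + a *\<^sub>R u) x < d" if "0 \<le> a" "a \<le> t" "0 \<le> b" "b \<le> t" for a b
    using close[OF that] by (simp add: add.commute add.left_commute)
  have inS: "y \<in> S" if "dist y x < d" for y using d3 that by (auto simp: d_def dist_commute)
  obtain a b where ab: "0 < a" "a < t" "0 < b" "b < t"
    "f (x + t *\<^sub>R u + t *\<^sub>R v) - f (x + t *\<^sub>R u) - f (x + t *\<^sub>R v) + f x = t\<^sup>2 * F u v (x + a *\<^sub>R u + b *\<^sub>R v)"
    using second_difference[OF S t, of x u v] inS close unfolding F_def by metis
  obtain a' b' where ab': "0 < a'" "a' < t" "0 < b'" "b' < t"
    "f (x + t *\<^sub>R v + t *\<^sub>R u) - f (x + t *\<^sub>R v) - f (x + t *\<^sub>R u) + f x = t\<^sup>2 * F v u (x + a' *\<^sub>R v + b' *\<^sub>R u)"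
    using second_difference[OF S t, of x v u] inS cl2 unfolding F_def by metis
  have "x + t *\<^sub>R v + t *\<^sub>R u = x + t *\<^sub>R u + t *\<^sub>R v" by simp
  then have "t\<^sup>2 * F u v (x + a *\<^sub>R u + b *\<^sub>R v) = t\<^sup>2 * F v u (x + a' *\<^sub>R v + b' *\<^sub>R u)"
    using ab(5) ab'(5) by (metis (no_types) diff_diff_eq2 diff_diff_add add.commute)
  then have "F u v (x + a *\<^sub>R u + b *\<^sub>R v) = F v u (x + a' *\<^sub>R v + b' *\<^sub>R u)" using t by simp
  moreover have "dist (F u v (x + a *\<^sub>R u + b *\<^sub>R v)) (F u v x) < e"
    by (rule d1(2)) (use close[of a b] ab in \<open>simp add: d_def\<close>)
  moreover have "dist (F v u (x + a' *\<^sub>R v + b' *\<^sub>R u)) (F v u x) < e"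
    by (rule d2(2)) (use cl2[of b' a'] ab' in \<open>simp add: d_def\<close>)
  ultimately show False unfolding dist_real_def e_def by (smt (verit) field_sum_of_halves)
qed

lemma frechet_linear_compose:
  assumes "bounded_linear h" "f differentiable at x"
  shows "frechet_derivative (\<lambda>y. h (f y)) (at x) v = h (frechet_derivative f (at x) v)"
  using bounded_linear.has_derivative[OF assms(1) has_derivative_frechet[OF assms(2)]] frechet_eqI by metis

lemma frechet_second_symmetric:
  fixes f :: "'a::real_normed_vector \<Rightarrow> real^'k"
  assumes S: "smooth_on S f" and o: "open S" and x: "x \<in> S"
  shows "frechet_derivative (\<lambda>y. frechet_derivative f (at y) u) (at x) v
       = frechet_derivative (\<lambda>y. frechet_derivative f (at y) v) (at x) u"
proof -
  have *: "frechet_derivative (\<lambda>y. frechet_derivative f (at y) u) (at x) v $ i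
      = frechet_derivative (\<lambda>y. frechet_derivative (\<lambda>y. f y $ i) (at y) u) (at x) v" for i u v
  proof -
    have "frechet_derivative (\<lambda>y. frechet_derivative f (at y) u) (at x) v $ i
       = frechet_derivative (\<lambda>y. frechet_derivative f (at y) u $ i) (at x) v"
      using frechet_linear_compose[OF bounded_linear_vec_nth smooth_on_differentiable[OF smooth_on_frechet[OF S] x]]
      by metis
    also have "\<dots> = frechet_derivative (\<lambda>y. frechet_derivative (\<lambda>y. f y $ i) (at y) u) (at x) v"
      by (intro fun_cong[OF frechet_derivative_cong_open[OF o x]]
          frechet_linear_compose[OF bounded_linear_vec_nth smooth_on_differentiable[OF S], symmetric])
    finally show ?thesis .
  qed
  show ?thesis unfolding vec_eq_iff *
    using frechet_second_symmetric_real[OF smooth_on_nth[OF o S] o x] by metis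
qed

text \<open>Continuity is available for each directional derivative separately. Compactness bounds
  these for the basis vectors, and linearity adds up the bounds.\<close>

lemma smooth_deriv_bound:
  fixes f :: "'a::euclidean_space \<Rightarrow> 'b::real_normed_vector"
  assumes S: "smooth_on S f" and K: "compact K" "K \<subseteq> S"
  shows "\<exists>C\<ge>0. \<forall>z\<in>K. \<forall>h. norm (frechet_derivative f (at z) h) \<le> C * norm h"
proof -
  have "\<exists>C\<ge>0. \<forall>z\<in>K. norm (frechet_derivative f (at z) b) \<le> C" for b
  proof -
    have "compact ((\<lambda>z. frechet_derivative f (at z) b) ` K)"
      using K by (intro compact_continuous_image continuous_on_subset[OF smooth_on_continuous[OF smooth_on_frechet[OF S]]])
    then obtain B where "B > 0" "\<forall>y\<in>(\<lambda>z. frechet_derivative f (at z) b) ` K. norm y \<le> B"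
      using compact_imp_bounded bounded_pos by metis
    then show ?thesis by (intro exI[of _ B]) auto
  qed
  then obtain C where C: "\<And>b. C b \<ge> 0" "\<And>b z. z \<in> K \<Longrightarrow> norm (frechet_derivative f (at z) b) \<le> C b" by metis
  show ?thesis
  proof (intro exI[of _ "\<Sum>b\<in>Basis. C b"] conjI ballI allI)
    show "0 \<le> sum C Basis" by (simp add: C sum_nonneg)
    fix z h assume z: "z \<in> K"
    have "norm (frechet_derivative f (at z) h) = norm (\<Sum>b\<in>Basis. (h \<bullet> b) *\<^sub>R frechet_derivative f (at z) b)"
      using frechet_euclidean_sum[OF smooth_on_differentiable[OF S], of z h] z K by auto
    also have "\<dots> \<le> (\<Sum>b\<in>Basis. norm h * C b)"
      using z by (intro sum_norm_le) (auto intro!: mult_mono C simp: Basis_le_norm)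
    finally show "norm (frechet_derivative f (at z) h) \<le> sum C Basis * norm h"
      by (simp add: sum_distrib_left mult.commute)
  qed
qed

lemma smooth_lipschitz:
  fixes f :: "'a::euclidean_space \<Rightarrow> 'b::real_normed_vector"
  assumes S: "smooth_on S f" and r: "cball a r \<subseteq> S"
  shows "\<exists>C\<ge>0. \<forall>z\<in>cball a r. \<forall>w\<in>cball a r. norm (f z - f w) \<le> C * norm (z - w)"
proof -
  obtain C where C: "C \<ge> 0" "\<forall>z\<in>cball a r. \<forall>h. norm (frechet_derivative f (at z) h) \<le> C * norm h"
    using smooth_deriv_bound[OF S compact_cball r] by blast
  show ?thesis
  proof (intro exI[of _ C] conjI ballI C(1))
    fix z w assume "z \<in> cball a r" "w \<in> cball a r"
    then show "norm (f z - f w) \<le> C * norm (z - w)"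
      using r C by (intro differentiable_bound[OF convex_cball, of a r f "\<lambda>x. frechet_derivative f (at x)"])
        (auto intro!: has_derivative_at_withinI smooth_on_has_derivative[OF S] onorm_le)
  qed
qed

lemma smooth_taylor:
  fixes f :: "'a::euclidean_space \<Rightarrow> 'b::real_normed_vector"
  assumes S: "smooth_on S f" and r: "cball a r \<subseteq> S"
  shows "\<exists>C\<ge>0. \<forall>z\<in>cball a r. \<forall>w\<in>cball a r.
    norm (f w - f z - frechet_derivative f (at z) (w - z)) \<le> C * (norm (w - z))\<^sup>2"
proof -
  have "\<exists>C\<ge>0. \<forall>z\<in>cball a r. \<forall>w\<in>cball a r.
      norm (frechet_derivative f (at z) b - frechet_derivative f (at w) b) \<le> C * norm (z - w)" for b
    by (rule smooth_lipschitz[OF smooth_on_frechet[OF S] r])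
  then obtain C where C: "\<And>b. C b \<ge> 0" "\<And>b z w. \<lbrakk>z \<in> cball a r; w \<in> cball a r\<rbrakk> \<Longrightarrow>
      norm (frechet_derivative f (at z) b - frechet_derivative f (at w) b) \<le> C b * norm (z - w)" by metis
  define K where "K = (\<Sum>b\<in>Basis. C b)"
  have K: "K \<ge> 0" by (simp add: C sum_nonneg K_def)
  have D: "norm (frechet_derivative f (at z) h - frechet_derivative f (at w) h) \<le> K * norm (z - w) * norm h"
    if "z \<in> cball a r" "w \<in> cball a r" for z w h
  proof -
    have "frechet_derivative f (at z) h - frechet_derivative f (at w) h
      = (\<Sum>b\<in>Basis. (h \<bullet> b) *\<^sub>R (frechet_derivative f (at z) b - frechet_derivative f (at w) b))"
      using frechet_euclidean_sum[OF smooth_on_differentiable[OF S], of z h]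
        frechet_euclidean_sum[OF smooth_on_differentiable[OF S], of w h] that r
      by (simp add: sum_subtractf scaleR_right_diff_distrib subset_iff)
    also have "norm \<dots> \<le> (\<Sum>b\<in>Basis. norm h * (C b * norm (z - w)))"
      using that by (intro sum_norm_le) (auto intro!: mult_mono C simp: Basis_le_norm)
    finally show ?thesis by (simp add: K_def sum_distrib_left sum_distrib_right mult_ac)
  qed
  show ?thesis
  proof (intro exI[of _ K] conjI ballI K)
    fix z w assume z: "z \<in> cball a r" and w: "w \<in> cball a r"
    \<comment> \<open>The linear part of \<open>f\<close> at \<open>z\<close> is subtracted. The
      derivative of the difference at \<open>y\<close> compares the derivatives of \<open>f\<close>
      at \<open>y\<close> and \<open>z\<close>, so it is at most \<open>K\<close> times the length
      of the segment, which provides the second factor of the square.\<close>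
    let ?g = "\<lambda>y. f y - frechet_derivative f (at z) y"
    have seg: "closed_segment z w \<subseteq> cball a r" using z w by (simp add: closed_segment_subset)
    have bl: "bounded_linear (frechet_derivative f (at z))"
      using has_derivative_bounded_linear[OF smooth_on_has_derivative[OF S, of z]] z r by blast
    have "norm (?g w - ?g z) \<le> (K * norm (w - z)) * norm (w - z)"
    proof (rule differentiable_bound[OF convex_closed_segment, of z w ?g "\<lambda>y h. frechet_derivative f (at y) h - frechet_derivative f (at z) h"])
      fix y assume y: "y \<in> closed_segment z w"
      show "(?g has_derivative (\<lambda>h. frechet_derivative f (at y) h - frechet_derivative f (at z) h)) (at y within closed_segment z w)"
        using y seg r by (intro has_derivative_diff has_derivative_at_withinI[OF smooth_on_has_derivative[OF S]]
             bounded_linear_imp_has_derivative bl) auto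
      show "onorm (\<lambda>h. frechet_derivative f (at y) h - frechet_derivative f (at z) h) \<le> K * norm (w - z)"
      proof (rule onorm_le)
        fix h
        have "norm (frechet_derivative f (at y) h - frechet_derivative f (at z) h) \<le> K * norm (y - z) * norm h"
          using y seg z by (intro D) auto
        also have "\<dots> \<le> K * norm (w - z) * norm h"
          using segment_bound(1)[OF y] K by (intro mult_right_mono mult_left_mono) auto
        finally show "norm (frechet_derivative f (at y) h - frechet_derivative f (at z) h) \<le> K * norm (w - z) * norm h" .
      qed
    qed auto
    moreover have "?g w - ?g z = f w - f z - frechet_derivative f (at z) (w - z)"
      using linear_diff[OF bounded_linear.linear[OF bl]] by simp
    ultimately show "norm (f w - f z - frechet_derivative f (at z) (w - z)) \<le> K * (norm (w - z))\<^sup>2"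
      by (simp add: power2_eq_square mult.assoc)
  qed
qed

section \<open>A smooth bump function\<close>

definition bump_profile :: "nat \<Rightarrow> real \<Rightarrow> real" where
  "bump_profile m x = (if x > 0 then exp (- inverse x) * inverse x ^ m else 0)"

lemma bump_profile_limit: "(bump_profile m \<longlongrightarrow> 0) (at_right 0)"
proof -
  have "((\<lambda>x::real. (inverse x) ^ m / exp (inverse x)) \<longlongrightarrow> 0) (at_right 0)"
    by (rule filterlim_compose[OF tendsto_power_div_exp_0 filterlim_inverse_at_top_right])
  then show ?thesis
    by (rule Lim_transform_eventually)
       (auto simp: eventually_at_filter bump_profile_def exp_minus field_simps)
qed

text \<open>The exponent \<open>m\<close> is carried along because the family of functions
  \<open>exp (-1/x) / x^m\<close> is closed under differentiation up to linear combinations;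
  smoothness of all members then follows by a single induction.\<close>

lemma bump_profile_derivative:
  "(bump_profile m has_field_derivative bump_profile (m + 2) x - real m * bump_profile (m + 1) x) (at x)"
proof -
  consider "x > 0" | "x < 0" | "x = 0" by linarith
  then show ?thesis
  proof cases
    case 1
    have "((\<lambda>x. exp (- inverse x) * inverse x ^ m) has_field_derivative
        exp (- inverse x) * (inverse x)\<^sup>2 * inverse x ^ m
        + exp (- inverse x) * (real m * inverse x ^ (m - 1) * - ((inverse x)\<^sup>2))) (at x)"
      using 1 by (auto intro!: derivative_eq_intros simp: power2_eq_square)
    \<comment> \<open>The truncated exponent \<open>m - 1\<close> is harmless for
      \<open>m = 0\<close>, where the factor \<open>real m\<close> is 0.\<close>
    moreover have "exp (- inverse x) * (real m * inverse x ^ (m - 1) * - ((inverse x)\<^sup>2))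
       = - (real m * (exp (- inverse x) * inverse x ^ (m + 1)))"
      by (cases m) (simp_all add: power2_eq_square)
    moreover have "exp (- inverse x) * (inverse x)\<^sup>2 * inverse x ^ m = exp (- inverse x) * inverse x ^ (m + 2)"
      by (simp add: power2_eq_square)
    ultimately have "((\<lambda>x. exp (- inverse x) * inverse x ^ m) has_field_derivative
        bump_profile (m + 2) x - real m * bump_profile (m + 1) x) (at x)"
      using 1 by (simp only: bump_profile_def if_True diff_conv_add_uminus)
    then show ?thesis
      by (rule has_field_derivative_transform_within_open[where S="{0<..}"]) (use 1 in \<open>auto simp: bump_profile_def\<close>)
  next
    case 2
    have "((\<lambda>x. 0) has_field_derivative bump_profile (m + 2) x - real m * bump_profile (m + 1) x) (at x)"
      using 2 by (auto simp: bump_profile_def)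
    then show ?thesis
      by (rule has_field_derivative_transform_within_open[where S="{..<0}"]) (use 2 in \<open>auto simp: bump_profile_def\<close>)
  next
    case 3
    have "((\<lambda>y. (bump_profile m y - bump_profile m 0) / (y - 0)) \<longlongrightarrow> 0) (at 0)"
    proof (rule filterlim_split_at)
      \<comment> \<open>To the right of 0 the difference quotient is
        \<open>bump_profile (Suc m)\<close>, which tends to 0 as well.\<close>
      show "((\<lambda>y. (bump_profile m y - bump_profile m 0) / (y - 0)) \<longlongrightarrow> 0) (at_right 0)"
        by (rule Lim_transform_eventually[OF bump_profile_limit[of "Suc m"]])
           (auto simp: eventually_at_filter bump_profile_def field_simps)
      show "((\<lambda>y. (bump_profile m y - bump_profile m 0) / (y - 0)) \<longlongrightarrow> 0) (at_left 0)"
        by (rule Lim_transform_eventually[OF tendsto_const])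
           (auto simp: eventually_at_filter bump_profile_def)
    qed
    then show ?thesis using 3 by (simp add: has_field_derivative_iff bump_profile_def)
  qed
qed

lemma Ck_on_bump_profile: "Ck_on k UNIV (bump_profile m)"
proof (induction k arbitrary: m)
  case 0
  show ?case using bump_profile_derivative
    by (auto intro!: continuous_at_imp_continuous_on DERIV_isCont)
next
  case (Suc k)
  show ?case
  proof (rule Ck_on_SucI[where f'="\<lambda>x v. (bump_profile (m + 2) x + (- real m) * bump_profile (m + 1) x) * v"])
    show "(bump_profile m has_derivative (\<lambda>v. (bump_profile (m + 2) x + - real m * bump_profile (m + 1) x) * v)) (at x)" for x
      using bump_profile_derivative[of m x] by (simp add: has_field_derivative_def)
    show "Ck_on k UNIV (\<lambda>x. (bump_profile (m + 2) x + - real m * bump_profile (m + 1) x) * v)" for v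
      by (intro Ck_on_bilinear[OF bounded_bilinear_mult] Ck_on_add Ck_on_const Suc open_UNIV)
  qed auto
qed

definition bump :: "'a::euclidean_space \<Rightarrow> real \<Rightarrow> 'a \<Rightarrow> real" where
  "bump a r z = bump_profile 0 (r\<^sup>2 - (z - a) \<bullet> (z - a))"

lemma smooth_on_bump: "open S \<Longrightarrow> smooth_on S (bump a r)"
proof -
  assume S: "open S"
  have "smooth_on UNIV (bump_profile 0)" by (simp add: smooth_on_def Ck_on_bump_profile)
  then have "smooth_on S (\<lambda>z. bump_profile 0 (r\<^sup>2 - (z - a) \<bullet> (z - a)))"
    by (rule smooth_on_compose[OF S open_UNIV])
       (auto intro!: smooth_on_diff smooth_on_inner smooth_on_const smooth_on_id S)
  then show ?thesis unfolding bump_def[abs_def] .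
qed

lemma bump_pos: "r > 0 \<Longrightarrow> z \<in> ball a r \<Longrightarrow> bump a r z > 0"
proof -
  assume r: "r > 0" "z \<in> ball a r"
  then have "(norm (z - a))\<^sup>2 < r\<^sup>2" by (intro power_strict_mono) (auto simp: dist_norm norm_minus_commute)
  then show ?thesis by (simp add: bump_def bump_profile_def power2_norm_eq_inner)
qed

lemma bump_zero: "r > 0 \<Longrightarrow> z \<notin> ball a r \<Longrightarrow> bump a r z = 0"
proof -
  assume r: "r > 0" "z \<notin> ball a r"
  then have "r\<^sup>2 \<le> (norm (z - a))\<^sup>2" by (intro power_mono) (auto simp: dist_norm norm_minus_commute)
  then show ?thesis by (simp add: bump_def bump_profile_def power2_norm_eq_inner)
qed

section \<open>Real-analytic functions\<close>

definition vmono :: "('n::finite \<Rightarrow> nat) \<Rightarrow> real^'n \<Rightarrow> real" where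
  "vmono \<alpha> w = (\<Prod>i\<in>UNIV. w $ i ^ \<alpha> i)"

text \<open>The partial derivative of \<open>vmono \<alpha>\<close> in the coordinate
  \<open>i\<close>. The truncated subtraction does no harm, since the factor
  \<open>\<alpha> i\<close> is then 0.\<close>

definition vmono_diff :: "'n::finite \<Rightarrow> ('n \<Rightarrow> nat) \<Rightarrow> real^'n \<Rightarrow> real" where
  "vmono_diff i \<alpha> w = real (\<alpha> i) * w $ i ^ (\<alpha> i - 1) * (\<Prod>j\<in>UNIV - {i}. w $ j ^ \<alpha> j)"

lemma real_analytic_at_real:
  "real_analytic_at a (f :: real^'n \<Rightarrow> real) \<longleftrightarrow>
    (\<exists>r>0. \<exists>c. \<forall>z\<in>ball a r. ((\<lambda>\<alpha>. vmono \<alpha> (z - a) * c \<alpha>) has_sum f z) UNIV)"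
  by (simp add: real_analytic_at_def vmono_def)

lemma real_analytic_at_nth:
  assumes "real_analytic_at a f" shows "real_analytic_at a (\<lambda>z. f z $ k)"
proof -
  obtain r coef where r: "r > 0" "\<forall>z\<in>ball a r.
        ((\<lambda>\<alpha>. (\<Prod>i\<in>UNIV. (z $ i - a $ i) ^ \<alpha> i) *\<^sub>R coef \<alpha>) has_sum f z) UNIV"
    using assms unfolding real_analytic_at_def by blast
  have "((\<lambda>\<alpha>. (\<Prod>i\<in>UNIV. (z $ i - a $ i) ^ \<alpha> i) *\<^sub>R (coef \<alpha> $ k)) has_sum f z $ k) UNIV"
    if "z \<in> ball a r" for z
    using has_sum_bounded_linear[OF bounded_linear_vec_nth[of k] r(2)[rule_format, OF that]] by simp
  then show ?thesis unfolding real_analytic_at_def using r(1)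
    by (intro exI[of _ r] conjI exI[of _ "\<lambda>\<alpha>. coef \<alpha> $ k"]) auto
qed

lemma vmono_has_derivative:
  "((\<lambda>z. vmono \<alpha> (z - a)) has_derivative (\<lambda>h. \<Sum>i\<in>UNIV. h $ i * vmono_diff i \<alpha> (z - a))) (at z within S)"
proof -
  have "((\<lambda>z. (z - a) $ i ^ \<alpha> i) has_derivative (\<lambda>h. h $ i * (real (\<alpha> i) * (z - a) $ i ^ (\<alpha> i - 1)))) (at z within S)" for i
    by (auto intro!: derivative_eq_intros bounded_linear.has_derivative[OF bounded_linear_vec_nth] simp: mult_ac)
  then have "((\<lambda>z. vmono \<alpha> (z - a)) has_derivative
     (\<lambda>h. \<Sum>i\<in>UNIV. h $ i * (real (\<alpha> i) * (z - a) $ i ^ (\<alpha> i - 1)) * (\<Prod>j\<in>UNIV - {i}. (z - a) $ j ^ \<alpha> j))) (at z within S)"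
    unfolding vmono_def by (rule has_derivative_prod)
  then show ?thesis by (simp add: vmono_diff_def mult.assoc)
qed

lemma vmono_scaleR: "vmono \<alpha> (t *\<^sub>R w) = t ^ sum \<alpha> UNIV * vmono \<alpha> w"
  by (simp add: vmono_def power_mult_distrib prod.distrib power_sum)

text \<open>Halving the radius pays for the factor produced by differentiation: with
  \<open>d\<close> the total degree, \<open>d * (s/2)^(d-1)\<close> equals
  \<open>2/s * d * (s/2)^d\<close>, and \<open>d \<le> 2^d\<close>. The differentiated series is
  thus dominated by the original one at the point all of whose coordinates are
  \<open>s\<close>.\<close>

lemma vmono_diff_bound:
  assumes s: "0 < s" and w: "\<And>i. \<bar>w $ i\<bar> \<le> s / 2"
  shows "\<bar>vmono_diff i \<alpha> w\<bar> \<le> 2 / s * s ^ sum \<alpha> UNIV"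
proof (cases "\<alpha> i = 0")
  case True then show ?thesis using s by (simp add: vmono_diff_def)
next
  case False
  let ?d = "sum \<alpha> UNIV"
  have d: "?d = \<alpha> i + sum \<alpha> (UNIV - {i})" by (simp add: sum.remove[of UNIV i])
  have "\<alpha> i \<le> ?d" using d by linarith
  then have m: "real (\<alpha> i) \<le> real ?d" by (rule of_nat_mono)
  have "\<bar>vmono_diff i \<alpha> w\<bar> = real (\<alpha> i) * \<bar>w $ i\<bar> ^ (\<alpha> i - 1) * (\<Prod>j\<in>UNIV - {i}. \<bar>w $ j\<bar> ^ \<alpha> j)"
    by (simp add: vmono_diff_def abs_mult power_abs abs_prod)
  also have "\<dots> \<le> real ?d * (s/2) ^ (\<alpha> i - 1) * (\<Prod>j\<in>UNIV - {i}. (s/2) ^ \<alpha> j)"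
    by (intro mult_mono m prod_mono power_mono conjI w mult_nonneg_nonneg prod_nonneg ballI
        of_nat_0_le_iff zero_le_power abs_ge_zero) (use s in auto)
  also have "\<dots> = real ?d * (s/2) ^ (?d - 1)"
    using False d by (simp add: power_sum[symmetric] power_add[symmetric])
  also have "\<dots> = real ?d * (2 / s * (s/2) ^ ?d)"
  proof -
    have "(s/2) ^ (k - 1) = 2 / s * (s/2) ^ k" if "k > 0" for k using that s by (cases k) auto
    moreover have "?d > 0" using d False by linarith
    ultimately show ?thesis by metis
  qed
  also have "\<dots> \<le> 2 ^ ?d * (2 / s * (s/2) ^ ?d)"
    using s of_nat_less_two_power[of ?d, where 'a=real] by (intro mult_right_mono) auto
  also have "\<dots> = 2 / s * s ^ ?d" by (simp add: power_divide)
  finally show ?thesis .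
qed

lemma infinite_multi_indices: "infinite (UNIV :: ('n::finite \<Rightarrow> nat) set)"
proof -
  have "inj (\<lambda>n::nat. \<lambda>_::'n. n)" by (auto simp: inj_def fun_eq_iff)
  then show ?thesis using finite_subset[OF subset_UNIV] range_inj_infinite by blast
qed

text \<open>Raising the \<open>i\<close>-th exponent by one is a bijection onto the multi-indices
  with positive \<open>i\<close>-th entry, and the terms with entry 0 vanish. So the derived series
  is again a power series.\<close>

lemma vmono_diff_has_sum:
  assumes "((\<lambda>\<alpha>. vmono_diff i \<alpha> w * c \<alpha>) has_sum D) UNIV"
  shows "((\<lambda>\<beta>. vmono \<beta> w * (real (\<beta> i + 1) * c (\<beta>(i := \<beta> i + 1)))) has_sum D) UNIV"
proof -
  define g where "g \<alpha> = vmono_diff i \<alpha> w * c \<alpha>" for \<alpha>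
  define h where "h \<beta> = \<beta>(i := \<beta> i + 1)" for \<beta> :: "'a \<Rightarrow> nat"
  have inj: "inj h"
    by (rule inj_on_inverseI[where g="\<lambda>\<alpha>. \<alpha>(i := \<alpha> i - 1)"]) (simp add: h_def)
  have img: "\<alpha> \<in> range h" if "\<alpha> i \<noteq> 0" for \<alpha>
    by (rule image_eqI[where x="\<alpha>(i := \<alpha> i - 1)"]) (use that in \<open>auto simp: h_def\<close>)
  have "(g has_sum D) (range h)"
    by (rule iffD1[OF has_sum_cong_neutral assms[folded g_def]])
       (use img in \<open>auto simp: g_def vmono_diff_def\<close>)
  then have "((g \<circ> h) has_sum D) UNIV" using has_sum_reindex[OF inj] by blast
  moreover have "g (h \<beta>) = vmono \<beta> w * (real (\<beta> i + 1) * c (\<beta>(i := \<beta> i + 1)))" for \<beta>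
  proof -
    have "(\<Prod>j\<in>UNIV - {i}. w $ j ^ (h \<beta>) j) = (\<Prod>j\<in>UNIV - {i}. w $ j ^ \<beta> j)"
      by (rule prod.cong) (auto simp: h_def)
    then show ?thesis
      by (simp add: g_def vmono_diff_def vmono_def h_def prod.remove[of UNIV i] algebra_simps)
  qed
  ultimately show ?thesis by (simp add: o_def)
qed

lemma has_sum_finite_sum:
  fixes f :: "'i \<Rightarrow> 'a \<Rightarrow> real"
  assumes "\<And>i. i \<in> I \<Longrightarrow> (f i has_sum s i) A"
  shows "((\<lambda>x. \<Sum>i\<in>I. f i x) has_sum (\<Sum>i\<in>I. s i)) A"
  using assms by (induction I rule: infinite_finite_induct) (auto intro!: has_sum_add)

text \<open>Term-by-term differentiation. Unconditional convergence at one point with equal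
  coordinates \<open>s\<close> is absolute convergence and yields a majorant on the ball of radius
  \<open>s / 2\<close>. The theorem on derivatives of series concerns sequences, hence the
  enumeration \<open>e\<close> of the multi-indices.\<close>

lemma analytic_at_derivative:
  fixes f :: "real^'n \<Rightarrow> real"
  assumes "real_analytic_at a f"
  shows "\<exists>r>0. (\<forall>z\<in>ball a r. f differentiable at z) \<and>
    (\<forall>v. real_analytic_at a (\<lambda>z. frechet_derivative f (at z) v))"
proof -
  obtain r c where r: "r > 0" and c: "\<And>z. z \<in> ball a r \<Longrightarrow> ((\<lambda>\<alpha>. vmono \<alpha> (z - a) * c \<alpha>) has_sum f z) UNIV"
    using assms unfolding real_analytic_at_real by blast
  \<comment> \<open>The point with all coordinates \<open>s\<close> has norm at most
    \<open>CARD('n) * s = r / 2\<close>, so the given series converges there.\<close>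
  define s where "s = r / (2 * CARD('n))"
  have s: "s > 0" using r by (simp add: s_def)
  have "norm (\<chi> i::'n. s) \<le> (\<Sum>i\<in>(UNIV::'n set). \<bar>s\<bar>)"
    using norm_le_l1_cart[of "\<chi> i::'n. s"] by simp
  also have "\<dots> = r / 2" using r by (simp add: s_def)
  finally have ns: "norm (\<chi> i::'n. s) < r" using r by simp
  have vs: "vmono \<alpha> (\<chi> i. s) = s ^ sum \<alpha> UNIV" for \<alpha> :: "'n \<Rightarrow> nat"
    by (simp add: vmono_def flip: power_sum)
  have "((\<lambda>\<alpha>. vmono \<alpha> (\<chi> i. s) * c \<alpha>) has_sum f (a + (\<chi> i. s))) UNIV"
    using c[of "a + (\<chi> i. s)"] ns by (simp add: dist_norm)
  then have "(\<lambda>\<alpha>. s ^ sum \<alpha> UNIV * c \<alpha>) summable_on UNIV"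
    unfolding vs by (rule has_sum_imp_summable)
  then have ab: "(\<lambda>\<alpha>. norm (s ^ sum \<alpha> UNIV * c \<alpha>)) summable_on UNIV"
    by (rule iffD1[OF summable_on_iff_abs_summable_on_real])
  define B where "B \<alpha> = 2 / s * (s ^ sum \<alpha> UNIV * \<bar>c \<alpha>\<bar>)" for \<alpha> :: "'n \<Rightarrow> nat"
  have B0: "B \<alpha> \<ge> 0" for \<alpha> using s by (simp add: B_def)
  have Bsum: "B summable_on UNIV"
    using summable_on_cmult_right[OF ab, of "2 / s"] s by (simp add: B_def[abs_def] abs_mult)
  define S where "S = ball a (s/2)"
  have Sb: "\<bar>(z - a) $ i\<bar> \<le> s / 2" if "z \<in> S" for z i
    using component_le_norm_cart[of "z - a" i] that by (simp add: S_def dist_norm norm_minus_commute)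
  have "s * CARD('n) = r / 2" using r by (simp add: s_def)
  moreover have "s \<le> s * CARD('n)" using s by simp
  ultimately have sr: "s \<le> r / 2" by linarith
  have SB: "S \<subseteq> ball a r" using sr r by (auto simp: S_def)
  have db: "\<bar>vmono_diff i \<alpha> (z - a) * c \<alpha>\<bar> \<le> B \<alpha>" if "z \<in> S" for z i \<alpha>
    using mult_right_mono[OF vmono_diff_bound[OF s Sb[OF that], of i \<alpha>] abs_ge_zero[of "c \<alpha>"]]
    by (simp only: B_def abs_mult mult.assoc)
  define D where "D i z = infsum (\<lambda>\<alpha>. vmono_diff i \<alpha> (z - a) * c \<alpha>) UNIV" for i z
  have Dsum: "((\<lambda>\<alpha>. vmono_diff i \<alpha> (z - a) * c \<alpha>) has_sum D i z) UNIV" if "z \<in> S" for z i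
  proof -
    have "(\<lambda>\<alpha>. norm (vmono_diff i \<alpha> (z - a) * c \<alpha>)) summable_on UNIV"
      by (rule summable_on_comparison_test[OF Bsum]) (use db[OF that] in auto)
    then show ?thesis unfolding D_def by (rule has_sum_infsum[OF abs_summable_summable])
  qed
  define g' where "g' z h = (\<Sum>i\<in>UNIV. h $ i * D i z)" for z h
  define df where "df \<alpha> z h = (\<Sum>i\<in>UNIV. h $ i * (vmono_diff i \<alpha> (z - a) * c \<alpha>))" for \<alpha> z h
  have gsum: "((\<lambda>\<alpha>. df \<alpha> z h) has_sum g' z h) UNIV" if "z \<in> S" for z h
    unfolding g'_def df_def by (intro has_sum_finite_sum has_sum_cmult_right Dsum that)
  define e where "e = from_nat_into (UNIV :: ('n \<Rightarrow> nat) set)"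
  have e: "bij_betw e UNIV UNIV" unfolding e_def
    by (rule bij_betw_from_nat_into) (auto simp: infinite_multi_indices)
  have sums_e: "(\<lambda>n. u (e n)) sums l" if "(u has_sum l) UNIV" for u :: "_ \<Rightarrow> real" and l
    using that has_sum_reindex_bij_betw[OF e, of u l] by (auto intro: has_sum_imp_sums)
  \<comment> \<open>The factor \<open>CARD('n)\<close> accounts for the sum over the coordinate
    directions in \<open>df\<close>.\<close>
  define b where "b n = real CARD('n) * B (e n)" for n
  have bs: "summable b"
  proof -
    obtain l where "(B has_sum l) UNIV" using Bsum by (auto simp: summable_on_def)
    then show ?thesis unfolding b_def by (intro summable_mult sums_summable[OF sums_e])
  qed
  have dfb: "norm (df (e n) z h) \<le> b n * norm h" if "z \<in> S" for n z h
  proof -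
    have "norm (df (e n) z h) \<le> (\<Sum>i\<in>(UNIV::'n set). norm h * B (e n))"
      unfolding df_def
      by (intro sum_norm_le) (auto simp: abs_mult[of "h $ _"] intro!: mult_mono component_le_norm_cart db that)
    then show ?thesis by (simp add: b_def mult_ac)
  qed
  have ser: "\<exists>g. \<forall>z\<in>S. (\<lambda>n. vmono (e n) (z - a) * c (e n)) sums (g z) \<and> (g has_derivative g' z) (at z within S)"
  proof (rule has_derivative_series[where f'="\<lambda>n. df (e n)" and x=a])
    show "convex S" by (simp add: S_def)
    show "a \<in> S" using s by (simp add: S_def)
    show "(\<lambda>n. vmono (e n) (a - a) * c (e n)) sums f a" using c[of a] r by (intro sums_e) auto
    show "((\<lambda>z. vmono (e n) (z - a) * c (e n)) has_derivative df (e n) z) (at z within S)" for n z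
      using has_derivative_mult_left[OF vmono_has_derivative, where y="c (e n)"]
      by (simp add: df_def[abs_def] sum_distrib_right mult.assoc)
    fix \<epsilon> :: real assume \<epsilon>: "\<epsilon> > 0"
    obtain N where N: "\<And>n. n \<ge> N \<Longrightarrow> norm (\<Sum>i. b (i + n)) < \<epsilon>"
      using suminf_exist_split[OF \<epsilon> bs] by blast
    show "\<forall>\<^sub>F n in sequentially. \<forall>z\<in>S. \<forall>h. norm ((\<Sum>i<n. df (e i) z h) - g' z h) \<le> \<epsilon> * norm h"
      unfolding eventually_sequentially
    proof (intro exI[of _ N] allI impI ballI)
      fix n z h assume n: "N \<le> n" and z: "z \<in> S"
      have sm: "(\<lambda>i. df (e i) z h) sums g' z h" by (rule sums_e[OF gsum[OF z]])
      have sb: "summable (\<lambda>i. b (i + n) * norm h)" using bs by (intro summable_mult2) (simp add: summable_iff_shift)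
      have "g' z h - (\<Sum>i<n. df (e i) z h) = (\<Sum>i. df (e (i + n)) z h)"
        using suminf_minus_initial_segment[OF sums_summable[OF sm], of n] sm sums_unique by metis
      then have "norm ((\<Sum>i<n. df (e i) z h) - g' z h) = norm (\<Sum>i. df (e (i + n)) z h)"
        by (metis norm_minus_commute)
      also have "\<dots> \<le> (\<Sum>i. b (i + n) * norm h)"
        by (rule norm_suminf_le[OF _ sb]) (rule dfb[OF z])
      also have "\<dots> = (\<Sum>i. b (i + n)) * norm h"
        using bs by (intro suminf_mult2[symmetric]) (simp add: summable_iff_shift)
      also have "\<dots> \<le> \<epsilon> * norm h"
        using N[OF n] by (intro mult_right_mono) auto
      finally show "norm ((\<Sum>i<n. df (e i) z h) - g' z h) \<le> \<epsilon> * norm h" .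
    qed
  qed
  then obtain g where g: "\<And>z. z \<in> S \<Longrightarrow> (\<lambda>n. vmono (e n) (z - a) * c (e n)) sums (g z)"
     "\<And>z. z \<in> S \<Longrightarrow> (g has_derivative g' z) (at z within S)" by blast
  have "g z = f z" if "z \<in> S" for z
  proof -
    have "(\<lambda>n. vmono (e n) (z - a) * c (e n)) sums f z" by (rule sums_e[OF c]) (use that SB in blast)
    then show ?thesis by (rule sums_unique2[OF g(1)[OF that]])
  qed
  then have df: "(f has_derivative g' z) (at z)" if "z \<in> S" for z
  proof -
    have o: "open S" by (simp add: S_def)
    have "(g has_derivative g' z) (at z)" using g(2)[OF that] at_within_open[OF that o] by simp
    then show ?thesis by (rule has_derivative_transform_within_open[OF _ o that]) fact
  qed
  have "real_analytic_at a (\<lambda>z. frechet_derivative f (at z) v)" for v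
    unfolding real_analytic_at_real
  proof (intro exI[of _ "s/2"] conjI ballI exI)
    show "s / 2 > 0" using s by simp
    fix z assume z: "z \<in> ball a (s/2)"
    have "((\<lambda>\<beta>. \<Sum>i\<in>UNIV. v $ i * (vmono \<beta> (z - a) * (real (\<beta> i + 1) * c (\<beta>(i := \<beta> i + 1))))) has_sum g' z v) UNIV"
      unfolding g'_def using z
      by (intro has_sum_finite_sum has_sum_cmult_right vmono_diff_has_sum Dsum) (simp add: S_def)
    then show "((\<lambda>\<beta>. vmono \<beta> (z - a) * (\<Sum>i\<in>UNIV. v $ i * (real (\<beta> i + 1) * c (\<beta>(i := \<beta> i + 1)))))
       has_sum frechet_derivative f (at z) v) UNIV"
      using frechet_eqI[OF df] z by (simp add: S_def sum_distrib_left mult_ac)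
  qed
  moreover have "\<forall>z\<in>ball a (s/2). f differentiable at z"
    using df unfolding S_def by (blast intro: differentiableI)
  ultimately show ?thesis using s by (intro exI[of _ "s/2"]) simp
qed

lemma real_analytic_on_frechet:
  fixes f :: "real^'n \<Rightarrow> real"
  assumes "real_analytic_on S f"
  shows "real_analytic_on S (\<lambda>z. frechet_derivative f (at z) v)"
  using assms analytic_at_derivative unfolding real_analytic_on_def by blast

lemma real_analytic_on_nth: "real_analytic_on S f \<Longrightarrow> real_analytic_on S (\<lambda>z. f z $ k)"
  unfolding real_analytic_on_def using real_analytic_at_nth by blast

lemma real_analytic_differentiable:
  fixes f :: "real^'n \<Rightarrow> real"
  shows "real_analytic_on S f \<Longrightarrow> x \<in> S \<Longrightarrow> f differentiable at x"
  using analytic_at_derivative[of x f] unfolding real_analytic_on_def by (metis centre_in_ball)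

lemma real_analytic_Ck:
  fixes f :: "real^'n \<Rightarrow> real"
  shows "real_analytic_on S f \<Longrightarrow> Ck_on k S f"
proof (induction k arbitrary: f)
  case 0
  then show ?case using real_analytic_differentiable
    by (auto intro!: continuous_at_imp_continuous_on differentiable_imp_continuous_within)
next
  case (Suc k)
  have "Ck_on k S (\<lambda>x. frechet_derivative f (at x) v)" for v
    by (rule Suc.IH[OF real_analytic_on_frechet[OF Suc.prems]])
  then show ?case using real_analytic_differentiable[OF Suc.prems] by simp
qed

lemma real_analytic_smooth:
  fixes f :: "real^'n \<Rightarrow> real^'k"
  assumes "open S" "real_analytic_on S f" shows "smooth_on S f"
  by (rule smooth_on_vecI[OF assms(1)])
     (use real_analytic_Ck[OF real_analytic_on_nth[OF assms(2)]] in \<open>simp add: smooth_on_def\<close>)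

section \<open>Restriction to lines and the identity theorem\<close>

lemma finite_multi_indices_degree: "finite {\<alpha> :: 'n::finite \<Rightarrow> nat. sum \<alpha> UNIV = k}"
proof (rule finite_subset)
  show "{\<alpha> :: 'n \<Rightarrow> nat. sum \<alpha> UNIV = k} \<subseteq> UNIV \<rightarrow>\<^sub>E {..k}"
    by (auto simp: member_le_sum)
qed (simp add: finite_PiE)

text \<open>On the line every monomial of total degree \<open>k\<close> is a multiple of
  \<open>t^k\<close>. Unconditional summation allows grouping by degree, each group being finite,
  which leaves a power series in \<open>t\<close>.\<close>

lemma analytic_along_line:
  fixes f :: "real^'n \<Rightarrow> real"
  assumes "real_analytic_at a f"
  shows "\<exists>F. (\<lambda>t. f (a + t *\<^sub>R w)) has_fps_expansion F"
proof -
  obtain r c where r: "r > 0" and c: "\<And>z. z \<in> ball a r \<Longrightarrow> ((\<lambda>\<alpha>. vmono \<alpha> (z - a) * c \<alpha>) has_sum f z) UNIV"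
    using assms unfolding real_analytic_at_real by blast
  \<comment> \<open>For \<open>\<bar>t\<bar> < \<delta>\<close> the point stays within
    \<open>r\<close> of \<open>a\<close>; the summand 1 covers the case
    \<open>w = 0\<close>.\<close>
  define \<delta> where "\<delta> = r / (norm w + 1)"
  have nw: "norm w + 1 > 0" by (smt (verit) norm_ge_zero)
  have \<delta>: "\<delta> > 0" using r nw by (simp add: \<delta>_def)
  define d where "d k = (\<Sum>\<alpha>\<in>{\<alpha>. sum \<alpha> UNIV = k}. vmono \<alpha> w * c \<alpha>)" for k
  have sums: "(\<lambda>k. d k * t ^ k) sums f (a + t *\<^sub>R w)" if "\<bar>t\<bar> < \<delta>" for t
  proof -
    have "\<bar>t\<bar> * norm w \<le> \<bar>t\<bar> * (norm w + 1)" by (simp add: mult_left_mono)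
    also have "\<dots> < r" using that nw by (simp add: \<delta>_def pos_less_divide_eq)
    finally have "((\<lambda>\<alpha>. t ^ sum \<alpha> UNIV * (vmono \<alpha> w * c \<alpha>)) has_sum f (a + t *\<^sub>R w)) UNIV"
      using c[of "a + t *\<^sub>R w"] by (simp add: dist_norm vmono_scaleR mult.assoc)
    moreover have "bij_betw snd (Sigma UNIV (\<lambda>k. {\<alpha>::'n \<Rightarrow> nat. sum \<alpha> UNIV = k})) UNIV"
      by (rule bij_betw_byWitness[where f'="\<lambda>\<alpha>. (sum \<alpha> UNIV, \<alpha>)"]) auto
    ultimately have "((\<lambda>x. t ^ sum (snd x) UNIV * (vmono (snd x) w * c (snd x))) has_sum f (a + t *\<^sub>R w))
        (Sigma UNIV (\<lambda>k. {\<alpha>. sum \<alpha> UNIV = k}))"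
      using has_sum_reindex_bij_betw[of snd _ UNIV "\<lambda>\<alpha>. t ^ sum \<alpha> UNIV * (vmono \<alpha> w * c \<alpha>)"] by blast
    then have "((\<lambda>k. d k * t ^ k) has_sum f (a + t *\<^sub>R w)) UNIV"
    proof (rule has_sum_Sigma')
      fix k
      show "((\<lambda>\<alpha>. t ^ sum (snd (k, \<alpha>)) UNIV * (vmono (snd (k, \<alpha>)) w * c (snd (k, \<alpha>)))) has_sum d k * t ^ k) {\<alpha>. sum \<alpha> UNIV = k}"
        using has_sum_finite[OF finite_multi_indices_degree, of "\<lambda>\<alpha>. t ^ sum \<alpha> UNIV * (vmono \<alpha> w * c \<alpha>)" k]
        by (simp add: d_def sum_distrib_left mult_ac)
    qed
    then show ?thesis by (rule has_sum_imp_sums)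
  qed
  have "fps_conv_radius (Abs_fps d) \<ge> \<delta>"
    unfolding fps_conv_radius_def
    by (rule conv_radius_geI_ex') (use sums sums_summable in force)
  then have "fps_conv_radius (Abs_fps d) > 0" using \<delta> by (metis ereal_less(2) less_le_trans)
  moreover have "eventually (\<lambda>t. eval_fps (Abs_fps d) t = f (a + t *\<^sub>R w)) (nhds 0)"
    unfolding eventually_nhds_metric using \<delta> sums_unique[OF sums]
    by (intro exI[of _ \<delta>]) (auto simp: eval_fps_def dist_norm)
  ultimately show ?thesis unfolding has_fps_expansion_def by (intro exI[of _ "Abs_fps d"] conjI)
qed

text \<open>Here \<open>d\<close> is the order of vanishing at 0 and \<open>c\<close> the leading
  coefficient. A nonzero limit serves twice: it isolates the zeros, and it contradicts decay faster
  than \<open>t^d\<close>.\<close>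

lemma fps_expansion_leading_term:
  fixes \<phi> :: "real \<Rightarrow> real"
  assumes F: "\<phi> has_fps_expansion F" and "F \<noteq> 0"
  shows "\<exists>c d. c \<noteq> 0 \<and> ((\<lambda>t. \<phi> t / t ^ d) \<longlongrightarrow> c) (at 0)"
proof -
  define d where "d = subdegree F"
  have c0: "fps_nth F d \<noteq> 0" using assms(2) by (simp add: d_def)
  have r: "fps_conv_radius F > 0" using F by (simp add: has_fps_expansion_def)
  have r': "fps_conv_radius (fps_shift d F) > 0" using r by simp
  have "isCont (eval_fps (fps_shift d F)) 0"
    using r' by (intro continuous_eval_fps) (auto simp: zero_ereal_def)
  then have "(eval_fps (fps_shift d F) \<longlongrightarrow> eval_fps (fps_shift d F) 0) (at 0)" by (simp add: isCont_def)
  moreover have "eval_fps (fps_shift d F) 0 = fps_nth F d" by (simp add: eval_fps_at_0)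
  moreover have "\<forall>\<^sub>F t in at 0. eval_fps (fps_shift d F) t = \<phi> t / t ^ d"
  proof -
    have "\<forall>\<^sub>F t in nhds 0. eval_fps F t = \<phi> t" using F by (simp add: has_fps_expansion_def)
    moreover have "\<forall>\<^sub>F t::real in nhds 0. ereal (norm t) < fps_conv_radius F"
      using r eventually_nhds_in_open[of "eball 0 (fps_conv_radius F)" "0::real"]
      by (auto simp: in_eball_iff dist_norm zero_ereal_def elim!: eventually_mono)
    ultimately show ?thesis unfolding eventually_at_filter
    proof eventually_elim
      case (elim t)
      show ?case
      proof
        assume t: "t \<noteq> 0"
        have "F = fps_shift d F * fps_X ^ d" unfolding d_def by (metis subdegree_decompose)
        then have "eval_fps F t = eval_fps (fps_shift d F * fps_X ^ d) t" by simp
        also have "\<dots> = eval_fps (fps_shift d F) t * t ^ d"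
          using elim by (subst eval_fps_mult) auto
        finally show "t \<in> UNIV \<longrightarrow> eval_fps (fps_shift d F) t = \<phi> t / t ^ d" using elim t by simp
      qed
    qed
  qed
  ultimately have "((\<lambda>t. \<phi> t / t ^ d) \<longlongrightarrow> fps_nth F d) (at 0)"
    using Lim_transform_eventually by fastforce
  then show ?thesis using c0 by blast
qed

text \<open>Around each point of the interval the function either vanishes identically or has no
  zero except possibly that point. Therefore local vanishing is constant in a neighbourhood of each
  point, hence constant on the connected interval.\<close>

lemma analytic_line_vanish:
  fixes \<phi> :: "real \<Rightarrow> real"
  assumes ex: "\<And>t. t \<in> {0..1} \<Longrightarrow> \<exists>F. (\<lambda>s. \<phi> (t + s)) has_fps_expansion F"
    and z: "\<forall>\<^sub>F t in nhds 0. \<phi> t = 0"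
    and t: "t \<in> {0..1}"
  shows "\<phi> t = 0"
proof -
  let ?P = "\<lambda>t. \<forall>\<^sub>F s in nhds t. \<phi> s = 0"
  have dich: "(\<forall>\<^sub>F s in nhds t. \<phi> s = 0) \<or> (\<forall>\<^sub>F s in at t. \<phi> s \<noteq> 0)" if t: "t \<in> {0..1}" for t
  proof -
    obtain F where F: "(\<lambda>s. \<phi> (t + s)) has_fps_expansion F" using ex[OF t] by blast
    have sh: "filtermap (\<lambda>s. t + s) (nhds 0) = nhds t" "filtermap (\<lambda>s. t + s) (at 0) = at t"
      using filtermap_nhds_shift[of "-t" 0] filtermap_at_shift[of "-t" 0] by (simp_all add: add.commute)
    show ?thesis
    proof (cases "F = 0")
      case True
      then have "\<forall>\<^sub>F s in nhds 0. \<phi> (t + s) = 0" using F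
        by (auto simp: has_fps_expansion_def elim: eventually_mono)
      then have "\<forall>\<^sub>F s in filtermap (\<lambda>s. t + s) (nhds 0). \<phi> s = 0" by (simp add: eventually_filtermap)
      then show ?thesis using sh by simp
    next
      case False
      obtain c d where cd: "c \<noteq> 0" "((\<lambda>s. \<phi> (t + s) / s ^ d) \<longlongrightarrow> c) (at 0)"
        using fps_expansion_leading_term[OF F False] by blast
      have "\<forall>\<^sub>F s in at 0. \<phi> (t + s) / s ^ d \<noteq> 0" using tendsto_imp_eventually_ne[OF cd(2,1)] .
      then have "\<forall>\<^sub>F s in at 0. \<phi> (t + s) \<noteq> 0" by (rule eventually_mono) auto
      then have "\<forall>\<^sub>F s in filtermap (\<lambda>s. t + s) (at 0). \<phi> s \<noteq> 0" by (simp add: eventually_filtermap)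
      then show ?thesis using sh by simp
    qed
  qed
  have "?P t"
  proof (rule connected_induction_simple[of "{0..1::real}" 0 t ?P])
    fix a :: real assume a: "a \<in> {0..1}"
    show "\<exists>T. openin (top_of_set {0..1}) T \<and> a \<in> T \<and> (\<forall>x\<in>T. \<forall>y\<in>T. ?P x \<longrightarrow> ?P y)"
      using dich[OF a]
    proof
      assume "\<forall>\<^sub>F s in nhds a. \<phi> s = 0"
      then obtain U where U: "open U" "a \<in> U" "\<And>s. s \<in> U \<Longrightarrow> \<phi> s = 0" unfolding eventually_nhds by blast
      show ?thesis
        by (rule exI[of _ "{0..1} \<inter> U"]) (use U a in \<open>auto simp: openin_open eventually_nhds\<close>)
    next
      assume "\<forall>\<^sub>F s in at a. \<phi> s \<noteq> 0"
      then obtain U where U: "open U" "a \<in> U" "\<And>s. s \<in> U \<Longrightarrow> s \<noteq> a \<Longrightarrow> \<phi> s \<noteq> 0" unfolding eventually_at_topological by auto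
      have "\<not> ?P x" if xU: "x \<in> U" for x
      proof
        assume "?P x"
        then obtain V where V: "open V" "x \<in> V" "\<And>s. s \<in> V \<Longrightarrow> \<phi> s = 0" unfolding eventually_nhds by blast
        \<comment> \<open>Two open sets of reals cannot meet in exactly one point, so a
          neighbourhood on which the function vanishes contains a zero in \<open>U\<close> other
          than \<open>a\<close>.\<close>
        have "U \<inter> V \<noteq> {a}" using open_Int[OF U(1) V(1)] not_open_singleton by metis
        then obtain s where "s \<in> U \<inter> V" "s \<noteq> a" using xU V(2) by blast
        then show False using U V by auto
      qed
      then show ?thesis
        by (intro exI[of _ "{0..1} \<inter> U"]) (use U a in \<open>auto simp: openin_open\<close>)
    qed
  qed (use t z in auto)
  then show ?thesis unfolding eventually_nhds by blast
qed

text \<open>If the series had order \<open>d\<close>, flatness of order \<open>d + 1\<close> would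
  make the quotient by \<open>t^d\<close> tend to 0 and not to the leading coefficient.\<close>

lemma fps_expansion_flat_zero:
  fixes \<phi> :: "real \<Rightarrow> real"
  assumes F: "\<phi> has_fps_expansion F"
    and fl: "\<And>k. \<exists>C. \<forall>\<^sub>F t in nhds 0. \<bar>\<phi> t\<bar> \<le> C * \<bar>t\<bar> ^ k"
  shows "\<forall>\<^sub>F t in nhds 0. \<phi> t = 0"
proof (cases "F = 0")
  case True
  then show ?thesis using F by (auto simp: has_fps_expansion_def elim: eventually_mono)
next
  case False
  obtain c d where cd: "c \<noteq> 0" "((\<lambda>s. \<phi> s / s ^ d) \<longlongrightarrow> c) (at 0)"
    using fps_expansion_leading_term[OF F False] by blast
  obtain C where C: "\<forall>\<^sub>F t in nhds 0. \<bar>\<phi> t\<bar> \<le> C * \<bar>t\<bar> ^ Suc d" using fl by blast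
  have "((\<lambda>s. \<phi> s / s ^ d) \<longlongrightarrow> 0) (at 0)"
  proof (rule tendsto_0_le[where K=C])
    show "((\<lambda>s::real. s) \<longlongrightarrow> 0) (at 0)" by (rule tendsto_ident_at)
    have "\<forall>\<^sub>F t in at 0. \<bar>\<phi> t\<bar> \<le> C * \<bar>t\<bar> ^ Suc d \<and> t \<noteq> 0"
      using C unfolding eventually_at_filter by (rule eventually_mono) auto
    then show "\<forall>\<^sub>F s in at 0. norm (\<phi> s / s ^ d) \<le> norm s * C"
    proof (rule eventually_mono)
      fix t assume t: "\<bar>\<phi> t\<bar> \<le> C * \<bar>t\<bar> ^ Suc d \<and> t \<noteq> 0"
      then have "\<bar>t ^ d\<bar> > 0" by simp
      then show "norm (\<phi> t / t ^ d) \<le> norm t * C"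
        using t by (simp add: abs_divide pos_divide_le_eq power_abs mult_ac)
    qed
  qed
  then show ?thesis using tendsto_unique[OF at_neq_bot cd(2)] cd(1) by blast
qed

section \<open>Integrable linear total differential equations\<close>

text \<open>With the factor \<open>1/2\<close>, the mean value theorem bounds \<open>sup |d|\<close> by \<open>sup |d| / 2 + e\<close>.\<close>

lemma small_gronwall:
  fixes d :: "real \<Rightarrow> 'a::real_normed_vector"
  assumes d: "\<And>t. t \<in> {0..1} \<Longrightarrow> (d has_vector_derivative d' t) (at t within {0..1})"
    and b: "\<And>t. t \<in> {0..1} \<Longrightarrow> norm (d' t) \<le> norm (d t) / 2 + e"
    and 0: "d 0 = 0" and t: "t \<in> {0..1}"
  shows "norm (d t) \<le> 2 * e"
proof -
  have "continuous_on {0..1} (\<lambda>t. norm (d t))"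
    by (intro continuous_on_norm) (simp add: continuous_on_eq_continuous_within has_vector_derivative_continuous[OF d])
  then obtain s where s: "s \<in> {0..1}" "\<And>t. t \<in> {0..1} \<Longrightarrow> norm (d t) \<le> norm (d s)"
    using continuous_attains_sup[of "{0..1::real}" "\<lambda>t. norm (d t)"] by auto
  let ?m = "norm (d s) / 2 + e"
  have m: "norm (d' t) \<le> ?m" if "t \<in> {0..1}" for t using b[OF that] s(2)[OF that] by linarith
  have m0: "0 \<le> ?m" using m[OF s(1)] norm_ge_zero[of "d' s"] by linarith
  have "norm (d s - d 0) \<le> ?m * norm (s - 0)"
  proof (rule differentiable_bound[where S="{0..1}" and f'="\<lambda>x h. h *\<^sub>R d' x"])
    show "(d has_derivative (\<lambda>h. h *\<^sub>R d' x)) (at x within {0..1})" if "x \<in> {0..1}" for x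
      using d[OF that] by (simp add: has_vector_derivative_def)
    show "onorm (\<lambda>h. h *\<^sub>R d' x) \<le> ?m" if "x \<in> {0..1}" for x
    proof (rule onorm_le)
      fix h :: real
      show "norm (h *\<^sub>R d' x) \<le> ?m * norm h" using mult_left_mono[OF m[OF that] abs_ge_zero[of h]] by (simp add: mult.commute)
    qed
  qed (use s in auto)
  also have "\<dots> \<le> ?m * 1" using s(1) m0 by (intro mult_left_mono) auto
  finally have "norm (d s) \<le> 2 * e" using 0 by simp
  then show ?thesis using s(2)[OF t] by linarith
qed

lemma linear_euclidean_sum:
  fixes f :: "'a::euclidean_space \<Rightarrow> 'b::real_vector"
  assumes l: "linear f" shows "f v = (\<Sum>b\<in>Basis. (v \<bullet> b) *\<^sub>R f b)"
proof -
  have "f v = f (\<Sum>b\<in>Basis. (v \<bullet> b) *\<^sub>R b)" by (simp add: euclidean_representation)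
  also have "\<dots> = (\<Sum>b\<in>Basis. (v \<bullet> b) *\<^sub>R f b)"
    by (simp add: linear_sum[OF l] linear_scale[OF l] o_def)
  finally show ?thesis .
qed

text \<open>The difference of the two solutions satisfies the estimate of
  \<open>small_gronwall\<close> with \<open>e = 0\<close>.\<close>

lemma linear_ode_unique:
  fixes y z :: "real \<Rightarrow> 'a::real_normed_vector"
  assumes y: "\<And>t. t \<in> {0..1} \<Longrightarrow> (y has_vector_derivative L t (y t)) (at t within {0..1})"
    and z: "\<And>t. t \<in> {0..1} \<Longrightarrow> (z has_vector_derivative L t (z t)) (at t within {0..1})"
    and lin: "\<And>t. t \<in> {0..1} \<Longrightarrow> linear (L t)"
    and b: "\<And>t w. t \<in> {0..1} \<Longrightarrow> norm (L t w) \<le> norm w / 2"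
    and 0: "y 0 = z 0" and t: "t \<in> {0..1}"
  shows "y t = z t"
proof -
  have "norm (y t - z t) \<le> 2 * 0"
  proof (rule small_gronwall[where d="\<lambda>t. y t - z t" and d'="\<lambda>t. L t (y t - z t)", OF _ _ _ t])
    fix t :: real assume t: "t \<in> {0..1}"
    show "((\<lambda>t. y t - z t) has_vector_derivative L t (y t - z t)) (at t within {0..1})"
      using has_vector_derivative_diff[OF y[OF t] z[OF t]] by (simp add: linear_diff[OF lin[OF t]])
    show "norm (L t (y t - z t)) \<le> norm (y t - z t) / 2 + 0" using b[OF t] by simp
  qed (use 0 in simp)
  then show ?thesis by simp
qed

text \<open>Picard iteration on bounded continuous functions on the whole line; the integral is frozen outside \<open>[0, 1]\<close>.\<close>

lemma linear_ode_exists: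
  fixes L :: "real \<Rightarrow> 'a::euclidean_space \<Rightarrow> 'a"
  assumes lin: "\<And>t. t \<in> {0..1} \<Longrightarrow> linear (L t)"
    and b: "\<And>t w. t \<in> {0..1} \<Longrightarrow> norm (L t w) \<le> norm w / 2"
    and cont: "\<And>w. continuous_on {0..1} (\<lambda>t. L t w)"
  shows "\<exists>y. y 0 = v \<and> (\<forall>t\<in>{0..1}. (y has_vector_derivative L t (y t)) (at t within {0..1}))"
proof -
  have cy: "continuous_on {0..1} (\<lambda>t. L t (y t))" if "continuous_on {0..1} y" for y
  proof -
    have "continuous_on {0..1} (\<lambda>t. \<Sum>b\<in>Basis. (y t \<bullet> b) *\<^sub>R L t b)"
      by (intro continuous_intros that cont)
    then show ?thesis
      by (rule continuous_on_eq) (rule linear_euclidean_sum[OF lin, symmetric])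
  qed
  define cl where "cl t = max 0 (min 1 t)" for t :: real
  have cl: "cl t \<in> {0..1}" for t by (auto simp: cl_def)
  have clc: "continuous_on UNIV cl" unfolding cl_def by (intro continuous_intros)
  define I where "I y t = v + integral {0..t} (\<lambda>s. L s (y s))" for y t
  have Ic: "continuous_on {0..1} (I y)" if "continuous_on {0..1} y" for y
    unfolding I_def
    by (intro continuous_intros indefinite_integral_continuous_1 integrable_continuous_interval cy that)
  have bc: "(\<lambda>t. I y (cl t)) \<in> bcontfun" if "continuous_on {0..1} y" for y
  proof -
    have "bounded (I y ` {0..1})" by (intro compact_imp_bounded compact_continuous_image Ic that compact_Icc)
    then obtain K where "\<forall>x\<in>I y ` {0..1}. norm x \<le> K" using bounded_iff by blast
    then have "norm (I y (cl t)) \<le> K" for t using cl by blast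
    moreover have "continuous_on UNIV (\<lambda>t. I y (cl t))"
      by (rule continuous_on_compose2[OF Ic[OF that] clc]) (use cl in auto)
    ultimately show ?thesis by (intro bcontfun_normI)
  qed
  define \<Phi> where "\<Phi> y = Bcontfun (\<lambda>t. I (apply_bcontfun y) (cl t))" for y :: "real \<Rightarrow>\<^sub>C 'a"
  have yc: "continuous_on S (apply_bcontfun y)" for S and y :: "real \<Rightarrow>\<^sub>C 'a"
    using continuous_on_apply_bcontfun continuous_on_subset by blast
  have \<Phi>: "apply_bcontfun (\<Phi> y) t = I (apply_bcontfun y) (cl t)" for y t
    unfolding \<Phi>_def using Bcontfun_inverse[OF bc[OF yc]] by simp
  \<comment> \<open>The bound 1/2 on the right-hand side, integrated over length at most 1, is the
    contraction constant; one fixed point covers all of \<open>{0..1}\<close>.\<close>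
  have lip: "dist (\<Phi> y) (\<Phi> z) \<le> 1/2 * dist y z" for y z
  proof (rule dist_bound)
    fix t
    have "I (apply_bcontfun y) (cl t) - I (apply_bcontfun z) (cl t)
       = integral {0..cl t} (\<lambda>s. L s (apply_bcontfun y s)) - integral {0..cl t} (\<lambda>s. L s (apply_bcontfun z s))"
      by (simp add: I_def)
    also have "\<dots> = integral {0..cl t} (\<lambda>s. L s (apply_bcontfun y s) - L s (apply_bcontfun z s))"
      using cl[of t] by (intro Henstock_Kurzweil_Integration.integral_diff[symmetric] integrable_continuous_interval
           continuous_on_subset[OF cy[OF yc]]) auto
    also have "norm \<dots> \<le> (dist y z / 2) * (cl t - 0)"
    proof (rule integral_bound)
      show "continuous_on {0..cl t} (\<lambda>s. L s (apply_bcontfun y s) - L s (apply_bcontfun z s))"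
        using cl[of t] by (intro continuous_on_diff continuous_on_subset[OF cy[OF yc]]) auto
      fix s assume "s \<in> {0..cl t}"
      then have s: "s \<in> {0..1}" using cl[of t] by auto
      have "norm (L s (apply_bcontfun y s) - L s (apply_bcontfun z s)) = norm (L s (apply_bcontfun y s - apply_bcontfun z s))"
        by (simp add: linear_diff[OF lin[OF s]])
      also have "\<dots> \<le> norm (apply_bcontfun y s - apply_bcontfun z s) / 2" by (rule b[OF s])
      also have "\<dots> \<le> dist y z / 2" using dist_bounded[of y s z] by (simp add: dist_norm)
      finally show "norm (L s (apply_bcontfun y s) - L s (apply_bcontfun z s)) \<le> dist y z / 2" .
    qed (use cl[of t] in auto)
    also have "\<dots> \<le> (dist y z / 2) * 1" using cl[of t] by (intro mult_left_mono) auto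
    finally show "dist (apply_bcontfun (\<Phi> y) t) (apply_bcontfun (\<Phi> z) t) \<le> 1/2 * dist y z"
      by (simp add: \<Phi> dist_norm)
  qed
  obtain y where y: "\<Phi> y = y" using banach_fix_type[of "1/2" \<Phi>] lip by auto
  let ?y = "apply_bcontfun y"
  have eq: "?y t = I ?y t" if "t \<in> {0..1}" for t
  proof -
    have "cl t = t" using that by (auto simp: cl_def)
    then show ?thesis using \<Phi>[of y t] y by simp
  qed
  have "(?y has_vector_derivative L t (?y t)) (at t within {0..1})" if t: "t \<in> {0..1}" for t
  proof -
    have "((\<lambda>u. integral {0..u} (\<lambda>s. L s (?y s))) has_vector_derivative L t (?y t)) (at t within {0..1})"
      by (rule integral_has_vector_derivative[OF cy[OF yc] t])
    then have "(I ?y has_vector_derivative L t (?y t)) (at t within {0..1})"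
      unfolding I_def by (auto intro!: derivative_eq_intros)
    then show ?thesis
      by (rule has_vector_derivative_transform[OF t, rotated]) (use eq in auto)
  qed
  moreover have "?y 0 = v" using eq[of 0] by (simp add: I_def)
  ultimately show ?thesis by blast
qed

text \<open>Differentiability is established through a quadratic error estimate both for the
  coefficients and for the solution built from rays.\<close>

lemma has_derivative_quadraticI:
  assumes bl: "bounded_linear f'" and e: "0 < e"
    and q: "\<And>w. dist w z < e \<Longrightarrow> norm (f w - f z - f' (w - z)) \<le> K * (norm (w - z))\<^sup>2"
  shows "(f has_derivative f') (at z)"
proof (rule has_derivativeI_sandwich[OF e bl])
  show "((\<lambda>y. K * norm (y - z)) \<longlongrightarrow> 0) (at z)"
    by (auto intro!: tendsto_eq_intros)
  fix y assume y: "y \<noteq> z" "dist y z < e"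
  then have "norm (y - z) > 0" by simp
  then show "norm (f y - f z - f' (y - z)) / norm (y - z) \<le> K * norm (y - z)"
    using q[OF y(2)] by (simp add: pos_divide_le_eq power2_eq_square)
qed

text \<open>
  The total differential equation \<open>D\<eta>(z)(u) = G z u (\<eta> z)\<close>; the assumption \<open>flat\<close> is its
  integrability condition.
\<close>

locale flat_system =
  fixes B :: "'a::euclidean_space set" and G :: "'a \<Rightarrow> 'a \<Rightarrow> 'b::euclidean_space \<Rightarrow> 'b"
    and G' :: "'a \<Rightarrow> 'a \<Rightarrow> 'a \<Rightarrow> 'b \<Rightarrow> 'b" and M M' C :: real
  assumes openB: "open B" and convB: "convex B"
    and lin1: "\<And>z \<theta>. linear (\<lambda>u. G z u \<theta>)" and lin2: "\<And>z u. linear (G z u)"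
    and lin1': "\<And>z u \<theta>. z \<in> B \<Longrightarrow> linear (\<lambda>h. G' z h u \<theta>)"
    and lin2': "\<And>z h \<theta>. linear (\<lambda>u. G' z h u \<theta>)" and lin3': "\<And>z h u. linear (G' z h u)"
    and pos: "0 \<le> M" "0 \<le> M'" "0 \<le> C"
    and bound: "\<And>z u \<theta>. z \<in> B \<Longrightarrow> norm (G z u \<theta>) \<le> M * norm u * norm \<theta>"
    and bound': "\<And>z h u \<theta>. z \<in> B \<Longrightarrow> norm (G' z h u \<theta>) \<le> M' * norm h * norm u * norm \<theta>"
    and small: "\<And>z w. z \<in> B \<Longrightarrow> w \<in> B \<Longrightarrow> M * norm (z - w) \<le> 1 / 2"
    and taylor: "\<And>z w u \<theta>. z \<in> B \<Longrightarrow> w \<in> B \<Longrightarrow>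
       norm (G w u \<theta> - G z u \<theta> - G' z (w - z) u \<theta>) \<le> C * (norm (w - z))\<^sup>2 * norm u * norm \<theta>"
    and flat: "\<And>z h u \<theta>. z \<in> B \<Longrightarrow>
       G z u (G z h \<theta>) - G z h (G z u \<theta>) + G' z h u \<theta> - G' z u h \<theta> = 0"
begin

lemma segment_in: "p \<in> B \<Longrightarrow> p + w \<in> B \<Longrightarrow> t \<in> {0..1} \<Longrightarrow> p + t *\<^sub>R w \<in> B"
  using convexD_alt[OF convB, of p "p + w" t] by (simp add: algebra_simps)

lemma G_has_derivative:
  assumes z: "z \<in> B" shows "((\<lambda>z. G z u \<theta>) has_derivative (\<lambda>h. G' z h u \<theta>)) (at z)"
proof -
  obtain e where e: "e > 0" "\<And>w. dist w z < e \<Longrightarrow> w \<in> B" using openB z open_dist by metis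
  show ?thesis
    by (rule has_derivative_quadraticI[OF _ e(1), where K="C * norm u * norm \<theta>"])
       (use lin1'[OF z] taylor[OF z e(2)] in \<open>auto simp: linear_conv_bounded_linear mult_ac\<close>)
qed

text \<open>A product rule. Expanding \<open>y t\<close> in the basis separates it from the
  coefficients, which need to be differentiated only at fixed vectors.\<close>

lemma G_along:
  assumes y: "(y has_vector_derivative y') (at t within T)" and p: "p + t *\<^sub>R w \<in> B"
  shows "((\<lambda>t. G (p + t *\<^sub>R w) h (y t)) has_vector_derivative
      G' (p + t *\<^sub>R w) w h (y t) + G (p + t *\<^sub>R w) h y') (at t within T)"
proof -
  have ex: "G z h \<theta> = (\<Sum>b\<in>Basis. (\<theta> \<bullet> b) *\<^sub>R G z h b)" for z \<theta>
    by (rule linear_euclidean_sum[OF lin2])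
  have ex': "G' z k h \<theta> = (\<Sum>b\<in>Basis. (\<theta> \<bullet> b) *\<^sub>R G' z k h b)" for z k \<theta>
    by (rule linear_euclidean_sum[OF lin3'])
  have 1: "((\<lambda>t. G (p + t *\<^sub>R w) h b) has_vector_derivative G' (p + t *\<^sub>R w) w h b) (at t within T)" for b
  proof -
    have "((\<lambda>t. G (p + t *\<^sub>R w) h b) has_derivative (\<lambda>s. G' (p + t *\<^sub>R w) (s *\<^sub>R w) h b)) (at t within T)"
      by (rule has_derivative_compose[of "\<lambda>t. p + t *\<^sub>R w" "\<lambda>s. s *\<^sub>R w" t T "\<lambda>z. G z h b" "\<lambda>k. G' (p + t *\<^sub>R w) k h b"])
         (auto intro!: derivative_eq_intros G_has_derivative p)
    then show ?thesis by (simp add: has_vector_derivative_def linear_scale[OF lin1'[OF p]])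
  qed
  have "((\<lambda>t. \<Sum>b\<in>Basis. (y t \<bullet> b) *\<^sub>R G (p + t *\<^sub>R w) h b) has_vector_derivative
     (\<Sum>b\<in>Basis. (y t \<bullet> b) *\<^sub>R G' (p + t *\<^sub>R w) w h b + (y' \<bullet> b) *\<^sub>R G (p + t *\<^sub>R w) h b)) (at t within T)"
  proof (intro has_vector_derivative_sum has_vector_derivative_scaleR 1)
    fix b show "((\<lambda>t. y t \<bullet> b) has_field_derivative y' \<bullet> b) (at t within T)"
      using bounded_linear.has_vector_derivative[OF bounded_linear_inner_left y]
      by (simp add: has_real_derivative_iff_has_vector_derivative)
  qed
  then show ?thesis
    by (simp add: ex[symmetric] ex'[symmetric] sum.distrib)
qed

definition solves :: "'a set \<Rightarrow> ('a \<Rightarrow> 'b) \<Rightarrow> bool" where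
  "solves S \<eta> \<longleftrightarrow> (\<forall>z\<in>S. (\<eta> has_derivative (\<lambda>u. G z u (\<eta> z))) (at z))"

text \<open>This is the purpose of \<open>small\<close>: after every segment of \<open>B\<close> is
  parametrised over \<open>{0..1}\<close>, its equation has norm at most 1/2, as the lemmas on
  ordinary equations demand.\<close>

lemma ray_bound:
  assumes "p \<in> B" "p + w \<in> B" "t \<in> {0..1}"
  shows "norm (G (p + t *\<^sub>R w) w \<theta>) \<le> norm \<theta> / 2"
proof -
  have "norm (G (p + t *\<^sub>R w) w \<theta>) \<le> (M * norm w) * norm \<theta>" using bound[OF segment_in[OF assms]] by simp
  also have "\<dots> \<le> 1/2 * norm \<theta>" using small[OF assms(2,1)] by (intro mult_right_mono) auto
  finally show ?thesis by simp
qed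

lemma solves_along:
  assumes "solves B \<eta>" "p + t *\<^sub>R w \<in> B"
  shows "((\<lambda>t. \<eta> (p + t *\<^sub>R w)) has_vector_derivative G (p + t *\<^sub>R w) w (\<eta> (p + t *\<^sub>R w))) (at t within T)"
proof -
  have "((\<lambda>t. \<eta> (p + t *\<^sub>R w)) has_derivative (\<lambda>s. G (p + t *\<^sub>R w) (s *\<^sub>R w) (\<eta> (p + t *\<^sub>R w)))) (at t within T)"
    by (rule has_derivative_compose[of "\<lambda>t. p + t *\<^sub>R w" "\<lambda>s. s *\<^sub>R w" t T \<eta> "\<lambda>k. G (p + t *\<^sub>R w) k (\<eta> (p + t *\<^sub>R w))"])
       (use assms in \<open>auto intro!: derivative_eq_intros simp: solves_def\<close>)
  then show ?thesis by (simp add: has_vector_derivative_def linear_scale[OF lin1])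
qed

text \<open>On the segment from \<open>p\<close> to \<open>q\<close> both functions satisfy the same
  linear ordinary equation with the same initial value.\<close>

lemma solves_unique:
  assumes "solves B \<eta>" "solves B \<xi>" "p \<in> B" "q \<in> B" "\<eta> p = \<xi> p"
  shows "\<eta> q = \<xi> q"
proof -
  have pq: "p + (q - p) \<in> B" using assms by simp
  have "\<eta> (p + 1 *\<^sub>R (q - p)) = \<xi> (p + 1 *\<^sub>R (q - p))"
    by (rule linear_ode_unique[where L="\<lambda>t. G (p + t *\<^sub>R (q - p)) (q - p)" and y="\<lambda>t. \<eta> (p + t *\<^sub>R (q - p))"
          and z="\<lambda>t. \<xi> (p + t *\<^sub>R (q - p))"])
       (use assms ray_bound[OF assms(3) pq] in \<open>auto intro!: solves_along segment_in[OF _ pq] lin2\<close>)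
  then show ?thesis by simp
qed

text \<open>
  Integrate along the rays \<open>t \<mapsto> a + t z\<close>. By \<open>flat\<close>, the function \<open>\<eta> + t G(h) \<eta>\<close> on the ray of \<open>z\<close>
  solves the equation of the ray of \<open>z + h\<close> up to an error quadratic in \<open>h\<close>.
\<close>

lemma solves_exists:
  assumes a: "a \<in> B"
  shows "\<exists>\<eta>. \<eta> a = v \<and> solves B \<eta>"
proof -
  have "\<exists>y. a + w \<in> B \<longrightarrow> y 0 = v \<and> (\<forall>t\<in>{0..1}. (y has_vector_derivative G (a + t *\<^sub>R w) w (y t)) (at t within {0..1}))" for w
  proof (cases "a + w \<in> B")
    case True
    have "\<exists>y. y 0 = v \<and> (\<forall>t\<in>{0..1}. (y has_vector_derivative G (a + t *\<^sub>R w) w (y t)) (at t within {0..1}))"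
    proof (rule linear_ode_exists)
      fix \<theta>
      have "((\<lambda>t. G (a + t *\<^sub>R w) w \<theta>) has_vector_derivative G' (a + t *\<^sub>R w) w w \<theta> + G (a + t *\<^sub>R w) w 0) (at t within {0..1})"
        if "t \<in> {0..1}" for t
        by (rule G_along[OF has_vector_derivative_const segment_in[OF a True that]])
      then show "continuous_on {0..1} (\<lambda>t. G (a + t *\<^sub>R w) w \<theta>)"
        unfolding continuous_on_eq_continuous_within by (blast intro: has_vector_derivative_continuous)
    qed (use ray_bound[OF a True] lin2 in auto)
    then show ?thesis by blast
  qed simp
  then obtain Y where Y: "\<And>w. a + w \<in> B \<Longrightarrow> Y w 0 = v"
    "\<And>w t. a + w \<in> B \<Longrightarrow> t \<in> {0..1} \<Longrightarrow> (Y w has_vector_derivative G (a + t *\<^sub>R w) w (Y w t)) (at t within {0..1})"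
    by metis
  define \<eta> where "\<eta> p = Y (p - a) 1" for p
  have main: "(\<eta> has_derivative (\<lambda>h. G (a + z) h (\<eta> (a + z)))) (at (a + z))" if z: "a + z \<in> B" for z
  proof -
    let ?y = "Y z"
    have "continuous_on {0..1} ?y"
      unfolding continuous_on_eq_continuous_within by (blast intro: has_vector_derivative_continuous Y(2)[OF z])
    then have "bounded (?y ` {0..1})" by (intro compact_imp_bounded compact_continuous_image compact_Icc)
    then obtain K where K: "\<And>t. t \<in> {0..1} \<Longrightarrow> norm (?y t) \<le> K" unfolding bounded_iff by blast
    have K0: "0 \<le> K" using order_trans[OF norm_ge_zero K[of 0]] by simp
    \<comment> \<open>A bound for \<open>?w\<close> below, valid because both \<open>t\<close> and
      \<open>norm h\<close> are at most 1; the latter is the reason for the 1 in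
      \<open>e\<close>.\<close>
    define K2 where "K2 = K + M * K"
    have K20: "0 \<le> K2" using K0 pos by (simp add: K2_def)
    \<comment> \<open>The four summands are the bounds \<open>T1\<close>, \<open>T2\<close>,
      \<open>T3\<close> and \<open>R\<close> obtained below, each without its factor
      \<open>(norm h)\<^sup>2\<close>.\<close>
    define E where "E = M * M * K + M' * norm z * M * K + M' * K2 + C * (norm z + 1) * K2"
    obtain e0 where e0: "e0 > 0" "\<And>w. dist w (a + z) < e0 \<Longrightarrow> w \<in> B" using openB z open_dist by metis
    define e where "e = min e0 1"
    have e: "e > 0" using e0 by (simp add: e_def)
    show ?thesis
    proof (rule has_derivative_quadraticI[OF _ e, where K="2 * E"])
      show "bounded_linear (\<lambda>h. G (a + z) h (\<eta> (a + z)))" using lin1 by (simp add: linear_conv_bounded_linear)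
      fix w assume w: "dist w (a + z) < e"
      define h where "h = w - (a + z)"
      have wh: "w = a + (z + h)" by (simp add: h_def)
      have zh: "a + (z + h) \<in> B" using e0(2)[of w] w wh by (simp add: e_def)
      have h1: "norm h \<le> 1" using w by (simp add: e_def h_def dist_norm)
      let ?g = "\<lambda>t. G (a + t *\<^sub>R z)"
      let ?g' = "\<lambda>t. G' (a + t *\<^sub>R z)"
      let ?w = "\<lambda>t. ?y t + t *\<^sub>R ?g t h (?y t)"
      let ?w' = "\<lambda>t. ?g t z (?y t) + (t *\<^sub>R (?g' t z h (?y t) + ?g t h (?g t z (?y t))) + 1 *\<^sub>R ?g t h (?y t))"
      let ?Q = "\<lambda>t. G (a + t *\<^sub>R (z + h)) (z + h)"
      have dw: "(?w has_vector_derivative ?w' t) (at t within {0..1})" if t: "t \<in> {0..1}" for t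
        by (intro has_vector_derivative_add has_vector_derivative_scaleR G_along Y(2)[OF z t] segment_in[OF a z t])
           (auto intro!: derivative_eq_intros)
      have err: "norm (?Q t (?w t) - ?w' t) \<le> E * (norm h)\<^sup>2" if t: "t \<in> {0..1}" for t
      proof -
        let ?p = "a + t *\<^sub>R z" and ?q = "a + t *\<^sub>R (z + h)"
        have p: "?p \<in> B" and q: "?q \<in> B" using segment_in[OF a z t] segment_in[OF a zh t] by auto
        have qp: "?q - ?p = t *\<^sub>R h" by (simp add: scaleR_right_distrib)
        let ?Y = "?y t" and ?W = "?w t"
        define R where "R = G ?q (z + h) ?W - G ?p (z + h) ?W - G' ?p (t *\<^sub>R h) (z + h) ?W"
        have t01: "0 \<le> t" "t \<le> 1" using t by auto
        have tt: "t * t \<le> 1" using t01 by (simp add: mult_le_one)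
        have nY: "norm ?Y \<le> K" by (rule K[OF t])
        have ghY: "norm (?g t h ?Y) \<le> M * norm h * K"
          using bound[OF p, of h ?Y] nY pos by (meson mult_left_mono mult_nonneg_nonneg norm_ge_zero order_trans)
        have "M * norm h * K \<le> M * 1 * K" using h1 pos K0 by (intro mult_right_mono mult_left_mono) auto
        then have ghY': "norm (?g t h ?Y) \<le> M * K" using ghY by linarith
        have "norm (t *\<^sub>R ?g t h ?Y) \<le> 1 * (M * K)"
          unfolding norm_scaleR using t01 ghY' by (intro mult_mono) auto
        then have nW: "norm ?W \<le> K2" unfolding K2_def using nY norm_triangle_le by (smt (verit))
        have R: "norm R \<le> C * (norm h)\<^sup>2 * (norm z + 1) * K2"
        proof -
          have "norm R \<le> C * (norm (t *\<^sub>R h))\<^sup>2 * norm (z + h) * norm ?W"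
            unfolding R_def using taylor[OF p q, of "z + h" ?W] unfolding qp .
          also have "\<dots> \<le> C * (norm h)\<^sup>2 * (norm z + 1) * K2"
          proof (intro mult_mono power_mono)
            show "norm (t *\<^sub>R h) \<le> norm h" using t01 by (simp add: mult_left_le_one_le)
            show "norm (z + h) \<le> norm z + 1" using norm_triangle_ineq[of z h] h1 by linarith
          qed (use nW pos K20 in auto)
          finally show ?thesis .
        qed
        have T1: "norm (t *\<^sub>R ?g t h (?g t h ?Y)) \<le> M * M * K * (norm h)\<^sup>2"
        proof -
          have "norm (?g t h (?g t h ?Y)) \<le> M * norm h * (M * norm h * K)"
            using bound[OF p, of h "?g t h ?Y"] ghY pos by (meson mult_left_mono mult_nonneg_nonneg norm_ge_zero order_trans)
          then have "norm (t *\<^sub>R ?g t h (?g t h ?Y)) \<le> 1 * (M * norm h * (M * norm h * K))"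
            unfolding norm_scaleR using t01 by (intro mult_mono) auto
          then show ?thesis by (simp add: power2_eq_square mult_ac)
        qed
        have T2: "norm ((t * t) *\<^sub>R ?g' t h z (?g t h ?Y)) \<le> M' * norm z * M * K * (norm h)\<^sup>2"
        proof -
          have "norm (?g' t h z (?g t h ?Y)) \<le> M' * norm h * norm z * (M * norm h * K)"
            using bound'[OF p, of h z "?g t h ?Y"] ghY pos by (meson mult_left_mono mult_nonneg_nonneg norm_ge_zero order_trans)
          then have "norm ((t * t) *\<^sub>R ?g' t h z (?g t h ?Y)) \<le> 1 * (M' * norm h * norm z * (M * norm h * K))"
            unfolding norm_scaleR using t01 tt by (intro mult_mono) auto
          then show ?thesis by (simp add: power2_eq_square mult_ac)
        qed
        have T3: "norm (t *\<^sub>R ?g' t h h ?W) \<le> M' * K2 * (norm h)\<^sup>2"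
        proof -
          have "norm (?g' t h h ?W) \<le> M' * norm h * norm h * K2"
            using bound'[OF p, of h h ?W] nW pos by (meson mult_left_mono mult_nonneg_nonneg norm_ge_zero order_trans)
          then have "norm (t *\<^sub>R ?g' t h h ?W) \<le> 1 * (M' * norm h * norm h * K2)"
            unfolding norm_scaleR using t01 by (intro mult_mono) auto
          then show ?thesis by (simp add: power2_eq_square mult_ac)
        qed
        note l1 = linear_add[OF lin1] linear_scale[OF lin1]
        note l2 = linear_add[OF lin2] linear_scale[OF lin2]
        note l1' = linear_scale[OF lin1'[OF p]]
        note l2' = linear_add[OF lin2']
        note l3' = linear_add[OF lin3'] linear_scale[OF lin3']
        have "?Q t ?W = G ?p (z + h) ?W + G' ?p (t *\<^sub>R h) (z + h) ?W + R" by (simp add: R_def)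
        also have "G' ?p (t *\<^sub>R h) (z + h) ?W
            = t *\<^sub>R ?g' t h z ?Y + (t * t) *\<^sub>R ?g' t h z (?g t h ?Y) + t *\<^sub>R ?g' t h h ?W"
          unfolding l1' l2' by (simp add: l3' scaleR_right_distrib)
        also have "G ?p (z + h) ?W = ?g t z ?Y + t *\<^sub>R ?g t z (?g t h ?Y) + ?g t h ?Y + t *\<^sub>R ?g t h (?g t h ?Y)"
          unfolding l1 l2 by (simp add: scaleR_right_distrib)
        \<comment> \<open>All terms linear in \<open>h\<close> are collected in the first bracket,
          which is the left-hand side of \<open>flat\<close>; everything else is quadratic.\<close>
        finally have "?Q t ?W - ?w' t =
            t *\<^sub>R (?g t z (?g t h ?Y) - ?g t h (?g t z ?Y) + ?g' t h z ?Y - ?g' t z h ?Y)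
            + t *\<^sub>R ?g t h (?g t h ?Y) + (t * t) *\<^sub>R ?g' t h z (?g t h ?Y) + t *\<^sub>R ?g' t h h ?W + R"
          by (simp add: algebra_simps)
        also have "\<dots> = t *\<^sub>R ?g t h (?g t h ?Y) + (t * t) *\<^sub>R ?g' t h z (?g t h ?Y) + t *\<^sub>R ?g' t h h ?W + R"
          using flat[OF p, of z h ?Y] by simp
        also have "norm \<dots> \<le> M * M * K * (norm h)\<^sup>2 + M' * norm z * M * K * (norm h)\<^sup>2 + M' * K2 * (norm h)\<^sup>2 + C * (norm h)\<^sup>2 * (norm z + 1) * K2"
          by (intro norm_triangle_mono T1 T2 T3 R)
        also have "\<dots> = E * (norm h)\<^sup>2" by (simp add: E_def algebra_simps)
        finally show ?thesis .
      qed
      have "norm (Y (z + h) 1 - ?w 1) \<le> 2 * (E * (norm h)\<^sup>2)"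
      proof (rule small_gronwall[where d="\<lambda>t. Y (z + h) t - ?w t" and d'="\<lambda>t. ?Q t (Y (z + h) t) - ?w' t"])
        fix t :: real assume t: "t \<in> {0..1}"
        show "((\<lambda>t. Y (z + h) t - ?w t) has_vector_derivative ?Q t (Y (z + h) t) - ?w' t) (at t within {0..1})"
          by (intro has_vector_derivative_diff dw t Y(2)[OF zh])
        have eq: "?Q t (Y (z + h) t) - ?w' t = ?Q t (Y (z + h) t - ?w t) + (?Q t (?w t) - ?w' t)"
          by (simp add: linear_diff[OF lin2])
        show "norm (?Q t (Y (z + h) t) - ?w' t) \<le> norm (Y (z + h) t - ?w t) / 2 + E * (norm h)\<^sup>2"
          unfolding eq by (rule norm_triangle_mono[OF ray_bound[OF a zh t] err[OF t]])
      qed (use Y(1)[OF zh] Y(1)[OF z] in auto)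
      moreover have "Y (z + h) 1 - ?w 1 = \<eta> w - \<eta> (a + z) - G (a + z) (w - (a + z)) (\<eta> (a + z))"
        by (simp add: \<eta>_def wh)
      ultimately show "norm (\<eta> w - \<eta> (a + z) - G (a + z) (w - (a + z)) (\<eta> (a + z))) \<le> 2 * E * (norm (w - (a + z)))\<^sup>2"
        by (simp add: h_def)
    qed
  qed
  have "solves B \<eta>" unfolding solves_def
  proof
    fix p assume "p \<in> B"
    then show "(\<eta> has_derivative (\<lambda>u. G p u (\<eta> p))) (at p)" using main[of "p - a"] by simp
  qed
  moreover have "\<eta> a = v"
  proof -
    \<comment> \<open>The ray in direction 0 is degenerate: linearity in the direction makes its
      right-hand side 0, so the solution is constant.\<close>
    have "Y 0 t = v" if "t \<in> {0..1}" for t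
      by (rule linear_ode_unique[where L="\<lambda>t \<theta>. 0" and z="\<lambda>_. v", OF _ _ _ _ _ that])
         (use Y(1)[of 0] Y(2)[of 0] a lin1 in \<open>auto simp: linear_0[OF lin1] linear_zero\<close>)
    then show ?thesis by (simp add: \<eta>_def)
  qed
  ultimately show ?thesis by blast
qed

end

section \<open>Bilinear systems given by coefficient functions\<close>

lemma double_sum_bound:
  fixes X :: "'n::finite \<Rightarrow> 'n \<Rightarrow> 'a::real_normed_vector" and u v :: "real^'n"
  assumes "\<And>i j. norm (X i j) \<le> K i j"
  shows "norm (\<Sum>i\<in>UNIV. \<Sum>j\<in>UNIV. (u $ i * v $ j) *\<^sub>R X i j) \<le> (\<Sum>i\<in>UNIV. \<Sum>j\<in>UNIV. K i j) * norm u * norm v"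
proof -
  have "norm (\<Sum>i\<in>UNIV. \<Sum>j\<in>UNIV. (u $ i * v $ j) *\<^sub>R X i j) \<le> (\<Sum>i\<in>UNIV. \<Sum>j\<in>UNIV. (norm u * norm v) * K i j)"
    by (intro sum_norm_le) (auto simp: abs_mult intro!: mult_mono component_le_norm_cart assms)
  then show ?thesis by (simp add: sum_distrib_left sum_distrib_right mult_ac)
qed

text \<open>A common form for the Christoffel symbols acting on vectors and for their transposes
  acting on covectors.\<close>

definition coeff_sys :: "('n::finite \<Rightarrow> 'n \<Rightarrow> real^'n \<Rightarrow> 'b::real_vector) \<Rightarrow> real^'n \<Rightarrow> real^'n \<Rightarrow> real^'n \<Rightarrow> 'b" where
  "coeff_sys c z u v = (\<Sum>i\<in>UNIV. \<Sum>j\<in>UNIV. (u $ i * v $ j) *\<^sub>R c i j z)"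

definition coeff_sys_deriv ::
    "('n::finite \<Rightarrow> 'n \<Rightarrow> real^'n \<Rightarrow> 'b::real_normed_vector) \<Rightarrow> real^'n \<Rightarrow> real^'n \<Rightarrow> real^'n \<Rightarrow> real^'n \<Rightarrow> 'b" where
  "coeff_sys_deriv c z h u v = (\<Sum>i\<in>UNIV. \<Sum>j\<in>UNIV. (u $ i * v $ j) *\<^sub>R frechet_derivative (c i j) (at z) h)"

lemma linear_coeff_sys1: "linear (\<lambda>u. coeff_sys c z u v)"
  by (rule linearI) (simp_all add: coeff_sys_def algebra_simps sum.distrib scaleR_sum_right)

lemma linear_coeff_sys2: "linear (coeff_sys c z u)"
  by (rule linearI) (simp_all add: coeff_sys_def algebra_simps sum.distrib scaleR_sum_right)

lemma linear_coeff_sys_deriv1: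
  assumes "\<And>i j. c i j differentiable at z" shows "linear (\<lambda>h. coeff_sys_deriv c z h u v)"
proof -
  note l = linear_frechet_derivative[OF assms]
  show ?thesis
    by (rule linearI)
       (simp_all add: coeff_sys_deriv_def algebra_simps sum.distrib scaleR_sum_right linear_add[OF l] linear_scale[OF l])
qed

lemma linear_coeff_sys_deriv2: "linear (\<lambda>u. coeff_sys_deriv c z h u v)"
  by (rule linearI) (simp_all add: coeff_sys_deriv_def algebra_simps sum.distrib scaleR_sum_right)

lemma linear_coeff_sys_deriv3: "linear (coeff_sys_deriv c z h u)"
  by (rule linearI) (simp_all add: coeff_sys_deriv_def algebra_simps sum.distrib scaleR_sum_right)

text \<open>The constants are bounds on one fixed closed ball, so the radius may be shrunk
  afterwards without changing them. This makes \<open>small\<close> attainable.\<close>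

lemma flat_system_ball:
  fixes c :: "'n::finite \<Rightarrow> 'n \<Rightarrow> real^'n \<Rightarrow> real^'n"
  assumes S: "open S" "a \<in> S" and sm: "\<And>i j. smooth_on S (c i j)"
    and flat: "\<And>z h u v. z \<in> S \<Longrightarrow> coeff_sys c z u (coeff_sys c z h v) - coeff_sys c z h (coeff_sys c z u v)
       + coeff_sys_deriv c z h u v - coeff_sys_deriv c z u h v = 0"
  shows "\<exists>r>0. ball a r \<subseteq> S \<and> (\<exists>M M' C. flat_system (ball a r) (coeff_sys c) (coeff_sys_deriv c) M M' C)"
proof -
  obtain R where R: "R > 0" "cball a R \<subseteq> S" using S open_contains_cball by metis
  have "\<exists>K\<ge>0. \<forall>z\<in>cball a R. norm (c i j z) \<le> K" for i j
  proof -
    have "compact (c i j ` cball a R)"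
      using R by (intro compact_continuous_image continuous_on_subset[OF smooth_on_continuous[OF sm]] compact_cball)
    then obtain B where "B > 0" "\<forall>y\<in>c i j ` cball a R. norm y \<le> B"
      using compact_imp_bounded bounded_pos by metis
    then show ?thesis by (intro exI[of _ B]) auto
  qed
  then obtain K where K: "\<And>i j. K i j \<ge> 0" "\<And>i j z. z \<in> cball a R \<Longrightarrow> norm (c i j z) \<le> K i j" by metis
  have "\<exists>C\<ge>0. \<forall>z\<in>cball a R. \<forall>h. norm (frechet_derivative (c i j) (at z) h) \<le> C * norm h" for i j
    by (rule smooth_deriv_bound[OF sm compact_cball R(2)])
  then obtain K' where K': "\<And>i j. K' i j \<ge> 0"
    "\<And>i j z h. z \<in> cball a R \<Longrightarrow> norm (frechet_derivative (c i j) (at z) h) \<le> K' i j * norm h" by metis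
  have "\<exists>C\<ge>0. \<forall>z\<in>cball a R. \<forall>w\<in>cball a R.
    norm (c i j w - c i j z - frechet_derivative (c i j) (at z) (w - z)) \<le> C * (norm (w - z))\<^sup>2" for i j
    by (rule smooth_taylor[OF sm R(2)])
  then obtain T where T: "\<And>i j. T i j \<ge> 0"
    "\<And>i j z w. z \<in> cball a R \<Longrightarrow> w \<in> cball a R \<Longrightarrow>
      norm (c i j w - c i j z - frechet_derivative (c i j) (at z) (w - z)) \<le> T i j * (norm (w - z))\<^sup>2" by metis
  define M where "M = (\<Sum>i\<in>UNIV. \<Sum>j\<in>UNIV. K i j)"
  define M' where "M' = (\<Sum>i\<in>UNIV. \<Sum>j\<in>UNIV. K' i j)"
  define C where "C = (\<Sum>i\<in>UNIV. \<Sum>j\<in>UNIV. T i j)"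
  have pos: "0 \<le> M" "0 \<le> M'" "0 \<le> C" using K K' T by (simp_all add: M_def M'_def C_def sum_nonneg)
  \<comment> \<open>Two points of the ball are less than \<open>2 * r\<close> apart, and
    \<open>M * 2 / (4 * (M + 1)) \<le> 1/2\<close>.\<close>
  define r where "r = min R (1 / (4 * (M + 1)))"
  have r: "r > 0" using R pos by (simp add: r_def)
  have rR: "ball a r \<subseteq> cball a R" by (auto simp: r_def)
  have df: "c i j differentiable at z" if "z \<in> ball a r" for i j z
    using smooth_on_differentiable[OF sm] that rR R(2) by blast
  have "flat_system (ball a r) (coeff_sys c) (coeff_sys_deriv c) M M' C"
  proof (rule flat_system.intro)
    fix z w h u v :: "real^'n"
    assume z: "z \<in> ball a r"
    then have zR: "z \<in> cball a R" using rR by blast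
    show "norm (coeff_sys c z u v) \<le> M * norm u * norm v"
      unfolding coeff_sys_def M_def by (rule double_sum_bound[OF K(2)[OF zR]])
    have "norm (coeff_sys_deriv c z h u v) \<le> (\<Sum>i\<in>UNIV. \<Sum>j\<in>UNIV. K' i j * norm h) * norm u * norm v"
      unfolding coeff_sys_deriv_def by (rule double_sum_bound[OF K'(2)[OF zR]])
    then show "norm (coeff_sys_deriv c z h u v) \<le> M' * norm h * norm u * norm v"
      by (simp add: M'_def sum_distrib_right)
    show "coeff_sys c z u (coeff_sys c z h v) - coeff_sys c z h (coeff_sys c z u v)
       + coeff_sys_deriv c z h u v - coeff_sys_deriv c z u h v = 0"
      using flat zR R(2) by blast
    show "linear (\<lambda>h. coeff_sys_deriv c z h u v)" using df[OF z] by (rule linear_coeff_sys_deriv1)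
    assume w: "w \<in> ball a r"
    then have wR: "w \<in> cball a R" using rR by blast
    have "norm (z - w) \<le> norm (z - a) + norm (w - a)" by (metis norm_triangle_ineq4 diff_diff_eq2 diff_add_cancel add_diff_cancel_right)
    also have "\<dots> \<le> 2 * r" using z w by (simp add: dist_norm norm_minus_commute)
    also have "\<dots> \<le> 2 * (1 / (4 * (M + 1)))" by (simp add: r_def)
    finally have "norm (z - w) \<le> 2 * (1 / (4 * (M + 1)))" .
    then have "M * norm (z - w) \<le> M * (2 * (1 / (4 * (M + 1))))" by (rule mult_left_mono[OF _ pos(1)])
    also have "\<dots> \<le> 1 / 2" using pos(1) by (simp add: field_simps)
    finally show "M * norm (z - w) \<le> 1 / 2" .
    have "norm (\<Sum>i\<in>UNIV. \<Sum>j\<in>UNIV. (u $ i * v $ j) *\<^sub>R (c i j w - c i j z - frechet_derivative (c i j) (at z) (w - z)))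
       \<le> (\<Sum>i\<in>UNIV. \<Sum>j\<in>UNIV. T i j * (norm (w - z))\<^sup>2) * norm u * norm v"
      by (rule double_sum_bound[OF T(2)[OF zR wR]])
    then show "norm (coeff_sys c w u v - coeff_sys c z u v - coeff_sys_deriv c z (w - z) u v)
        \<le> C * (norm (w - z))\<^sup>2 * norm u * norm v"
      by (simp add: C_def coeff_sys_def coeff_sys_deriv_def sum_distrib_right sum_subtractf scaleR_right_diff_distrib)
  qed (use pos in \<open>auto intro: linear_coeff_sys1 linear_coeff_sys2 linear_coeff_sys_deriv2 linear_coeff_sys_deriv3\<close>)
  then show ?thesis using r rR R(2) by (intro exI[of _ r]) blast
qed

section \<open>Monodromy of locally constant sheaves\<close>

definition section_on :: "('m \<Rightarrow> ('m \<Rightarrow> 'v) \<Rightarrow> bool) \<Rightarrow> 'm set \<Rightarrow> ('m \<Rightarrow> 'v) \<Rightarrow> bool" where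
  "section_on P U \<theta> \<longleftrightarrow> (\<forall>r\<in>U. P r \<theta>)"

text \<open>Evaluation at any point of \<open>U\<close> identifies the sections over
  \<open>U\<close> with \<open>'v\<close>: the third clause is surjectivity, the fourth injectivity.
  Path connectedness allows a path ending in \<open>U\<close> to be prolonged inside
  \<open>U\<close> to any other point.\<close>

definition good_nbhd :: "('m::topological_space \<Rightarrow> ('m \<Rightarrow> 'v) \<Rightarrow> bool) \<Rightarrow> 'm set \<Rightarrow> bool" where
  "good_nbhd P U \<longleftrightarrow> open U \<and> path_connected U \<and>
     (\<forall>q\<in>U. \<forall>v. \<exists>\<theta>. \<theta> q = v \<and> section_on P U \<theta>) \<and>
     (\<forall>\<theta> \<theta>' q r. section_on P U \<theta> \<longrightarrow> section_on P U \<theta>' \<longrightarrow> q \<in> U \<longrightarrow> r \<in> U \<longrightarrow> \<theta> q = \<theta>' q \<longrightarrow> \<theta> r = \<theta>' r)"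

text \<open>
  \<open>P p \<theta>\<close> says that \<open>\<theta>\<close> is a section of a locally constant sheaf near \<open>p\<close>; the assumption
  \<open>good\<close> makes the sheaf constant on a basis of the topology.
\<close>

locale local_system =
  fixes P :: "'m::topological_space \<Rightarrow> ('m \<Rightarrow> 'v) \<Rightarrow> bool"
  assumes germ: "\<And>U p \<theta> \<theta>'. \<lbrakk>open U; p \<in> U; \<And>q. q \<in> U \<Longrightarrow> \<theta> q = \<theta>' q; P p \<theta>\<rbrakk> \<Longrightarrow> P p \<theta>'"
    and good: "\<And>N p. \<lbrakk>open N; p \<in> N\<rbrakk> \<Longrightarrow> \<exists>U. p \<in> U \<and> U \<subseteq> N \<and> good_nbhd P U"
begin

lemma section_subset: "section_on P U \<theta> \<Longrightarrow> V \<subseteq> U \<Longrightarrow> section_on P V \<theta>"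
  by (auto simp: section_on_def)

lemma good_unique:
  "\<lbrakk>good_nbhd P U; section_on P U \<theta>; section_on P U \<theta>'; q \<in> U; r \<in> U; \<theta> q = \<theta>' q\<rbrakk> \<Longrightarrow> \<theta> r = \<theta>' r"
  unfolding good_nbhd_def by (elim conjE) metis

lemma good_ex: "good_nbhd P U \<Longrightarrow> q \<in> U \<Longrightarrow> \<exists>\<theta>. \<theta> q = v \<and> section_on P U \<theta>"
  unfolding good_nbhd_def by (elim conjE) (drule bspec, assumption, erule spec)

lemma good_open: "good_nbhd P U \<Longrightarrow> open U" by (simp add: good_nbhd_def)

text \<open>Continuation of a section along a map \<open>f\<close>. The domain \<open>K\<close> is
  an arbitrary set of a topological space, so paths, squares and their edges are treated
  alike.\<close>

definition lift :: "'k::topological_space set \<Rightarrow> ('k \<Rightarrow> 'm) \<Rightarrow> ('k \<Rightarrow> 'v) \<Rightarrow> bool" where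
  "lift K f \<sigma> \<longleftrightarrow> (\<forall>k\<in>K. \<exists>N U \<theta>. open N \<and> k \<in> N \<and> open U \<and> section_on P U \<theta> \<and>
     (\<forall>j\<in>N \<inter> K. f j \<in> U \<and> \<sigma> j = \<theta> (f j)))"

lemma liftE:
  assumes "lift K f \<sigma>" "k \<in> K"
  obtains N U \<theta> where "open N" "k \<in> N" "open U" "section_on P U \<theta>"
    "\<forall>j\<in>N \<inter> K. f j \<in> U \<and> \<sigma> j = \<theta> (f j)"
proof -
  have "\<exists>N U \<theta>. open N \<and> k \<in> N \<and> open U \<and> section_on P U \<theta> \<and>
     (\<forall>j\<in>N \<inter> K. f j \<in> U \<and> \<sigma> j = \<theta> (f j))"
    by (rule bspec[OF assms(1)[unfolded lift_def] assms(2)])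
  then show ?thesis
    by (elim exE conjE) (rule that)
qed

lemma liftI:
  assumes "\<And>k. k \<in> K \<Longrightarrow> open (N k) \<and> k \<in> N k \<and> open (U k) \<and> section_on P (U k) (\<theta> k) \<and>
     (\<forall>j\<in>N k \<inter> K. f j \<in> U k \<and> \<sigma> j = \<theta> k (f j))"
  shows "lift K f \<sigma>"
  unfolding lift_def by (intro ballI exI) (rule assms)

lemma preimage_nbhd:
  assumes "continuous_on K f" "k \<in> K" "open W" "f k \<in> W"
  obtains N where "open N" "k \<in> N" "\<forall>j\<in>N \<inter> K. f j \<in> W"
proof -
  have "\<exists>A. open A \<and> k \<in> A \<and> (\<forall>y\<in>K. y \<in> A \<longrightarrow> f y \<in> W)"
    by (rule iffD1[OF continuous_on_topological assms(1), THEN bspec, OF assms(2), THEN spec, THEN mp, OF assms(3), THEN mp, OF assms(4)])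
  then obtain A where "open A" "k \<in> A" "\<forall>y\<in>K. y \<in> A \<longrightarrow> f y \<in> W" by (elim exE conjE)
  then show ?thesis by (intro that[of A]) auto
qed

text \<open>The set in the definition of \<open>lift\<close> may fail to be good. Shrinking it
  inside a prescribed \<open>V\<close> makes values at one point determine a section, and lets two
  lifts be compared on a common set.\<close>

lemma lift_good:
  assumes l: "lift K f \<sigma>" and c: "continuous_on K f" and k: "k \<in> K" and V: "open V" "f k \<in> V"
  obtains N W \<theta> where "open N" "k \<in> N" "good_nbhd P W" "W \<subseteq> V" "f k \<in> W" "section_on P W \<theta>"
    "\<forall>j\<in>N \<inter> K. f j \<in> W \<and> \<sigma> j = \<theta> (f j)"
proof -
  obtain N U \<theta> where N: "open N" "k \<in> N" "open U" "section_on P U \<theta>"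
    "\<forall>j\<in>N \<inter> K. f j \<in> U \<and> \<sigma> j = \<theta> (f j)"
    by (rule liftE[OF l k]) (rule that)
  obtain W where W: "f k \<in> W" "W \<subseteq> U \<inter> V" "good_nbhd P W"
    using good[of "U \<inter> V" "f k"] N k V by blast
  obtain N' where N': "open N'" "k \<in> N'" "\<forall>j\<in>N' \<inter> K. f j \<in> W"
    by (rule preimage_nbhd[OF c k good_open[OF W(3)] W(1)]) (rule that)
  show ?thesis
    by (rule that[of "N \<inter> N'" W \<theta>]) (use N N' W section_subset[OF N(4)] in auto)
qed

lemma lift_good0:
  assumes l: "lift K f \<sigma>" and c: "continuous_on K f" and k: "k \<in> K"
  obtains N W \<theta> where "open N" "k \<in> N" "good_nbhd P W" "f k \<in> W" "section_on P W \<theta>"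
    "\<forall>j\<in>N \<inter> K. f j \<in> W \<and> \<sigma> j = \<theta> (f j)"
  by (rule lift_good[OF l c k open_UNIV UNIV_I]) (rule that)

lemma lift_subset:
  assumes l: "lift K f \<sigma>" and J: "J \<subseteq> K" shows "lift J f \<sigma>"
  unfolding lift_def
proof
  fix k assume "k \<in> J"
  then have "k \<in> K" using J by blast
  then obtain N U \<theta> where N: "open N" "k \<in> N" "open U" "section_on P U \<theta>"
    "\<forall>j\<in>N \<inter> K. f j \<in> U \<and> \<sigma> j = \<theta> (f j)" by (rule liftE[OF l]) (rule that)
  have "\<forall>j\<in>N \<inter> J. f j \<in> U \<and> \<sigma> j = \<theta> (f j)" using N(5) J by auto
  then show "\<exists>N U \<theta>. open N \<and> k \<in> N \<and> open U \<and> section_on P U \<theta> \<and> (\<forall>j\<in>N \<inter> J. f j \<in> U \<and> \<sigma> j = \<theta> (f j))"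
    using N(1-4) by (intro exI[of _ N] exI[of _ U] exI[of _ \<theta>] conjI)
qed

lemma lift_cong:
  assumes l: "lift K f \<sigma>" and e: "\<And>k. k \<in> K \<Longrightarrow> f k = g k" "\<And>k. k \<in> K \<Longrightarrow> \<sigma> k = \<tau> k"
  shows "lift K g \<tau>"
  unfolding lift_def
proof
  fix k assume "k \<in> K"
  then obtain N U \<theta> where N: "open N" "k \<in> N" "open U" "section_on P U \<theta>"
    "\<forall>j\<in>N \<inter> K. f j \<in> U \<and> \<sigma> j = \<theta> (f j)" by (rule liftE[OF l]) (rule that)
  have "\<forall>j\<in>N \<inter> K. g j \<in> U \<and> \<tau> j = \<theta> (g j)" using N(5) e by auto
  then show "\<exists>N U \<theta>. open N \<and> k \<in> N \<and> open U \<and> section_on P U \<theta> \<and> (\<forall>j\<in>N \<inter> K. g j \<in> U \<and> \<tau> j = \<theta> (g j))"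
    using N(1-4) by (intro exI[of _ N] exI[of _ U] exI[of _ \<theta>] conjI)
qed

lemma lift_compose:
  assumes l: "lift K f \<sigma>" and g: "continuous_on J g" "\<And>j. j \<in> J \<Longrightarrow> g j \<in> K"
  shows "lift J (\<lambda>j. f (g j)) (\<lambda>j. \<sigma> (g j))"
  unfolding lift_def
proof
  fix j assume j: "j \<in> J"
  obtain N U \<theta> where N: "open N" "g j \<in> N" "open U" "section_on P U \<theta>"
    "\<forall>j\<in>N \<inter> K. f j \<in> U \<and> \<sigma> j = \<theta> (f j)"
    by (rule liftE[OF l g(2)[OF j]]) (rule that)
  obtain N' where N': "open N'" "j \<in> N'" "\<forall>i\<in>N' \<inter> J. g i \<in> N"
    by (rule preimage_nbhd[OF g(1) j N(1,2)]) (rule that)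
  have "\<forall>i\<in>N' \<inter> J. f (g i) \<in> U \<and> \<sigma> (g i) = \<theta> (f (g i))" using N N' g(2) by auto
  then show "\<exists>N U \<theta>. open N \<and> j \<in> N \<and> open U \<and> section_on P U \<theta> \<and>
      (\<forall>j\<in>N \<inter> J. f (g j) \<in> U \<and> \<sigma> (g j) = \<theta> (f (g j)))"
    using N'(1,2) N(3,4) by (intro exI[of _ N'] exI[of _ U] exI[of _ \<theta>]) simp
qed

lemma lift_section: "open U \<Longrightarrow> section_on P U \<theta> \<Longrightarrow> (\<And>k. k \<in> K \<Longrightarrow> f k \<in> U) \<Longrightarrow> lift K f (\<lambda>k. \<theta> (f k))"
  by (rule liftI[of K "\<lambda>_. UNIV" "\<lambda>_. U" "\<lambda>_. \<theta>"]) auto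

text \<open>Near each point of \<open>K\<close> both lifts come from sections over one good
  neighbourhood. If they agree at one nearby parameter, the sections agree throughout, so agreement
  propagates over the connected \<open>K\<close>.\<close>

lemma lift_unique:
  assumes K: "connected K" and c: "continuous_on K f" and l: "lift K f \<sigma>" "lift K f \<tau>"
    and k: "k \<in> K" "l \<in> K" "\<sigma> k = \<tau> k"
  shows "\<sigma> l = \<tau> l"
proof (rule connected_induction_simple[OF K k(1,2), of "\<lambda>k. \<sigma> k = \<tau> k", OF k(3)])
  fix a assume a: "a \<in> K"
  obtain N W \<theta> where N: "open N" "a \<in> N" "good_nbhd P W" "f a \<in> W" "section_on P W \<theta>"
    "\<forall>j\<in>N \<inter> K. f j \<in> W \<and> \<sigma> j = \<theta> (f j)"
    by (rule lift_good0[OF l(1) c a]) (rule that)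
  obtain N' W' \<theta>' where N': "open N'" "a \<in> N'" "good_nbhd P W'" "W' \<subseteq> W" "f a \<in> W'" "section_on P W' \<theta>'"
    "\<forall>j\<in>N' \<inter> K. f j \<in> W' \<and> \<tau> j = \<theta>' (f j)"
    by (rule lift_good[OF l(2) c a good_open[OF N(3)] N(4)]) (rule that)
  have eq: "\<sigma> y = \<tau> y" if xy: "x \<in> K \<inter> (N \<inter> N')" "y \<in> K \<inter> (N \<inter> N')" "\<sigma> x = \<tau> x" for x y
  proof -
    have "\<theta> (f x) = \<theta>' (f x)" using N(6)[rule_format, of x] N'(7)[rule_format, of x] xy by auto
    then have "\<theta> (f y) = \<theta>' (f y)"
      using good_unique[OF N'(3) section_subset[OF N(5) N'(4)] N'(6)] N'(7) xy by auto
    then show ?thesis using N(6)[rule_format, of y] N'(7)[rule_format, of y] xy by auto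
  qed
  have "\<forall>x\<in>K \<inter> (N \<inter> N'). \<forall>y\<in>K \<inter> (N \<inter> N'). \<sigma> x = \<tau> x \<longrightarrow> \<sigma> y = \<tau> y"
    by (intro ballI impI) (rule eq)
  then show "\<exists>T. openin (top_of_set K) T \<and> a \<in> T \<and> (\<forall>x\<in>T. \<forall>y\<in>T. \<sigma> x = \<tau> x \<longrightarrow> \<sigma> y = \<tau> y)"
    using a N(1,2) N'(1,2) by (intro exI[of _ "K \<inter> (N \<inter> N')"] conjI openin_open_Int open_Int IntI)
qed

text \<open>At a common point the two local sections have the same value, hence coincide on a good
  neighbourhood, and either one represents both pieces. At any other point, closedness keeps the
  other piece away.\<close>

lemma lift_glue:
  assumes cl: "closed K" "closed L" and c: "continuous_on (K \<union> L) f"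
    and l: "lift K f \<sigma>" "lift L f \<tau>" and eq: "\<And>k. k \<in> K \<inter> L \<Longrightarrow> \<sigma> k = \<tau> k"
  shows "lift (K \<union> L) f (\<lambda>k. if k \<in> K then \<sigma> k else \<tau> k)"
  unfolding lift_def
proof
  let ?\<rho> = "\<lambda>k. if k \<in> K then \<sigma> k else \<tau> k"
  have cK: "continuous_on K f" and cL: "continuous_on L f" using c continuous_on_subset by blast+
  fix k assume "k \<in> K \<union> L"
  then consider "k \<in> K \<inter> L" | "k \<in> K" "k \<notin> L" | "k \<in> L" "k \<notin> K" by blast
  then show "\<exists>N U \<theta>. open N \<and> k \<in> N \<and> open U \<and> section_on P U \<theta> \<and>
       (\<forall>j\<in>N \<inter> (K \<union> L). f j \<in> U \<and> ?\<rho> j = \<theta> (f j))"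
  proof cases
    case 1
    then have kK: "k \<in> K" and kL: "k \<in> L" by auto
    obtain N W \<theta> where N: "open N" "k \<in> N" "good_nbhd P W" "f k \<in> W" "section_on P W \<theta>"
      "\<forall>j\<in>N \<inter> K. f j \<in> W \<and> \<sigma> j = \<theta> (f j)"
      by (rule lift_good0[OF l(1) cK kK]) (rule that)
    obtain N' W' \<theta>' where N': "open N'" "k \<in> N'" "good_nbhd P W'" "W' \<subseteq> W" "f k \<in> W'" "section_on P W' \<theta>'"
      "\<forall>j\<in>N' \<inter> L. f j \<in> W' \<and> \<tau> j = \<theta>' (f j)"
      by (rule lift_good[OF l(2) cL kL good_open[OF N(3)] N(4)]) (rule that)
    obtain N'' where N'': "open N''" "k \<in> N''" "\<forall>j\<in>N'' \<inter> (K \<union> L). f j \<in> W'"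
      by (rule preimage_nbhd[OF c UnI1[OF kK] good_open[OF N'(3)] N'(5)]) (rule that)
    have "\<theta> (f k) = \<theta>' (f k)" using N(6)[rule_format, of k] N'(7)[rule_format, of k] eq[OF 1] 1 N(2) N'(2) by auto
    then have th: "\<theta> w = \<theta>' w" if "w \<in> W'" for w
      using good_unique[OF N'(3) section_subset[OF N(5) N'(4)] N'(6) N'(5) that] by blast
    have "\<forall>j\<in>(N \<inter> N' \<inter> N'') \<inter> (K \<union> L). f j \<in> W' \<and> ?\<rho> j = \<theta> (f j)"
      using N(6) N'(7) N''(3) th by auto
    then show ?thesis
      using N N' N'' by (intro exI[of _ "N \<inter> N' \<inter> N''"] exI[of _ W'] exI[of _ \<theta>])
        (auto intro: section_subset good_open)
  next
    case 2
    obtain N U \<theta> where N: "open N" "k \<in> N" "open U" "section_on P U \<theta>"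
      "\<forall>j\<in>N \<inter> K. f j \<in> U \<and> \<sigma> j = \<theta> (f j)"
      by (rule liftE[OF l(1) 2(1)]) (rule that)
    then show ?thesis using 2 cl(2)
      by (intro exI[of _ "N - L"] exI[of _ U] exI[of _ \<theta>]) (auto intro: open_Diff)
  next
    case 3
    obtain N U \<theta> where N: "open N" "k \<in> N" "open U" "section_on P U \<theta>"
      "\<forall>j\<in>N \<inter> L. f j \<in> U \<and> \<tau> j = \<theta> (f j)"
      by (rule liftE[OF l(2) 3(1)]) (rule that)
    then show ?thesis using 3 cl(1)
      by (intro exI[of _ "N - K"] exI[of _ U] exI[of _ \<theta>]) (auto intro: open_Diff)
  qed
qed

section \<open>Lifts of squares, paths and loops\<close>

lemma lift_local:
  assumes c: "continuous_on K f" and k: "k \<in> K"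
  obtains N where "open N" "k \<in> N" "\<forall>J j v. J \<subseteq> K \<inter> N \<longrightarrow> j \<in> J \<longrightarrow> (\<exists>\<sigma>. lift J f \<sigma> \<and> \<sigma> j = v)"
proof -
  obtain W where W: "f k \<in> W" "good_nbhd P W" using good[of UNIV "f k"] by auto
  obtain N where N: "open N" "k \<in> N" "\<forall>j\<in>N \<inter> K. f j \<in> W"
    by (rule preimage_nbhd[OF c k good_open[OF W(2)] W(1)]) (rule that)
  have "\<exists>\<sigma>. lift J f \<sigma> \<and> \<sigma> j = v" if J: "J \<subseteq> K \<inter> N" "j \<in> J" for J j v
  proof -
    have fJ: "f i \<in> W" if "i \<in> J" for i using that J N(3) by blast
    obtain \<theta> where \<theta>: "\<theta> (f j) = v" "section_on P W \<theta>"
      using good_ex[OF W(2) fJ[OF J(2)], of v] by blast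
    have "lift J f (\<lambda>k. \<theta> (f k))" by (rule lift_section[OF good_open[OF W(2)] \<theta>(2) fJ])
    then show ?thesis using \<theta>(1) by (intro exI[of _ "\<lambda>k. \<theta> (f k)"] conjI)
  qed
  then have "\<forall>J j v. J \<subseteq> K \<inter> N \<longrightarrow> j \<in> J \<longrightarrow> (\<exists>\<sigma>. lift J f \<sigma> \<and> \<sigma> j = v)" by (intro allI impI)
  then show ?thesis by (rule that[OF N(1,2)])
qed

text \<open>The interval of the second variable is subdivided while a neighbourhood of
  \<open>s0\<close> in the first is kept; the minimum of two radii serves for two adjacent pieces.
  The starting point \<open>s\<close> and the value \<open>v\<close> are arbitrary because each
  piece must continue whatever the preceding one delivers.\<close>

lemma lift_strip:
  fixes h :: "real \<times> real \<Rightarrow> 'm"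
  assumes c: "continuous_on ({0..1} \<times> {0..1}) h" and s0: "s0 \<in> {0..1}"
  shows "\<exists>\<epsilon>>0. \<forall>a b. {a..b} \<subseteq> {0..1} \<inter> ball s0 \<epsilon> \<longrightarrow> (\<forall>s\<in>{a..b}. \<forall>v. \<exists>\<sigma>. lift ({a..b} \<times> {0..1}) h \<sigma> \<and> \<sigma> (s, 0) = v)"
proof -
  \<comment> \<open>The guard is there because the local hypothesis of \<open>Bolzano\<close> ranges
    over all short intervals around a point, including those that leave
    \<open>{0..1}\<close>.\<close>
  let ?P = "\<lambda>c d. 0 \<le> c \<and> d \<le> 1 \<longrightarrow> (\<exists>\<epsilon>>0. \<forall>a b. {a..b} \<subseteq> {0..1} \<inter> ball s0 \<epsilon> \<longrightarrow>
      (\<forall>s\<in>{a..b}. \<forall>v. \<exists>\<sigma>. lift ({a..b} \<times> {c..d}) h \<sigma> \<and> \<sigma> (s, c) = v))"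
  have "?P 0 1"
  proof (rule Bolzano[of 0 1 ?P])
    fix c d e :: real assume P: "?P c d" "?P d e" and le: "c \<le> d" "d \<le> e"
    show "?P c e"
    proof
      assume ce: "0 \<le> c \<and> e \<le> 1"
      then have "\<exists>\<epsilon>>0. \<forall>a b. {a..b} \<subseteq> {0..1} \<inter> ball s0 \<epsilon> \<longrightarrow>
          (\<forall>s\<in>{a..b}. \<forall>v. \<exists>\<sigma>. lift ({a..b} \<times> {c..d}) h \<sigma> \<and> \<sigma> (s, c) = v)"
        using le by (intro mp[OF P(1)]) simp
      then obtain \<epsilon>1 where e1: "\<epsilon>1 > 0" "\<forall>a b. {a..b} \<subseteq> {0..1} \<inter> ball s0 \<epsilon>1 \<longrightarrow>
          (\<forall>s\<in>{a..b}. \<forall>v. \<exists>\<sigma>. lift ({a..b} \<times> {c..d}) h \<sigma> \<and> \<sigma> (s, c) = v)"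
        by (elim exE conjE) (rule that)
      have "\<exists>\<epsilon>>0. \<forall>a b. {a..b} \<subseteq> {0..1} \<inter> ball s0 \<epsilon> \<longrightarrow>
          (\<forall>s\<in>{a..b}. \<forall>v. \<exists>\<sigma>. lift ({a..b} \<times> {d..e}) h \<sigma> \<and> \<sigma> (s, d) = v)"
        using le ce by (intro mp[OF P(2)]) simp
      then obtain \<epsilon>2 where e2: "\<epsilon>2 > 0" "\<forall>a b. {a..b} \<subseteq> {0..1} \<inter> ball s0 \<epsilon>2 \<longrightarrow>
          (\<forall>s\<in>{a..b}. \<forall>v. \<exists>\<sigma>. lift ({a..b} \<times> {d..e}) h \<sigma> \<and> \<sigma> (s, d) = v)"
        by (elim exE conjE) (rule that)
      have "\<exists>\<sigma>. lift ({a..b} \<times> {c..e}) h \<sigma> \<and> \<sigma> (s, c) = v"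
        if ab: "{a..b} \<subseteq> {0..1} \<inter> ball s0 (min \<epsilon>1 \<epsilon>2)" and s: "s \<in> {a..b}" for a b s v
      proof -
        have "{a..b} \<subseteq> {0..1} \<inter> ball s0 \<epsilon>1" "{a..b} \<subseteq> {0..1} \<inter> ball s0 \<epsilon>2" using ab by auto
        note 1 = e1(2)[rule_format, OF this(1) s] and 2 = e2(2)[rule_format, OF this(2) s]
        obtain \<sigma> where \<sigma>: "lift ({a..b} \<times> {c..d}) h \<sigma>" "\<sigma> (s, c) = v" using 1 by blast
        obtain \<tau> where \<tau>: "lift ({a..b} \<times> {d..e}) h \<tau>" "\<tau> (s, d) = \<sigma> (s, d)" using 2 by blast
        have un: "{a..b} \<times> {c..e} = ({a..b} \<times> {c..d}) \<union> ({a..b} \<times> {d..e})" using le by auto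
        have sub: "{a..b} \<times> {c..e} \<subseteq> {0..1} \<times> {0..1}" using ab ce by auto
        \<comment> \<open>\<open>\<tau>\<close> was prescribed at the single point
          \<open>(s, d)\<close>; uniqueness over the connected common edge spreads the agreement to
          all of it.\<close>
        have mid: "\<sigma> k = \<tau> k" if "k \<in> {a..b} \<times> {d}" for k
        proof (rule lift_unique[of "{a..b} \<times> {d}" h \<sigma> \<tau> "(s, d)" k])
          show "connected ({a..b} \<times> {d})" by (intro connected_Times) auto
          show "continuous_on ({a..b} \<times> {d}) h"
            by (rule continuous_on_subset[OF c order_trans[OF _ sub]]) (use le in auto)
          show "lift ({a..b} \<times> {d}) h \<sigma>" by (rule lift_subset[OF \<sigma>(1)]) (use le in auto)
          show "lift ({a..b} \<times> {d}) h \<tau>" by (rule lift_subset[OF \<tau>(1)]) (use le in auto)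
        qed (use s \<tau> that in auto)
        have "lift ({a..b} \<times> {c..e}) h (\<lambda>k. if k \<in> {a..b} \<times> {c..d} then \<sigma> k else \<tau> k)"
          unfolding un
        proof (rule lift_glue[OF _ _ _ \<sigma>(1) \<tau>(1)])
          show "continuous_on ({a..b} \<times> {c..d} \<union> {a..b} \<times> {d..e}) h"
            using continuous_on_subset[OF c sub] unfolding un .
          show "\<sigma> k = \<tau> k" if "k \<in> {a..b} \<times> {c..d} \<inter> {a..b} \<times> {d..e}" for k
            using that by (intro mid) auto
        qed (auto intro!: closed_Times)
        then show ?thesis using \<sigma>(2) s le by (intro exI[of _ "\<lambda>k. if k \<in> {a..b} \<times> {c..d} then \<sigma> k else \<tau> k"]) auto
      qed
      then have "\<forall>a b. {a..b} \<subseteq> {0..1} \<inter> ball s0 (min \<epsilon>1 \<epsilon>2) \<longrightarrow>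
        (\<forall>s\<in>{a..b}. \<forall>v. \<exists>\<sigma>. lift ({a..b} \<times> {c..e}) h \<sigma> \<and> \<sigma> (s, c) = v)" by (intro allI impI ballI)
      moreover have "min \<epsilon>1 \<epsilon>2 > 0" using e1(1) e2(1) by simp
      ultimately show "\<exists>\<epsilon>>0. \<forall>a b. {a..b} \<subseteq> {0..1} \<inter> ball s0 \<epsilon> \<longrightarrow>
        (\<forall>s\<in>{a..b}. \<forall>v. \<exists>\<sigma>. lift ({a..b} \<times> {c..e}) h \<sigma> \<and> \<sigma> (s, c) = v)"
        by (intro exI[of _ "min \<epsilon>1 \<epsilon>2"] conjI)
    qed
  next
    fix t0 :: real assume t0: "0 \<le> t0" "t0 \<le> 1"
    then have k: "(s0, t0) \<in> {0..1} \<times> {0..1}" using s0 by simp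
    obtain N where N: "open N" "(s0, t0) \<in> N"
      "\<forall>J j v. J \<subseteq> ({0..1} \<times> {0..1}) \<inter> N \<longrightarrow> j \<in> J \<longrightarrow> (\<exists>\<sigma>. lift J h \<sigma> \<and> \<sigma> j = v)"
      by (rule lift_local[OF c k]) (rule that)
    obtain A B where AB: "open A" "open B" "s0 \<in> A" "t0 \<in> B" "A \<times> B \<subseteq> N"
      using open_prod_elim[OF N(1,2)] by (metis mem_Sigma_iff)
    obtain \<epsilon> where \<epsilon>: "\<epsilon> > 0" "ball s0 \<epsilon> \<subseteq> A" using AB openE by metis
    obtain \<delta> where \<delta>: "\<delta> > 0" "ball t0 \<delta> \<subseteq> B" using AB openE by metis
    have loc: "?P c' d'" if cd: "c' \<le> t0 \<and> t0 \<le> d' \<and> d' - c' < \<delta>" for c' d'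
    proof
      assume g: "0 \<le> c' \<and> d' \<le> 1"
      have "{c'..d'} \<subseteq> ball t0 \<delta>" using cd by (auto simp: dist_real_def)
      then have cdB: "{c'..d'} \<subseteq> B" using \<delta> by blast
      have "\<exists>\<sigma>. lift ({a..b} \<times> {c'..d'}) h \<sigma> \<and> \<sigma> (s, c') = v"
        if ab: "{a..b} \<subseteq> {0..1} \<inter> ball s0 \<epsilon>" and s: "s \<in> {a..b}" for a b s v
      proof (rule N(3)[rule_format])
        have "{a..b} \<subseteq> A" using ab \<epsilon> by blast
        then have "{a..b} \<times> {c'..d'} \<subseteq> N" using cdB AB(5) by blast
        moreover have "{c'..d'} \<subseteq> {0..1}" using g by auto
        ultimately show "{a..b} \<times> {c'..d'} \<subseteq> ({0..1} \<times> {0..1}) \<inter> N" using ab by blast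
        show "(s, c') \<in> {a..b} \<times> {c'..d'}" using s cd by auto
      qed
      then have "\<forall>a b. {a..b} \<subseteq> {0..1} \<inter> ball s0 \<epsilon> \<longrightarrow>
        (\<forall>s\<in>{a..b}. \<forall>v. \<exists>\<sigma>. lift ({a..b} \<times> {c'..d'}) h \<sigma> \<and> \<sigma> (s, c') = v)" by (intro allI impI ballI)
      then show "\<exists>\<epsilon>>0. \<forall>a b. {a..b} \<subseteq> {0..1} \<inter> ball s0 \<epsilon> \<longrightarrow>
        (\<forall>s\<in>{a..b}. \<forall>v. \<exists>\<sigma>. lift ({a..b} \<times> {c'..d'}) h \<sigma> \<and> \<sigma> (s, c') = v)"
        by (intro exI[of _ \<epsilon>] conjI \<epsilon>(1))
    qed
    have "\<forall>c d. c \<le> t0 \<and> t0 \<le> d \<and> d - c < \<delta> \<longrightarrow> ?P c d" by (rule allI, rule allI, rule impI, rule loc)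
    then show "\<exists>\<delta>>0. \<forall>c d. c \<le> t0 \<and> t0 \<le> d \<and> d - c < \<delta> \<longrightarrow> ?P c d" by (intro exI[of _ \<delta>] conjI \<delta>(1))
  qed simp
  then show ?thesis by simp
qed

text \<open>The same bisection in the first variable, with the full-height strips of
  \<open>lift_strip\<close> as local pieces.\<close>

lemma lift_square:
  fixes h :: "real \<times> real \<Rightarrow> 'm"
  assumes c: "continuous_on ({0..1} \<times> {0..1}) h"
  shows "\<exists>\<sigma>. lift ({0..1} \<times> {0..1}) h \<sigma> \<and> \<sigma> (0, 0) = v"
proof -
  let ?Q = "\<lambda>a b. 0 \<le> a \<and> b \<le> 1 \<longrightarrow> (\<forall>v. \<exists>\<sigma>. lift ({a..b} \<times> {0..1}) h \<sigma> \<and> \<sigma> (a, 0) = v)"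
  have "?Q 0 1"
  proof (rule Bolzano[of 0 1 ?Q])
    fix a b d :: real assume Q: "?Q a b" "?Q b d" and le: "a \<le> b" "b \<le> d"
    show "?Q a d"
    proof (intro impI allI)
      fix v
      assume ad: "0 \<le> a \<and> d \<le> 1"
      then have 1: "0 \<le> a \<and> b \<le> 1" and 2: "0 \<le> b \<and> d \<le> 1" using le by auto
      obtain \<sigma> where \<sigma>: "lift ({a..b} \<times> {0..1}) h \<sigma>" "\<sigma> (a, 0) = v"
        using mp[OF Q(1) 1, THEN spec, of v] by (elim exE conjE) (rule that)
      obtain \<tau> where \<tau>: "lift ({b..d} \<times> {0..1}) h \<tau>" "\<tau> (b, 0) = \<sigma> (b, 0)"
        using mp[OF Q(2) 2, THEN spec, of "\<sigma> (b, 0)"] by (elim exE conjE) (rule that)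
      have un: "{a..d} \<times> {0..1} = ({a..b} \<times> {0..1}) \<union> ({b..d} \<times> {0..1::real})" using le by auto
      have sub: "{a..d} \<times> {0..1} \<subseteq> {0..1} \<times> {0..1::real}" using ad by auto
      have mid: "\<sigma> k = \<tau> k" if "k \<in> {b} \<times> {0..1}" for k
      proof (rule lift_unique[of "{b} \<times> {0..1}" h \<sigma> \<tau> "(b, 0)" k])
        show "connected ({b} \<times> {0..1::real})" by (intro connected_Times) auto
        show "continuous_on ({b} \<times> {0..1}) h"
          by (rule continuous_on_subset[OF c]) (use ad le in auto)
        show "lift ({b} \<times> {0..1}) h \<sigma>" by (rule lift_subset[OF \<sigma>(1)]) (use le in auto)
        show "lift ({b} \<times> {0..1}) h \<tau>" by (rule lift_subset[OF \<tau>(1)]) (use le in auto)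
      qed (use \<tau> that in auto)
      have "lift ({a..d} \<times> {0..1}) h (\<lambda>k. if k \<in> {a..b} \<times> {0..1} then \<sigma> k else \<tau> k)"
        unfolding un
      proof (rule lift_glue[OF _ _ _ \<sigma>(1) \<tau>(1)])
        show "continuous_on ({a..b} \<times> {0..1} \<union> {b..d} \<times> {0..1}) h"
          using continuous_on_subset[OF c sub] unfolding un .
        show "\<sigma> k = \<tau> k" if "k \<in> {a..b} \<times> {0..1} \<inter> {b..d} \<times> {0..1}" for k
          using that by (intro mid) auto
      qed (auto intro!: closed_Times)
      then show "\<exists>\<sigma>. lift ({a..d} \<times> {0..1}) h \<sigma> \<and> \<sigma> (a, 0) = v"
        using \<sigma>(2) le by (intro exI[of _ "\<lambda>k. if k \<in> {a..b} \<times> {0..1} then \<sigma> k else \<tau> k"]) auto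
    qed
  next
    fix s0 :: real assume "0 \<le> s0" "s0 \<le> 1"
    then have s01: "s0 \<in> {0..1}" by simp
    obtain \<epsilon> where \<epsilon>: "\<epsilon> > 0" "\<forall>a b. {a..b} \<subseteq> {0..1} \<inter> ball s0 \<epsilon> \<longrightarrow>
        (\<forall>s\<in>{a..b}. \<forall>v. \<exists>\<sigma>. lift ({a..b} \<times> {0..1}) h \<sigma> \<and> \<sigma> (s, 0) = v)"
      using lift_strip[OF c s01] by (elim exE conjE) (rule that)
    have loc: "?Q a b" if ab: "a \<le> s0 \<and> s0 \<le> b \<and> b - a < \<epsilon>" for a b
    proof (intro impI allI \<epsilon>(2)[rule_format])
      show "{a..b} \<subseteq> {0..1} \<inter> ball s0 \<epsilon>" if "0 \<le> a \<and> b \<le> 1" using that ab by (auto simp: dist_real_def)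
      show "a \<in> {a..b}" using ab by auto
    qed
    have "\<forall>a b. a \<le> s0 \<and> s0 \<le> b \<and> b - a < \<epsilon> \<longrightarrow> ?Q a b" by (rule allI, rule allI, rule impI, rule loc)
    then show "\<exists>\<epsilon>>0. \<forall>a b. a \<le> s0 \<and> s0 \<le> b \<and> b - a < \<epsilon> \<longrightarrow> ?Q a b" by (intro exI[of _ \<epsilon>] conjI \<epsilon>(1))
  qed simp
  then show ?thesis by simp
qed

text \<open>A path is treated as a square that does not depend on its first variable.\<close>

lemma lift_path:
  fixes \<gamma> :: "real \<Rightarrow> 'm"
  assumes "path \<gamma>"
  shows "\<exists>\<sigma>. lift {0..1} \<gamma> \<sigma> \<and> \<sigma> 0 = v"
proof -
  have "continuous_on ({0..1} \<times> {0..1}) (\<lambda>k::real \<times> real. \<gamma> (snd k))"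
    by (rule continuous_on_compose2[of "{0..1}" \<gamma> _ snd]) (use assms in \<open>auto simp: path_def intro: continuous_on_snd\<close>)
  then obtain \<sigma> where \<sigma>: "lift ({0..1} \<times> {0..1}) (\<lambda>k::real \<times> real. \<gamma> (snd k)) \<sigma>" "\<sigma> (0, 0) = v"
    using lift_square by blast
  have "lift {0..1} (\<lambda>t. \<gamma> (snd (0::real, t::real))) (\<lambda>t. \<sigma> (0, t))"
    by (rule lift_compose[OF \<sigma>(1)]) (auto intro!: continuous_intros)
  then show ?thesis using \<sigma>(2) by (intro exI[of _ "\<lambda>t. \<sigma> (0, t)"]) simp
qed

text \<open>The homotopy to a constant loop is lifted over the square. Its edge \<open>s = 0\<close>
  is the loop, its edge \<open>s = 1\<close> is constant, and the edges \<open>t = 0\<close> and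
  \<open>t = 1\<close> run along the same path. The lift is constant on the edge
  \<open>s = 1\<close>, so by uniqueness its values on the other two edges agree at every
  \<open>s\<close>, in particular at \<open>s = 0\<close>.\<close>

lemma lift_loop:
  assumes sc: "simply_connected (UNIV :: 'm set)"
    and p: "path p" "pathfinish p = pathstart p" and l: "lift {0..1} p \<sigma>"
  shows "\<sigma> 1 = \<sigma> 0"
proof -
  have "homotopic_loops UNIV p (\<lambda>_. p 0)"
    using sc p unfolding simply_connected_def
    by (auto simp: path_def pathfinish_def pathstart_def)
  then obtain h :: "real \<times> real \<Rightarrow> 'm" where h: "continuous_on ({0..1} \<times> {0..1}) h"
     "\<forall>x\<in>{0..1}. h (0, x) = p x" "\<forall>x\<in>{0..1}. h (1, x) = p 0" "\<forall>s\<in>{0..1}. h (s, 1) = h (s, 0)"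
    unfolding homotopic_loops pathfinish_def pathstart_def o_def by (elim exE conjE) (rule that, assumption+)
  obtain \<tau> where \<tau>: "lift ({0..1} \<times> {0..1}) h \<tau>" "\<tau> (0, 0) = \<sigma> 0" using lift_square[OF h(1)] by blast
  have ch: "continuous_on {0..1} (\<lambda>s. h (g s))"
    if "continuous_on {0..1} g" "\<And>s. s \<in> {0..1} \<Longrightarrow> g s \<in> {0..1} \<times> {0..1}" for g :: "real \<Rightarrow> real \<times> real"
    by (rule continuous_on_compose2[OF h(1) that(1)]) (use that(2) in blast)
  have lc: "lift {0..1} (\<lambda>s. h (g s)) (\<lambda>s. \<tau> (g s))"
    if "continuous_on {0..1} g" "\<And>s. s \<in> {0..1} \<Longrightarrow> g s \<in> {0..1} \<times> {0..1}" for g :: "real \<Rightarrow> real \<times> real"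
    by (rule lift_compose[OF \<tau>(1) that])
  have "\<sigma> 1 = \<tau> (0, 1)"
  proof (rule lift_unique[of "{0..1}" p \<sigma> "\<lambda>t. \<tau> (0, t)" 0 1])
    show "lift {0..1} p (\<lambda>t. \<tau> (0, t))"
      by (rule lift_cong[OF lc[of "\<lambda>t. (0, t)"]]) (use h(2) in \<open>auto intro!: continuous_intros\<close>)
  qed (use p l \<tau> in \<open>auto simp: path_def\<close>)
  \<comment> \<open>The comparison starts at parameter 1, where the loop has shrunk to a point, and
    runs back to 0.\<close>
  also have "\<tau> (0, 1) = \<tau> (0, 0)"
  proof (rule lift_unique[of "{0..1}" "\<lambda>s. h (s, 0)" "\<lambda>s. \<tau> (s, 1)" "\<lambda>s. \<tau> (s, 0)" 1 0])
    show "lift {0..1} (\<lambda>s. h (s, 0)) (\<lambda>s. \<tau> (s, 1))"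
      by (rule lift_cong[OF lc[of "\<lambda>s. (s, 1)"]]) (use h(4) in \<open>auto intro!: continuous_intros\<close>)
    show "lift {0..1} (\<lambda>s. h (s, 0)) (\<lambda>s. \<tau> (s, 0))"
      by (rule lc[of "\<lambda>s. (s, 0)"]) (auto intro!: continuous_intros)
    show "continuous_on {0..1} (\<lambda>s. h (s, 0))"
      by (rule ch[of "\<lambda>s. (s, 0)"]) (auto intro!: continuous_intros)
    show "\<tau> (1, 1) = \<tau> (1, 0)"
    proof (rule lift_unique[of "{0..1}" "\<lambda>s::real. p 0" "\<lambda>t. \<tau> (1, t)" "\<lambda>t. \<tau> (1, 0)" 0 1])
      show "lift {0..1} (\<lambda>s. p 0) (\<lambda>t. \<tau> (1, t))"
        by (rule lift_cong[OF lc[of "\<lambda>t. (1, t)"]]) (use h(3) in \<open>auto intro!: continuous_intros\<close>)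
      obtain W where W: "p 0 \<in> W" "good_nbhd P W" using good[of UNIV "p 0"] by auto
      obtain \<theta> where \<theta>: "\<theta> (p 0) = \<tau> (1, 0)" "section_on P W \<theta>"
        using good_ex[OF W(2,1), of "\<tau> (1, 0)"] by blast
      show "lift {0..1::real} (\<lambda>s. p 0) (\<lambda>t. \<tau> (1, 0))"
        using lift_section[OF good_open[OF W(2)] \<theta>(2), of "{0..1::real}" "\<lambda>s. p 0"] W(1) \<theta>(1) by simp
    qed auto
  qed auto
  finally show ?thesis using \<tau>(2) by simp
qed

text \<open>By definition any two loops are freely homotopic; for constant loops, the track of the
  base point is a path between their points.\<close>

lemma simply_connected_path:
  assumes "simply_connected (UNIV :: 'm set)"
  obtains g where "path g" "g 0 = (x :: 'm)" "g 1 = y"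
proof -
  have "homotopic_loops UNIV (\<lambda>_. x) (\<lambda>_. y)"
    using assms unfolding simply_connected_def by (auto simp: path_def pathfinish_def pathstart_def)
  then obtain h :: "real \<times> real \<Rightarrow> 'm" where h: "continuous_on ({0..1} \<times> {0..1}) h"
     "\<forall>t\<in>{0..1}. h (0, t) = x" "\<forall>t\<in>{0..1}. h (1, t) = y"
    unfolding homotopic_loops by (elim exE conjE) (rule that, assumption+)
  show ?thesis
  proof (rule that[of "\<lambda>s. h (s, 0)"])
    show "path (\<lambda>s. h (s, 0))" unfolding path_def
      by (rule continuous_on_compose2[OF h(1), of _ "\<lambda>s. (s, 0)"]) (auto intro!: continuous_intros)
  qed (use h in auto)
qed

lemma lift_first_half:
  assumes l: "lift {0..1} (\<gamma> +++ \<delta>) \<tau>" and g: "path \<gamma>" "lift {0..1} \<gamma> \<sigma>" and 0: "\<tau> 0 = \<sigma> 0"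
  shows "\<tau> (1/2) = \<sigma> 1"
proof -
  have "lift {0..1} (\<lambda>t. (\<gamma> +++ \<delta>) (t / 2)) (\<lambda>t. \<tau> (t / 2))"
    by (rule lift_compose[OF l]) (auto intro!: continuous_intros)
  then have "lift {0..1} \<gamma> (\<lambda>t. \<tau> (t / 2))"
    by (rule lift_cong) (auto simp: joinpaths_def)
  then have "(\<lambda>t. \<tau> (t / 2)) 1 = \<sigma> 1"
    by (intro lift_unique[of "{0..1}" \<gamma> "\<lambda>t. \<tau> (t / 2)" \<sigma> 0 1]) (use g 0 in \<open>auto simp: path_def\<close>)
  then show ?thesis by simp
qed

section \<open>Continuation of values and global sections\<close>

definition continues_to :: "'m \<Rightarrow> 'v \<Rightarrow> 'm \<Rightarrow> 'v \<Rightarrow> bool" where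
  "continues_to x v q w \<longleftrightarrow> (\<exists>\<gamma> \<sigma>. path \<gamma> \<and> \<gamma> 0 = x \<and> \<gamma> 1 = q \<and> lift {0..1} \<gamma> \<sigma> \<and> \<sigma> 0 = v \<and> \<sigma> 1 = w)"

text \<open>Going along one path and back along the other is a loop, along which the lift returns to
  its initial value. Its second half, read backwards, is the lift along the second path.\<close>

lemma continues_to_unique:
  assumes sc: "simply_connected (UNIV :: 'm set)" and c: "continues_to x v q w" "continues_to x v q w'"
  shows "w = w'"
proof -
  obtain \<gamma> \<sigma> where g: "path \<gamma>" "\<gamma> 0 = x" "\<gamma> 1 = q" "lift {0..1} \<gamma> \<sigma>" "\<sigma> 0 = v" "\<sigma> 1 = w"
    using c(1) unfolding continues_to_def by blast
  obtain \<gamma>' \<sigma>' where g': "path \<gamma>'" "\<gamma>' 0 = x" "\<gamma>' 1 = q" "lift {0..1} \<gamma>' \<sigma>'" "\<sigma>' 0 = v" "\<sigma>' 1 = w'"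
    using c(2) unfolding continues_to_def by blast
  let ?p = "\<gamma> +++ reversepath \<gamma>'"
  have "pathfinish \<gamma> = pathfinish \<gamma>'" using g g' by (simp add: pathfinish_def)
  then have p: "path ?p" using g(1) g'(1) by (intro path_join_imp) auto
  have pl: "pathfinish ?p = pathstart ?p" using g g' by (simp add: pathfinish_def pathstart_def reversepath_def joinpaths_def)
  obtain \<tau> where \<tau>: "lift {0..1} ?p \<tau>" "\<tau> 0 = v" using lift_path[OF p] by blast
  have 1: "\<tau> (1/2) = w" using lift_first_half[OF \<tau>(1) g(1,4)] g \<tau>(2) by simp
  have 2: "\<tau> 1 = v" using lift_loop[OF sc p pl \<tau>(1)] \<tau>(2) by simp
  have "lift {0..1} (\<lambda>t. ?p (1 - t / 2)) (\<lambda>t. \<tau> (1 - t / 2))"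
    by (rule lift_compose[OF \<tau>(1)]) (auto intro!: continuous_intros)
  then have "lift {0..1} \<gamma>' (\<lambda>t. \<tau> (1 - t / 2))"
  proof (rule lift_cong)
    fix t :: real assume t: "t \<in> {0..1}"
    show "?p (1 - t / 2) = \<gamma>' t"
      using t g(3) g'(3) by (cases "t = 1") (auto simp: joinpaths_def reversepath_def)
  qed simp
  then have "(\<lambda>t. \<tau> (1 - t / 2)) 1 = \<sigma>' 1"
    by (intro lift_unique[of "{0..1}" \<gamma>' "\<lambda>t. \<tau> (1 - t / 2)" \<sigma>' 0 1]) (use g' 2 in \<open>auto simp: path_def\<close>)
  then show ?thesis using 1 g'(6) by simp
qed

text \<open>The value at \<open>q\<close> is obtained by continuation along any path from
  \<open>x\<close>. Local agreement with a section near \<open>q\<close> holds because a path to a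
  nearby point may be chosen to pass through \<open>q\<close> and then stay in the good
  neighbourhood.\<close>

theorem global_section_exists:
  assumes sc: "simply_connected (UNIV :: 'm set)"
  shows "\<exists>\<Theta>. \<Theta> x = v \<and> (\<forall>q. P q \<Theta>)"
proof -
  define \<Theta> where "\<Theta> q = (SOME w. continues_to x v q w)" for q
  have ex: "\<exists>w. continues_to x v q w" for q
  proof -
    obtain g where g: "path g" "g 0 = x" "g 1 = q" using simply_connected_path[OF sc] by blast
    obtain \<sigma> where "lift {0..1} g \<sigma>" "\<sigma> 0 = v" using lift_path[OF g(1)] by blast
    then show ?thesis using g unfolding continues_to_def by blast
  qed
  have \<Theta>: "continues_to x v q (\<Theta> q)" for q unfolding \<Theta>_def by (rule someI_ex[OF ex])
  have eqI: "\<Theta> q = w" if "continues_to x v q w" for q w by (rule continues_to_unique[OF sc \<Theta> that])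
  have "P q \<Theta>" for q
  proof -
    obtain W where W: "q \<in> W" "good_nbhd P W" using good[of UNIV q] by auto
    obtain \<theta> where \<theta>: "\<theta> q = \<Theta> q" "section_on P W \<theta>"
      using good_ex[OF W(2,1), of "\<Theta> q"] by blast
    obtain \<gamma> \<sigma> where g: "path \<gamma>" "\<gamma> 0 = x" "\<gamma> 1 = q" "lift {0..1} \<gamma> \<sigma>" "\<sigma> 0 = v" "\<sigma> 1 = \<Theta> q"
      using \<Theta>[of q] unfolding continues_to_def by blast
    have "\<theta> r = \<Theta> r" if r: "r \<in> W" for r
    proof -
      have "path_connected W" using W(2) by (simp add: good_nbhd_def)
      then obtain \<delta> where d: "path \<delta>" "path_image \<delta> \<subseteq> W" "\<delta> 0 = q" "\<delta> 1 = r"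
        using W(1) r unfolding path_connected_def pathstart_def pathfinish_def by blast
      have dW: "\<delta> t \<in> W" if "t \<in> {0..1}" for t using d(2) that by (auto simp: path_image_def)
      let ?p = "\<gamma> +++ \<delta>"
      have p: "path ?p" using g d by (auto intro!: path_join_imp simp: pathfinish_def pathstart_def)
      obtain \<tau> where \<tau>: "lift {0..1} ?p \<tau>" "\<tau> 0 = v" using lift_path[OF p] by blast
      have 1: "\<tau> (1/2) = \<Theta> q" using lift_first_half[OF \<tau>(1) g(1,4)] g \<tau>(2) by simp
      have "lift {0..1} (\<lambda>t. ?p (1/2 + t / 2)) (\<lambda>t. \<tau> (1/2 + t / 2))"
        by (rule lift_compose[OF \<tau>(1)]) (auto intro!: continuous_intros)
      then have "lift {0..1} \<delta> (\<lambda>t. \<tau> (1/2 + t / 2))"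
      proof (rule lift_cong)
        fix t :: real assume t: "t \<in> {0..1}"
        show "?p (1/2 + t / 2) = \<delta> t"
          using t g(3) d(3) by (cases "t = 0") (auto simp: joinpaths_def)
      qed simp
      then have "(\<lambda>t. \<tau> (1/2 + t / 2)) 1 = (\<lambda>t. \<theta> (\<delta> t)) 1"
        by (intro lift_unique[of "{0..1}" \<delta> "\<lambda>t. \<tau> (1/2 + t / 2)" "\<lambda>t. \<theta> (\<delta> t)" 0 1]
             lift_section[OF good_open[OF W(2)] \<theta>(2) dW]) (use d 1 \<theta> in \<open>auto simp: path_def\<close>)
      then have "\<tau> 1 = \<theta> r" using d(4) by simp
      moreover have "continues_to x v r (\<tau> 1)"
        unfolding continues_to_def using p \<tau> g d
        by (intro exI[of _ ?p] exI[of _ \<tau>]) (simp add: joinpaths_def)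
      ultimately show ?thesis using eqI by simp
    qed
    then show ?thesis using germ[OF good_open[OF W(2)] W(1)] \<theta>(2) W(1) unfolding section_on_def by blast
  qed
  moreover have "continues_to x v x v"
  proof -
    obtain \<sigma> where s: "lift {0..1} (\<lambda>_::real. x) \<sigma>" "\<sigma> 0 = v" using lift_path[of "\<lambda>_. x"] by (auto simp: path_def)
    have "\<sigma> 1 = \<sigma> 0" by (rule lift_loop[OF sc _ _ s(1)]) (auto simp: path_def pathfinish_def pathstart_def)
    then show ?thesis unfolding continues_to_def using s
      by (intro exI[of _ "\<lambda>_. x"] exI[of _ \<sigma>]) (auto simp: path_def)
  qed
  ultimately show ?thesis using eqI by blast
qed

lemma global_section_unique:
  assumes "connected (UNIV :: 'm set)" "\<And>q. P q \<theta>" "\<And>q. P q \<theta>'" "\<theta> x = \<theta>' x"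
  shows "\<theta> y = \<theta>' y"
proof (rule connected_induction_simple[OF assms(1), of x y "\<lambda>q. \<theta> q = \<theta>' q"])
  fix a :: 'm
  obtain W where W: "a \<in> W" "good_nbhd P W" using good[of UNIV a] by auto
  have eq: "\<theta> r = \<theta>' r" if "q \<in> W" "r \<in> W" "\<theta> q = \<theta>' q" for q r
  proof -
    have sec: "section_on P W \<theta>" "section_on P W \<theta>'" using assms(2,3) by (simp_all add: section_on_def)
    show ?thesis by (rule good_unique[of W \<theta> \<theta>' q r]) (fact W(2) sec that)+
  qed
  have "\<forall>x\<in>W. \<forall>y\<in>W. \<theta> x = \<theta>' x \<longrightarrow> \<theta> y = \<theta>' y" by (intro ballI impI) (rule eq)
  moreover have "openin (top_of_set UNIV) W" using good_open[OF W(2)] by simp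
  ultimately show "\<exists>T. openin (top_of_set UNIV) T \<and> a \<in> T \<and> (\<forall>x\<in>T. \<forall>y\<in>T. \<theta> x = \<theta>' x \<longrightarrow> \<theta> y = \<theta>' y)"
    using W(1) by (intro exI[of _ W] conjI)
qed (rule UNIV_I UNIV_I assms(4))+

end

section \<open>Charts and vector fields\<close>

locale analytic_manifold =
  fixes A :: "('m::{t2_space,second_countable_topology}, 'n::finite) chart set"
  assumes atlas: "analytic_atlas A"
begin

lemma chart_at_in: "chart_at A p \<in> A" and in_chart_at: "p \<in> dom_chart (chart_at A p)"
proof -
  have "p \<in> (\<Union>c\<in>A. dom_chart c)" using atlas by (simp add: analytic_atlas_def)
  then have "\<exists>c. c \<in> A \<and> p \<in> dom_chart c" by blast
  from someI_ex[OF this] show "chart_at A p \<in> A" "p \<in> dom_chart (chart_at A p)"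
    by (simp_all add: chart_at_def)
qed

lemma is_chartD: "c \<in> A \<Longrightarrow> is_chart c" using atlas by (simp add: analytic_atlas_def)

lemma open_dom: "c \<in> A \<Longrightarrow> open (dom_chart c)" using is_chartD by (auto simp: is_chart_def)

lemma open_ran: "c \<in> A \<Longrightarrow> open (ran_chart c)" using is_chartD by (auto simp: is_chart_def)

lemma chart_hom: "c \<in> A \<Longrightarrow> homeomorphism (dom_chart c) (ran_chart c) (map_chart c) (inv_chart c)"
  using is_chartD by (auto simp: is_chart_def)

lemma inv_map: "c \<in> A \<Longrightarrow> p \<in> dom_chart c \<Longrightarrow> inv_chart c (map_chart c p) = p"
  using homeomorphism_apply1[OF chart_hom] .

lemma map_inv: "z \<in> ran_chart c \<Longrightarrow> map_chart c (inv_chart c z) = z"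
  by (rule f_inv_into_f)

lemma inv_in: "z \<in> ran_chart c \<Longrightarrow> inv_chart c z \<in> dom_chart c"
  by (rule inv_into_into)

lemma map_in: "p \<in> dom_chart c \<Longrightarrow> map_chart c p \<in> ran_chart c"
  by (rule imageI)

text \<open>Written with \<open>inv_chart\<close>, so that membership unfolds to conditions on a
  point of the manifold; \<open>overlap_eq\<close> recovers the image that occurs in
  \<open>analytic_atlas\<close>.\<close>

definition overlap :: "('m, 'n) chart \<Rightarrow> 'm set \<Rightarrow> (real^'n) set" where
  "overlap c U = {z \<in> ran_chart c. inv_chart c z \<in> U}"

lemma overlap_eq: "c \<in> A \<Longrightarrow> overlap c U = map_chart c ` (dom_chart c \<inter> U)"
proof (intro set_eqI iffI)
  fix z assume "z \<in> overlap c U"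
  then have z: "z \<in> ran_chart c" "inv_chart c z \<in> U" by (auto simp: overlap_def)
  show "z \<in> map_chart c ` (dom_chart c \<inter> U)"
    by (rule image_eqI[of z "map_chart c" "inv_chart c z", OF map_inv[OF z(1), symmetric] IntI[OF inv_in[OF z(1)] z(2)]])
next
  fix z assume c: "c \<in> A" and "z \<in> map_chart c ` (dom_chart c \<inter> U)"
  then obtain p where "p \<in> dom_chart c" "p \<in> U" "z = map_chart c p" by blast
  then show "z \<in> overlap c U" using inv_map[OF c] by (auto simp: overlap_def)
qed

lemma open_overlap: "c \<in> A \<Longrightarrow> open U \<Longrightarrow> open (overlap c U)"
proof -
  assume c: "c \<in> A" and U: "open U"
  have "openin (top_of_set (ran_chart c)) (map_chart c ` (dom_chart c \<inter> U))"
    by (rule homeomorphism_imp_open_map[OF chart_hom[OF c]]) (use U in \<open>simp add: openin_open_Int\<close>)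
  then show ?thesis unfolding overlap_eq[OF c] using openin_open_eq[OF open_ran[OF c]] by blast
qed

lemma overlap_mem: "c \<in> A \<Longrightarrow> p \<in> dom_chart c \<Longrightarrow> p \<in> U \<Longrightarrow> map_chart c p \<in> overlap c U"
  by (simp add: overlap_def map_in inv_map)

lemma open_inv_image: "c \<in> A \<Longrightarrow> open V \<Longrightarrow> V \<subseteq> ran_chart c \<Longrightarrow> open (inv_chart c ` V)"
proof -
  assume c: "c \<in> A" and V: "open V" "V \<subseteq> ran_chart c"
  have "openin (top_of_set (dom_chart c)) (inv_chart c ` V)"
    by (rule homeomorphism_imp_open_map[OF homeomorphism_symD[OF chart_hom[OF c]]])
       (use V open_ran[OF c] in \<open>simp add: openin_open_eq\<close>)
  then show ?thesis using openin_open_eq[OF open_dom[OF c]] by blast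
qed

lemma transition_smooth:
  assumes "c \<in> A" "d \<in> A"
  shows "smooth_on (overlap c (dom_chart d)) (map_chart d \<circ> inv_chart c)"
proof (rule real_analytic_smooth)
  show "open (overlap c (dom_chart d))" using assms by (simp add: open_overlap open_dom)
  show "real_analytic_on (overlap c (dom_chart d)) (map_chart d \<circ> inv_chart c)"
    using atlas assms unfolding overlap_eq[OF assms(1)] analytic_atlas_def by blast
qed

section \<open>Transition derivatives and tangent vectors\<close>

definition dtrans :: "('m, 'n) chart \<Rightarrow> ('m, 'n) chart \<Rightarrow> 'm \<Rightarrow> real^'n \<Rightarrow> real^'n" where
  "dtrans c d p = frechet_derivative (map_chart d \<circ> inv_chart c) (at (map_chart c p))"

lemma dtrans_has_derivative:
  assumes "c \<in> A" "d \<in> A" "p \<in> dom_chart c" "p \<in> dom_chart d"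
  shows "((map_chart d \<circ> inv_chart c) has_derivative dtrans c d p) (at (map_chart c p))"
  unfolding dtrans_def
  by (rule smooth_on_has_derivative[OF transition_smooth[OF assms(1,2)]]) (simp add: overlap_mem assms)

lemma linear_dtrans:
  assumes "c \<in> A" "d \<in> A" "p \<in> dom_chart c" "p \<in> dom_chart d"
  shows "linear (dtrans c d p)"
  using has_derivative_linear[OF dtrans_has_derivative[OF assms]] .

text \<open>Derivatives of functions on the manifold are defined in the chosen chart at each point;
  this transfers them to any other chart around it.\<close>

lemma chain_inv:
  assumes c: "c \<in> A" and d: "d \<in> A" and p: "p \<in> dom_chart c" "p \<in> dom_chart d"
    and D: "((f \<circ> inv_chart c) has_derivative D) (at (map_chart c p))"
  shows "((f \<circ> inv_chart d) has_derivative (\<lambda>w. D (dtrans d c p w))) (at (map_chart d p))"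
proof -
  have "(map_chart c \<circ> inv_chart d) (map_chart d p) = map_chart c p" using inv_map[OF d p(2)] by simp
  then have "((\<lambda>z. (f \<circ> inv_chart c) ((map_chart c \<circ> inv_chart d) z)) has_derivative (\<lambda>w. D (dtrans d c p w))) (at (map_chart d p))"
    using has_derivative_compose[OF dtrans_has_derivative[OF d c p(2,1)], of "f \<circ> inv_chart c" D] D by simp
  then show ?thesis
  proof (rule has_derivative_transform_within_open)
    show "open (overlap d (dom_chart c))" using open_overlap[OF d open_dom[OF c]] .
    show "map_chart d p \<in> overlap d (dom_chart c)" using overlap_mem[OF d p(2,1)] .
    show "(f \<circ> inv_chart c) ((map_chart c \<circ> inv_chart d) z) = (f \<circ> inv_chart d) z"
      if "z \<in> overlap d (dom_chart c)" for z
      using that inv_map[OF c, of "inv_chart d z"] by (simp add: overlap_def)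
  qed
qed

lemma dtrans_cocycle:
  assumes "c \<in> A" "d \<in> A" "e \<in> A" "p \<in> dom_chart c" "p \<in> dom_chart d" "p \<in> dom_chart e"
  shows "dtrans d e p (dtrans c d p v) = dtrans c e p v"
proof -
  have "((map_chart e \<circ> inv_chart c) has_derivative (\<lambda>w. dtrans d e p (dtrans c d p w))) (at (map_chart c p))"
    by (rule chain_inv[OF assms(2,1,5,4) dtrans_has_derivative[OF assms(2,3,5,6)]])
  from frechet_eqI[OF this] show ?thesis unfolding dtrans_def[of c e] by simp
qed

lemma dtrans_same:
  assumes "c \<in> A" "p \<in> dom_chart c" shows "dtrans c c p v = v"
proof -
  have "((\<lambda>z. z) has_derivative (\<lambda>w. w)) (at (map_chart c p))" by (rule has_derivative_ident)
  then have "((map_chart c \<circ> inv_chart c) has_derivative (\<lambda>w. w)) (at (map_chart c p))"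
    by (rule has_derivative_transform_within_open[OF _ open_ran[OF assms(1)] map_in[OF assms(2)]])
       (simp add: map_inv)
  from frechet_eqI[OF this] show ?thesis by (simp add: dtrans_def)
qed

lemma tangent_comp_dtrans: "tangent_comp A c p v = dtrans (chart_at A p) c p v"
  by (simp add: tangent_comp_def dtrans_def)

text \<open>The inverse of \<open>tangent_comp A c p\<close>: it turns components in
  \<open>c\<close> into an element of the chosen model of the tangent space.\<close>

definition tangent_vec :: "('m, 'n) chart \<Rightarrow> 'm \<Rightarrow> real^'n \<Rightarrow> real^'n" where
  "tangent_vec c p u = dtrans c (chart_at A p) p u"

context
  fixes c p assumes c: "c \<in> A" and p: "p \<in> dom_chart c"
begin

lemma linear_tangent_comp: "linear (tangent_comp A c p)"
  using linear_dtrans[OF chart_at_in c in_chart_at p] by (simp add: tangent_comp_dtrans[abs_def])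

lemma linear_tangent_vec: "linear (tangent_vec c p)"
  using linear_dtrans[OF c chart_at_in p in_chart_at] by (simp add: tangent_vec_def[abs_def])

lemma tangent_comp_vec: "tangent_comp A c p (tangent_vec c p u) = u"
  by (simp add: tangent_comp_dtrans tangent_vec_def dtrans_cocycle c chart_at_in p in_chart_at dtrans_same)

lemma tangent_vec_comp: "tangent_vec c p (tangent_comp A c p v) = v"
  by (simp add: tangent_comp_dtrans tangent_vec_def dtrans_cocycle c chart_at_in p in_chart_at dtrans_same)

lemma tangent_comp_change:
  "d \<in> A \<Longrightarrow> p \<in> dom_chart d \<Longrightarrow> tangent_comp A d p v = dtrans c d p (tangent_comp A c p v)"
  by (simp add: tangent_comp_dtrans dtrans_cocycle c chart_at_in p in_chart_at)

lemma tangent_comp_inject: "tangent_comp A c p u = tangent_comp A c p v \<Longrightarrow> u = v"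
  by (metis tangent_vec_comp)

lemma field_comp_at: "field_comp A c X (map_chart c p) = tangent_comp A c p (X p)"
  by (simp add: field_comp_def inv_map[OF c p])

lemma field_deriv_chart:
  assumes "((f \<circ> inv_chart c) has_derivative D) (at (map_chart c p))"
  shows "field_deriv A X f p = D (tangent_comp A c p (X p))"
proof -
  have "((f \<circ> inv_chart (chart_at A p)) has_derivative (\<lambda>w. D (dtrans (chart_at A p) c p w))) (at (map_chart (chart_at A p) p))"
    by (rule chain_inv[OF c chart_at_in p in_chart_at assms])
  from frechet_eqI[OF this] show ?thesis by (simp add: field_deriv_def tangent_comp_dtrans)
qed

end

lemma tangent_comp_chart_at: "tangent_comp A (chart_at A p) p v = v"
  by (simp add: tangent_comp_dtrans dtrans_same chart_at_in in_chart_at)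

lemma field_comp_change:
  assumes c: "c \<in> A" and d: "d \<in> A" and z: "z \<in> overlap c (dom_chart d)"
  shows "field_comp A d X ((map_chart d \<circ> inv_chart c) z)
    = frechet_derivative (map_chart d \<circ> inv_chart c) (at z) (field_comp A c X z)"
proof -
  define q where "q = inv_chart c z"
  have zr: "z \<in> ran_chart c" and qd: "q \<in> dom_chart d" using z by (simp_all add: overlap_def q_def)
  have q: "q \<in> dom_chart c" "q \<in> dom_chart d" "z = map_chart c q"
    using qd inv_in[OF zr] map_inv[OF zr] by (simp_all add: q_def)
  show ?thesis
    using tangent_comp_change[OF c q(1) d q(2)] field_comp_at[OF c q(1)] field_comp_at[OF d q(2)] inv_map[OF c q(1)]
    by (simp add: q(3) dtrans_def)
qed

section \<open>Smooth functions and vector fields\<close>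

abbreviation vf :: "('m \<Rightarrow> real^'n) \<Rightarrow> bool" where "vf \<equiv> vector_field A"
abbreviation sf :: "('m \<Rightarrow> real) \<Rightarrow> bool" where "sf \<equiv> smooth_function A"

lemma vf_smooth: "vf X \<Longrightarrow> c \<in> A \<Longrightarrow> smooth_on (ran_chart c) (field_comp A c X)"
  by (simp add: vector_field_def)

lemma sf_smooth: "sf f \<Longrightarrow> c \<in> A \<Longrightarrow> smooth_on (ran_chart c) (f \<circ> inv_chart c)"
  by (simp add: smooth_function_def)

lemma field_comp_add: "c \<in> A \<Longrightarrow> z \<in> ran_chart c \<Longrightarrow>
    field_comp A c (\<lambda>q. X q + Y q) z = field_comp A c X z + field_comp A c Y z"
  by (simp add: field_comp_def linear_add[OF linear_tangent_comp] inv_in)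

lemma field_comp_diff: "c \<in> A \<Longrightarrow> z \<in> ran_chart c \<Longrightarrow>
    field_comp A c (\<lambda>q. X q - Y q) z = field_comp A c X z - field_comp A c Y z"
  by (simp add: field_comp_def linear_diff[OF linear_tangent_comp] inv_in)

lemma field_comp_scale: "c \<in> A \<Longrightarrow> z \<in> ran_chart c \<Longrightarrow>
    field_comp A c (\<lambda>q. f q *\<^sub>R X q) z = f (inv_chart c z) *\<^sub>R field_comp A c X z"
  by (simp add: field_comp_def linear_scale[OF linear_tangent_comp] inv_in)

lemma vf_add: "vf X \<Longrightarrow> vf Y \<Longrightarrow> vf (\<lambda>q. X q + Y q)"
  unfolding vector_field_def
  by (auto intro!: smooth_on_cong[OF open_ran field_comp_add[symmetric]] smooth_on_add open_ran)

lemma vf_diff: "vf X \<Longrightarrow> vf Y \<Longrightarrow> vf (\<lambda>q. X q - Y q)"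
  unfolding vector_field_def
  by (auto intro!: smooth_on_cong[OF open_ran field_comp_diff[symmetric]] smooth_on_diff open_ran)

lemma vf_scale: "sf f \<Longrightarrow> vf X \<Longrightarrow> vf (\<lambda>q. f q *\<^sub>R X q)"
  unfolding vector_field_def smooth_function_def
  by (auto intro!: smooth_on_cong[OF open_ran field_comp_scale[symmetric]] smooth_on_scaleR open_ran simp: o_def)

lemma sf_const: "sf (\<lambda>q. k)"
  by (simp add: smooth_function_def o_def smooth_on_const open_ran)

lemma sf_mult: "sf f \<Longrightarrow> sf g \<Longrightarrow> sf (\<lambda>q. f q * g q)"
  unfolding smooth_function_def o_def by (auto intro!: smooth_on_mult open_ran)

lemma vf_zero: "vf (\<lambda>q. 0)"
  unfolding vector_field_def
proof
  fix c assume c: "c \<in> A"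
  show "smooth_on (ran_chart c) (field_comp A c (\<lambda>q. 0))"
    by (rule smooth_on_cong[OF open_ran[OF c] _ smooth_on_const[OF open_ran[OF c], of 0]])
       (simp add: field_comp_def linear_0[OF linear_tangent_comp] inv_in c)
qed

lemma vf_sum: "(\<And>i. i \<in> I \<Longrightarrow> vf (X i)) \<Longrightarrow> vf (\<lambda>q. \<Sum>i\<in>I. X i q)"
  by (induction I rule: infinite_finite_induct) (auto intro: vf_zero vf_add)

lemma field_deriv_comp:
  assumes c: "c \<in> A" and z: "z \<in> ran_chart c" and f: "sf f"
  shows "field_deriv A X f (inv_chart c z) = frechet_derivative (f \<circ> inv_chart c) (at z) (field_comp A c X z)"
proof -
  have "((f \<circ> inv_chart c) has_derivative frechet_derivative (f \<circ> inv_chart c) (at z)) (at (map_chart c (inv_chart c z)))"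
    unfolding map_inv[OF z] by (rule smooth_on_has_derivative[OF sf_smooth[OF f c] z])
  from field_deriv_chart[OF c inv_in[OF z] this] show ?thesis by (simp add: field_comp_def)
qed

lemma sf_field_deriv: "sf f \<Longrightarrow> vf X \<Longrightarrow> sf (field_deriv A X f)"
  unfolding smooth_function_def[of A "field_deriv A X f"]
proof
  fix c assume f: "sf f" and X: "vf X" and c: "c \<in> A"
  show "smooth_on (ran_chart c) (field_deriv A X f \<circ> inv_chart c)"
    by (rule smooth_on_cong[OF open_ran[OF c] _ smooth_on_frechet_apply[OF open_ran[OF c] sf_smooth[OF f c] vf_smooth[OF X c]]])
       (simp add: field_deriv_comp[OF c _ f])
qed

text \<open>The compact image of the ball is closed because the manifold is Hausdorff.\<close>

lemma smooth_cutoff: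
  fixes F :: "real^'n \<Rightarrow> 'b::real_normed_vector"
  assumes c: "c \<in> A" and d: "d \<in> A" and r: "cball a r \<subseteq> ran_chart c"
    and sm: "smooth_on (overlap d (dom_chart c)) F"
    and z: "\<And>w. w \<in> ran_chart d \<Longrightarrow> inv_chart d w \<notin> inv_chart c ` cball a r \<Longrightarrow> F w = 0"
  shows "smooth_on (ran_chart d) F"
proof (rule smooth_on_local)
  let ?K = "inv_chart c ` cball a r"
  have "compact ?K"
    using continuous_on_subset[OF homeomorphism_cont2[OF chart_hom[OF c]] r] by (intro compact_continuous_image compact_cball)
  then have "closed ?K" by (rule compact_imp_closed)
  then have oK: "open (overlap d (- ?K))" by (intro open_overlap[OF d]) auto
  fix w assume w: "w \<in> ran_chart d"
  show "\<exists>U. open U \<and> w \<in> U \<and> smooth_on U F"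
  proof (cases "inv_chart d w \<in> dom_chart c")
    case True
    then have "w \<in> overlap d (dom_chart c)" using w by (simp add: overlap_def)
    then show ?thesis using sm open_overlap[OF d open_dom[OF c]]
      by (intro exI[of _ "overlap d (dom_chart c)"] conjI)
  next
    case False
    have "?K \<subseteq> dom_chart c" by (intro image_subsetI inv_in[OF subsetD[OF r]])
    then have "inv_chart d w \<in> - ?K" using False by blast
    then have "w \<in> overlap d (- ?K)" using w unfolding overlap_def by (intro CollectI conjI)
    moreover have "smooth_on (overlap d (- ?K)) F"
      by (rule smooth_on_cong[OF oK _ smooth_on_const[OF oK, of 0]]) (use z in \<open>simp add: overlap_def\<close>)
    ultimately show ?thesis using oK by (intro exI[of _ "overlap d (- ?K)"] conjI)
  qed
qed

section \<open>Global functions and fields made from local ones\<close>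

definition cut_fun :: "('m, 'n) chart \<Rightarrow> real^'n \<Rightarrow> real \<Rightarrow> (real^'n \<Rightarrow> real) \<Rightarrow> 'm \<Rightarrow> real" where
  "cut_fun c a r h q = (if q \<in> dom_chart c then bump a r (map_chart c q) * h (map_chart c q) else 0)"

definition cut_field :: "('m, 'n) chart \<Rightarrow> real^'n \<Rightarrow> real \<Rightarrow> (real^'n \<Rightarrow> real^'n) \<Rightarrow> 'm \<Rightarrow> real^'n" where
  "cut_field c a r h q = (if q \<in> dom_chart c then tangent_vec c q (bump a r (map_chart c q) *\<^sub>R h (map_chart c q)) else 0)"

context
  fixes c :: "('m, 'n) chart" and a :: "real^'n" and r :: real
  assumes c: "c \<in> A" and r0: "r > 0" and r: "cball a r \<subseteq> ran_chart c"
begin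

lemma bump_outside: "q \<in> dom_chart c \<Longrightarrow> q \<notin> inv_chart c ` cball a r \<Longrightarrow> bump a r (map_chart c q) = 0"
proof (rule bump_zero[OF r0])
  assume "q \<in> dom_chart c" "q \<notin> inv_chart c ` cball a r"
  then show "map_chart c q \<notin> ball a r"
    using inv_map[OF c, of q] image_eqI[of q "inv_chart c" "map_chart c q" "cball a r"] by auto
qed

lemma sf_cut_fun:
  assumes h: "smooth_on (ran_chart c) h" shows "sf (cut_fun c a r h)"
  unfolding smooth_function_def
proof
  fix d assume d: "d \<in> A"
  note o = open_overlap[OF d open_dom[OF c]]
  show "smooth_on (ran_chart d) (cut_fun c a r h \<circ> inv_chart d)"
  proof (rule smooth_cutoff[OF c d r])
    have "smooth_on (ran_chart c) (\<lambda>z. bump a r z * h z)"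
      by (intro smooth_on_mult smooth_on_bump open_ran c h)
    then have "smooth_on (overlap d (dom_chart c)) (\<lambda>w. (\<lambda>z. bump a r z * h z) ((map_chart c \<circ> inv_chart d) w))"
      by (rule smooth_on_compose[OF o open_ran[OF c] _ transition_smooth[OF d c]]) (auto simp: overlap_def)
    then show "smooth_on (overlap d (dom_chart c)) (cut_fun c a r h \<circ> inv_chart d)"
      by (rule smooth_on_cong[OF o, rotated]) (simp add: overlap_def cut_fun_def)
  qed (simp add: cut_fun_def bump_outside)
qed

lemma cut_field_comp: "z \<in> ran_chart c \<Longrightarrow> field_comp A c (cut_field c a r h) z = bump a r z *\<^sub>R h z"
  by (simp add: field_comp_def cut_field_def inv_in map_inv tangent_comp_vec c)

lemma vf_cut_field:
  assumes h: "smooth_on (ran_chart c) h" shows "vf (cut_field c a r h)"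
  unfolding vector_field_def
proof
  fix d assume d: "d \<in> A"
  note o = open_overlap[OF d open_dom[OF c]] and o' = open_overlap[OF c open_dom[OF d]]
  show "smooth_on (ran_chart d) (field_comp A d (cut_field c a r h))"
  proof (rule smooth_cutoff[OF c d r])
    \<comment> \<open>The components in \<open>d\<close>, still as a function of the coordinates of
      \<open>c\<close>. Composition with the transition map expresses them in the coordinates of
      \<open>d\<close>.\<close>
    let ?g = "\<lambda>z. frechet_derivative (map_chart d \<circ> inv_chart c) (at z) (bump a r z *\<^sub>R h z)"
    have "smooth_on (overlap c (dom_chart d)) ?g"
      by (intro smooth_on_frechet_apply o' transition_smooth c d smooth_on_scaleR smooth_on_bump
          smooth_on_subset[OF h]) (auto simp: overlap_def)
    then have "smooth_on (overlap d (dom_chart c)) (\<lambda>w. ?g ((map_chart c \<circ> inv_chart d) w))"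
      by (rule smooth_on_compose[OF o o' _ transition_smooth[OF d c]])
         (auto simp: overlap_def inv_map c inv_in)
    then show "smooth_on (overlap d (dom_chart c)) (field_comp A d (cut_field c a r h))"
    proof (rule smooth_on_cong[OF o, rotated])
      fix w assume w: "w \<in> overlap d (dom_chart c)"
      let ?z = "(map_chart c \<circ> inv_chart d) w"
      have z: "?z \<in> overlap c (dom_chart d)" using w by (auto simp: overlap_def inv_map c inv_in)
      have "(map_chart d \<circ> inv_chart c) ?z = w" using w by (auto simp: overlap_def inv_map c map_inv)
      then show "?g ?z = field_comp A d (cut_field c a r h) w"
        using field_comp_change[OF c d z, of "cut_field c a r h"] z by (simp add: cut_field_comp overlap_def)
    qed
  next
    fix w assume "w \<in> ran_chart d" "inv_chart d w \<notin> inv_chart c ` cball a r"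
    then show "field_comp A d (cut_field c a r h) w = 0"
      by (auto simp: field_comp_def cut_field_def bump_outside linear_0[OF linear_tangent_vec] c
          linear_0[OF linear_tangent_comp] d inv_in)
  qed
qed

end

lemma chart_ball: "c \<in> A \<Longrightarrow> p \<in> dom_chart c \<Longrightarrow> \<exists>r>0. cball (map_chart c p) r \<subseteq> ran_chart c"
  using open_contains_cball open_ran map_in by metis

text \<open>A positive factor is as good as a cut-off that is constant near \<open>p\<close>, because it can be divided out.\<close>

lemma field_germ:
  assumes c: "c \<in> A" and p: "p \<in> dom_chart c"
  obtains \<psi> X where "smooth_on (ran_chart c) \<psi>" "\<psi> (map_chart c p) > (0::real)" "\<forall>v. vf (X v)"
    "\<forall>v. \<forall>z\<in>ran_chart c. field_comp A c (X v) z = \<psi> z *\<^sub>R (v :: real^'n)"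
proof -
  obtain r where r: "r > 0" "cball (map_chart c p) r \<subseteq> ran_chart c" using chart_ball[OF c p] by blast
  show ?thesis
  proof (rule that[of "bump (map_chart c p) r" "\<lambda>v. cut_field c (map_chart c p) r (\<lambda>_. v)"])
    show "smooth_on (ran_chart c) (bump (map_chart c p) r)" by (rule smooth_on_bump[OF open_ran[OF c]])
    show "bump (map_chart c p) r (map_chart c p) > 0" using r by (intro bump_pos) auto
    show "\<forall>v. vf (cut_field c (map_chart c p) r (\<lambda>_. v))"
      by (intro allI vf_cut_field c r smooth_on_const open_ran)
    show "\<forall>v. \<forall>z\<in>ran_chart c. field_comp A c (cut_field c (map_chart c p) r (\<lambda>_. v)) z = bump (map_chart c p) r z *\<^sub>R v"
      by (intro allI ballI cut_field_comp[OF c r])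
  qed
qed

lemma field_through:
  obtains V where "vf V" "V p = v"
proof -
  let ?c = "chart_at A p"
  obtain \<psi> X where "smooth_on (ran_chart ?c) \<psi>" and X: "\<psi> (map_chart ?c p) > 0" "\<forall>v. vf (X v)"
    "\<forall>v. \<forall>z\<in>ran_chart ?c. field_comp A ?c (X v) z = \<psi> z *\<^sub>R (v :: real^'n)"
    by (rule field_germ[OF chart_at_in in_chart_at]) (rule that)
  let ?v = "inverse (\<psi> (map_chart ?c p)) *\<^sub>R v"
  have "X ?v p = v"
    using X(3)[rule_format, OF map_in[OF in_chart_at], of ?v] X(1) field_comp_at[of ?c p "X ?v", OF chart_at_in in_chart_at]
    by (simp add: tangent_comp_chart_at)
  then show ?thesis using that X(2) by blast
qed

text \<open>Justifies the choice in the definition of \<open>extend_vector\<close>, and with it the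
  evaluation of tensors at a point by \<open>tensor_at\<close>.\<close>

lemma extend_vector: "vf (extend_vector A p v)" "extend_vector A p v p = v"
proof -
  have "\<exists>V. vf V \<and> V p = v" using field_through[of p v] by blast
  from someI_ex[OF this] show "vf (extend_vector A p v)" "extend_vector A p v p = v"
    by (simp_all add: extend_vector_def)
qed

section \<open>Tensoriality: linearity over smooth functions\<close>

definition tensorial :: "nat \<Rightarrow> ('m, 'n) tensor \<Rightarrow> bool" where
  "tensorial m T \<longleftrightarrow> (\<forall>Ys. length Ys = m \<longrightarrow> (\<forall>Y\<in>set Ys. vf Y) \<longrightarrow> vf (T Ys) \<and>
     (\<forall>i<m. \<forall>Y Y' p. vf Y \<longrightarrow> vf Y' \<longrightarrow>
        T (Ys[i := (\<lambda>q. Y q + Y' q)]) p = T (Ys[i := Y]) p + T (Ys[i := Y']) p) \<and>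
     (\<forall>i<m. \<forall>f Y p. sf f \<longrightarrow> vf Y \<longrightarrow> T (Ys[i := (\<lambda>q. f q *\<^sub>R Y q)]) p = f p *\<^sub>R T (Ys[i := Y]) p))"

context
  fixes m T assumes T: "tensorial m T"
begin

lemma tensorial_vf: "length Ys = m \<Longrightarrow> (\<forall>Y\<in>set Ys. vf Y) \<Longrightarrow> vf (T Ys)"
  using T unfolding tensorial_def by simp

context
  fixes Ys i assumes Ys: "length Ys = m" "\<forall>Y\<in>set Ys. vf Y" and i: "i < m"
begin

lemma tensorial_add: "vf Y \<Longrightarrow> vf Y' \<Longrightarrow>
    T (Ys[i := (\<lambda>q. Y q + Y' q)]) p = T (Ys[i := Y]) p + T (Ys[i := Y']) p"
  using T Ys i unfolding tensorial_def by simp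

lemma tensorial_scale: "sf f \<Longrightarrow> vf Y \<Longrightarrow> T (Ys[i := (\<lambda>q. f q *\<^sub>R Y q)]) p = f p *\<^sub>R T (Ys[i := Y]) p"
  using T Ys i unfolding tensorial_def by simp

lemma tensorial_sum:
  assumes "finite S" "\<And>k. k \<in> S \<Longrightarrow> sf (f k)" "\<And>k. k \<in> S \<Longrightarrow> vf (E k)"
  shows "T (Ys[i := (\<lambda>q. \<Sum>k\<in>S. f k q *\<^sub>R E k q)]) p = (\<Sum>k\<in>S. f k p *\<^sub>R T (Ys[i := E k]) p)"
  using assms
proof (induction S rule: finite_induct)
  case empty
  show ?case using tensorial_scale[OF sf_const[of 0] vf_zero, of p] by simp
next
  case (insert k S)
  have "T (Ys[i := (\<lambda>q. f k q *\<^sub>R E k q + (\<Sum>k\<in>S. f k q *\<^sub>R E k q))]) p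
     = T (Ys[i := (\<lambda>q. f k q *\<^sub>R E k q)]) p + T (Ys[i := (\<lambda>q. \<Sum>k\<in>S. f k q *\<^sub>R E k q)]) p"
    using insert.prems by (intro tensorial_add vf_scale vf_sum) auto
  then show ?case using insert tensorial_scale[of "f k" "E k" p] by simp
qed

text \<open>
  With a cut-off \<open>\<psi>\<close> around \<open>p\<close>, the field \<open>\<psi>\<^sup>2 Y\<close> is a combination of globally defined
  fields whose coefficients vanish at \<open>p\<close> when \<open>Y\<close> does.
\<close>

lemma tensorial_zero:
  assumes Y: "vf Y" "Y p = 0" shows "T (Ys[i := Y]) p = 0"
proof -
  define c where "c = chart_at A p"
  have c: "c \<in> A" and p: "p \<in> dom_chart c" by (simp_all add: c_def chart_at_in in_chart_at)
  obtain r where r: "r > 0" "cball (map_chart c p) r \<subseteq> ran_chart c" using chart_ball[OF c p] by blast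
  define \<psi> where "\<psi> = cut_fun c (map_chart c p) r (\<lambda>_. 1)"
  define f where "f k = cut_fun c (map_chart c p) r (\<lambda>z. field_comp A c Y z $ k)" for k
  define E where "E k = cut_field c (map_chart c p) r (\<lambda>_. axis k 1)" for k
  have \<psi>: "sf \<psi>" unfolding \<psi>_def by (intro sf_cut_fun c r smooth_on_const open_ran)
  have f: "sf (f k)" for k unfolding f_def by (intro sf_cut_fun c r smooth_on_nth vf_smooth Y open_ran)
  have E: "vf (E k)" for k unfolding E_def by (intro vf_cut_field c r smooth_on_const open_ran)
  have eq: "(\<lambda>q. (\<psi> q * \<psi> q) *\<^sub>R Y q) = (\<lambda>q. \<Sum>k\<in>UNIV. f k q *\<^sub>R E k q)"
  proof
    fix q
    show "(\<psi> q * \<psi> q) *\<^sub>R Y q = (\<Sum>k\<in>UNIV. f k q *\<^sub>R E k q)"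
    proof (cases "q \<in> dom_chart c")
      case True
      let ?b = "bump (map_chart c p) r (map_chart c q)"
      let ?y = "tangent_comp A c q (Y q)"
      note lv = linear_tangent_vec[OF c True]
      have "(\<Sum>k\<in>UNIV. f k q *\<^sub>R E k q) = (\<Sum>k\<in>UNIV. tangent_vec c q ((?b * ?b) *\<^sub>R (?y $ k *\<^sub>R axis k 1)))"
        using True by (intro sum.cong)
          (simp_all add: f_def E_def cut_fun_def cut_field_def field_comp_at[OF c] linear_scale[OF lv] mult_ac)
      also have "\<dots> = (?b * ?b) *\<^sub>R tangent_vec c q (\<Sum>k\<in>UNIV. ?y $ k *\<^sub>R axis k 1)"
        by (simp add: linear_scale[OF lv] linear_sum[OF lv] o_def scaleR_sum_right)
      also have "(\<Sum>k\<in>UNIV. ?y $ k *\<^sub>R axis k 1) = ?y"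
        using basis_expansion[of ?y] by (simp add: scalar_mult_eq_scaleR)
      finally show ?thesis using True by (simp add: \<psi>_def cut_fun_def tangent_vec_comp[OF c])
    qed (simp add: \<psi>_def cut_fun_def f_def)
  qed
  have "(\<psi> p * \<psi> p) *\<^sub>R T (Ys[i := Y]) p = T (Ys[i := (\<lambda>q. (\<psi> q * \<psi> q) *\<^sub>R Y q)]) p"
    using tensorial_scale[OF sf_mult[OF \<psi> \<psi>] Y(1)] by simp
  also have "\<dots> = (\<Sum>k\<in>UNIV. f k p *\<^sub>R T (Ys[i := E k]) p)"
    unfolding eq by (rule tensorial_sum) (auto intro: f E)
  also have "\<dots> = 0"
    using p Y(2) by (simp add: f_def cut_fun_def field_comp_at[OF c] linear_0[OF linear_tangent_comp[OF c]])
  finally have "(\<psi> p * \<psi> p) *\<^sub>R T (Ys[i := Y]) p = 0" .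
  moreover have "\<psi> p > 0" using p r bump_pos[of r "map_chart c p" "map_chart c p"] by (simp add: \<psi>_def cut_fun_def)
  ultimately show ?thesis by simp
qed

lemma tensorial_cong_slot:
  assumes "vf Y" "vf Y'" "Y p = Y' p" shows "T (Ys[i := Y]) p = T (Ys[i := Y']) p"
proof -
  have "T (Ys[i := (\<lambda>q. Y' q + (Y q - Y' q))]) p = T (Ys[i := Y']) p + T (Ys[i := (\<lambda>q. Y q - Y' q)]) p"
    by (rule tensorial_add) (auto intro: vf_diff assms)
  moreover have "T (Ys[i := (\<lambda>q. Y q - Y' q)]) p = 0"
    by (rule tensorial_zero) (auto intro: vf_diff assms simp: assms(3))
  ultimately show ?thesis by simp
qed

end

text \<open>The arguments are exchanged one slot at a time, through the hybrid lists
  \<open>take k Zs @ drop k Ys\<close>.\<close>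

lemma tensorial_cong:
  assumes Ys: "length Ys = m" "\<forall>Y\<in>set Ys. vf Y" and Zs: "length Zs = m" "\<forall>Y\<in>set Zs. vf Y"
    and eq: "\<And>i. i < m \<Longrightarrow> (Ys ! i) p = (Zs ! i) p"
  shows "T Ys p = T Zs p"
proof -
  have "k \<le> m \<Longrightarrow> T (take k Zs @ drop k Ys) p = T Ys p" for k
  proof (induction k)
    case (Suc k)
    let ?L = "take k Zs @ drop k Ys"
    have L: "length ?L = m" "\<forall>Y\<in>set ?L. vf Y" using Ys Zs Suc.prems by (auto dest: in_set_takeD in_set_dropD)
    have k: "k < m" using Suc.prems by simp
    have e: "drop k Ys = Ys ! k # drop (Suc k) Ys" "take (Suc k) Zs = take k Zs @ [Zs ! k]"
      using k Ys Zs by (simp_all add: Cons_nth_drop_Suc take_Suc_conv_app_nth)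
    have lk: "length (take k Zs) = k" using k Zs by simp
    have 1: "?L[k := Zs ! k] = take (Suc k) Zs @ drop (Suc k) Ys"
      unfolding e by (simp add: list_update_append lk del: length_take)
    have 2: "?L[k := Ys ! k] = ?L"
      unfolding e by (simp add: list_update_append lk del: length_take)
    have "T (?L[k := Zs ! k]) p = T (?L[k := Ys ! k]) p"
      using k Ys Zs eq[OF k] by (intro tensorial_cong_slot[OF L k]) auto
    then show ?case using Suc k unfolding 1 2 by simp
  qed simp
  from this[of m] show ?thesis using Ys Zs by simp
qed

end

end

section \<open>Christoffel symbols and curvature\<close>

text \<open>The product rule for a derivative evaluated in a moving direction; the basis expansion
  again reduces it to fixed directions.\<close>

lemma frechet_apply_has_derivative:
  fixes f :: "'a::euclidean_space \<Rightarrow> 'b::real_normed_vector"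
  assumes f: "smooth_on S f" and S: "open S" "x \<in> S" and g: "(g has_derivative g') (at x)"
  shows "((\<lambda>y. frechet_derivative f (at y) (g y)) has_derivative
    (\<lambda>h. frechet_derivative (\<lambda>y. frechet_derivative f (at y) (g x)) (at x) h + frechet_derivative f (at x) (g' h))) (at x)"
proof -
  let ?d = "\<lambda>b y. frechet_derivative f (at y) b"
  have db: "(?d b has_derivative frechet_derivative (?d b) (at x)) (at x)" for b
    by (rule smooth_on_has_derivative[OF smooth_on_frechet[OF f] S(2)])
  have "((\<lambda>y. \<Sum>b\<in>Basis. (g y \<bullet> b) *\<^sub>R ?d b y) has_derivative
     (\<lambda>h. \<Sum>b\<in>Basis. (g x \<bullet> b) *\<^sub>R frechet_derivative (?d b) (at x) h + (g' h \<bullet> b) *\<^sub>R ?d b x)) (at x)"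
    by (intro has_derivative_sum has_derivative_scaleR has_derivative_inner_left g db)
  moreover have "(\<Sum>b\<in>Basis. (g x \<bullet> b) *\<^sub>R frechet_derivative (?d b) (at x) h + (g' h \<bullet> b) *\<^sub>R ?d b x)
      = frechet_derivative (?d (g x)) (at x) h + ?d (g' h) x" for h
  proof -
    have "((\<lambda>y. \<Sum>b\<in>Basis. (g x \<bullet> b) *\<^sub>R ?d b y) has_derivative
       (\<lambda>h. \<Sum>b\<in>Basis. (g x \<bullet> b) *\<^sub>R frechet_derivative (?d b) (at x) h)) (at x)"
      by (intro has_derivative_sum has_derivative_scaleR_right db)
    then have "(?d (g x) has_derivative
       (\<lambda>h. \<Sum>b\<in>Basis. (g x \<bullet> b) *\<^sub>R frechet_derivative (?d b) (at x) h)) (at x)"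
      by (rule has_derivative_transform_within_open[OF _ S])
         (rule frechet_euclidean_sum[OF smooth_on_differentiable[OF f], symmetric])
    from frechet_eqI[OF this] show ?thesis
      by (simp add: sum.distrib frechet_euclidean_sum[OF smooth_on_differentiable[OF f S(2)], of "g' h", symmetric])
  qed
  ultimately have "((\<lambda>y. \<Sum>b\<in>Basis. (g y \<bullet> b) *\<^sub>R ?d b y) has_derivative
     (\<lambda>h. frechet_derivative (?d (g x)) (at x) h + ?d (g' h) x)) (at x)" by simp
  then show ?thesis
    by (rule has_derivative_transform_within_open[OF _ S])
       (rule frechet_euclidean_sum[OF smooth_on_differentiable[OF f], symmetric])
qed

lemma coeff_sys_has_derivative:
  fixes c :: "'n::finite \<Rightarrow> 'n \<Rightarrow> real^'n \<Rightarrow> 'b::real_normed_vector"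
  assumes c: "\<And>i j. (c i j) differentiable (at z)"
    and u: "(u has_derivative u') (at z)" and v: "(v has_derivative v') (at z)"
  shows "((\<lambda>y. coeff_sys c y (u y) (v y)) has_derivative
    (\<lambda>h. coeff_sys_deriv c z h (u z) (v z) + coeff_sys c z (u' h) (v z) + coeff_sys c z (u z) (v' h))) (at z)"
proof -
  have n: "((\<lambda>y. f y $ i) has_derivative (\<lambda>h. f' h $ i)) (at z)" if "(f has_derivative f') (at z)"
    for f f' and i :: 'n by (rule bounded_linear.has_derivative[OF bounded_linear_vec_nth that])
  have "((\<lambda>y. coeff_sys c y (u y) (v y)) has_derivative (\<lambda>h. \<Sum>i\<in>UNIV. \<Sum>j\<in>UNIV.
     (u z $ i * v z $ j) *\<^sub>R frechet_derivative (c i j) (at z) h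
      + (u z $ i * v' h $ j + u' h $ i * v z $ j) *\<^sub>R c i j z)) (at z)"
    unfolding coeff_sys_def
    by (intro has_derivative_sum has_derivative_scaleR has_derivative_mult n u v has_derivative_frechet c)
  then show ?thesis
    by (simp add: coeff_sys_def coeff_sys_deriv_def sum.distrib scaleR_left_distrib add_ac)
qed

locale connection_manifold = analytic_manifold A
  for A :: "('m::{t2_space,second_countable_topology}, 'n::finite) chart set" +
  fixes nabla :: "('m, 'n) connection"
  assumes analytic_conn: "analytic_connection A nabla"
begin

lemma affine_conn: "affine_connection A nabla"
  using analytic_conn by (simp add: analytic_connection_def)

lemma nabla_vf: "vf X \<Longrightarrow> vf Y \<Longrightarrow> vf (nabla X Y)"
  using affine_conn unfolding affine_connection_def by (elim conjE) simp

text \<open>Like its companions, stated as an equality of fields and not of values, so that it can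
  rewrite an argument of \<open>nabla\<close> or of a tensor.\<close>

lemma nabla_add1: "vf X \<Longrightarrow> vf X' \<Longrightarrow> vf Y \<Longrightarrow> nabla (\<lambda>q. X q + X' q) Y = (\<lambda>p. nabla X Y p + nabla X' Y p)"
  using affine_conn unfolding affine_connection_def by (elim conjE) (rule ext, simp)

lemma nabla_scale1: "sf f \<Longrightarrow> vf X \<Longrightarrow> vf Y \<Longrightarrow> nabla (\<lambda>q. f q *\<^sub>R X q) Y = (\<lambda>p. f p *\<^sub>R nabla X Y p)"
  using affine_conn unfolding affine_connection_def by (elim conjE) (rule ext, simp)

lemma nabla_add2: "vf X \<Longrightarrow> vf Y \<Longrightarrow> vf Y' \<Longrightarrow> nabla X (\<lambda>q. Y q + Y' q) = (\<lambda>p. nabla X Y p + nabla X Y' p)"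
  using affine_conn unfolding affine_connection_def by (elim conjE) (rule ext, simp)

lemma nabla_leibniz: "sf f \<Longrightarrow> vf X \<Longrightarrow> vf Y \<Longrightarrow>
    nabla X (\<lambda>q. f q *\<^sub>R Y q) = (\<lambda>p. field_deriv A X f p *\<^sub>R Y p + f p *\<^sub>R nabla X Y p)"
  using affine_conn unfolding affine_connection_def by (elim conjE) (rule ext, simp)

lemma lie_bracket_eq: "vf X \<Longrightarrow> vf Y \<Longrightarrow> lie_bracket A X Y = (\<lambda>p. nabla X Y p - nabla Y X p)"
  using analytic_conn unfolding analytic_connection_def torsion_free_def by (elim conjE) (rule ext, simp)

text \<open>Torsion-freeness writes the bracket as a difference of two smooth fields, which replaces
  a computation of its smoothness in charts.\<close>

lemma lie_bracket_vf: "vf X \<Longrightarrow> vf Y \<Longrightarrow> vf (lie_bracket A X Y)"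
  by (simp add: lie_bracket_eq vf_diff nabla_vf)

definition christ :: "('m, 'n) chart \<Rightarrow> 'n \<Rightarrow> 'n \<Rightarrow> real^'n \<Rightarrow> real^'n" where
  "christ c = (SOME \<Gamma>. christoffel_symbols A nabla c \<Gamma> \<and> (\<forall>i j. real_analytic_on (ran_chart c) (\<Gamma> i j)))"

lemma christ:
  assumes "c \<in> A"
  shows "christoffel_symbols A nabla c (christ c)" "real_analytic_on (ran_chart c) (christ c i j)"
proof -
  have "\<exists>\<Gamma>. christoffel_symbols A nabla c \<Gamma> \<and> (\<forall>i j. real_analytic_on (ran_chart c) (\<Gamma> i j))"
    using analytic_conn assms unfolding analytic_connection_def by (elim conjE) (rule bspec)
  from someI_ex[OF this]
  show "christoffel_symbols A nabla c (christ c)" "real_analytic_on (ran_chart c) (christ c i j)"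
    unfolding christ_def by simp_all
qed

lemma christ_smooth: "c \<in> A \<Longrightarrow> smooth_on (ran_chart c) (christ c i j)"
  by (rule real_analytic_smooth[OF open_ran christ(2)])

abbreviation gam :: "('m, 'n) chart \<Rightarrow> real^'n \<Rightarrow> real^'n \<Rightarrow> real^'n \<Rightarrow> real^'n" where
  "gam c \<equiv> coeff_sys (christ c)"

abbreviation dgam :: "('m, 'n) chart \<Rightarrow> real^'n \<Rightarrow> real^'n \<Rightarrow> real^'n \<Rightarrow> real^'n \<Rightarrow> real^'n" where
  "dgam c \<equiv> coeff_sys_deriv (christ c)"

lemma nabla_comp:
  assumes "c \<in> A" "vf X" "vf Y" "z \<in> ran_chart c"
  shows "field_comp A c (nabla X Y) z =
    frechet_derivative (field_comp A c Y) (at z) (field_comp A c X z) + gam c z (field_comp A c X z) (field_comp A c Y z)"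
  unfolding coeff_sys_def
  by (rule christ(1)[OF assms(1), unfolded christoffel_symbols_def, rule_format, OF assms(2,3,4)])

lemma field_has_derivative:
  "c \<in> A \<Longrightarrow> vf X \<Longrightarrow> z \<in> ran_chart c \<Longrightarrow>
    (field_comp A c X has_derivative frechet_derivative (field_comp A c X) (at z)) (at z)"
  by (rule smooth_on_has_derivative[OF vf_smooth])

text \<open>The definition evaluates the bracket in the chosen chart at each point. In another chart
  second derivatives of the transition map appear, and their symmetry cancels them.\<close>

lemma lie_bracket_comp:
  assumes c: "c \<in> A" and X: "vf X" and Y: "vf Y" and z: "z \<in> ran_chart c"
  shows "field_comp A c (lie_bracket A X Y) z =
    frechet_derivative (field_comp A c Y) (at z) (field_comp A c X z)
    - frechet_derivative (field_comp A c X) (at z) (field_comp A c Y z)"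
proof -
  define p where "p = inv_chart c z"
  have p: "p \<in> dom_chart c" and zp: "z = map_chart c p"
    using inv_in[OF z] map_inv[OF z] by (simp_all add: p_def)
  define d where "d = chart_at A p"
  have d: "d \<in> A" and pd: "p \<in> dom_chart d" by (simp_all add: d_def chart_at_in in_chart_at)
  define w where "w = map_chart d p"
  have wd: "w \<in> ran_chart d" using pd by (simp add: w_def)
  define \<phi> where "\<phi> = map_chart c \<circ> inv_chart d"
  let ?O = "overlap d (dom_chart c)"
  have O: "open ?O" "w \<in> ?O" using open_overlap[OF d open_dom[OF c]] overlap_mem[OF d pd p] by (simp_all add: w_def)
  have sm: "smooth_on ?O \<phi>" unfolding \<phi>_def by (rule transition_smooth[OF d c])
  have \<phi>w: "\<phi> w = z" using inv_map[OF d pd] by (simp add: \<phi>_def w_def zp)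
  have dt: "dtrans d c p = frechet_derivative \<phi> (at w)" by (simp add: dtrans_def \<phi>_def w_def)
  have val: "field_comp A d V w = V p" for V
    using field_comp_at[OF d pd, of V] tangent_comp_chart_at[of p "V p"] by (simp add: d_def w_def)
  have val': "field_comp A c V z = frechet_derivative \<phi> (at w) (V p)" for V
    using field_comp_change[OF d c O(2), of V] val[of V] \<phi>w by (simp add: \<phi>_def)
  \<comment> \<open>The derivative at \<open>w\<close> of \<open>field_comp A c V\<close> composed
    with \<open>\<phi>\<close> is computed twice: by the chain rule, and from the transformation law
    of components.\<close>
  have key: "frechet_derivative (field_comp A c V) (at z) (field_comp A c W z) =
      frechet_derivative (\<lambda>y. frechet_derivative \<phi> (at y) (V p)) (at w) (W p)
      + frechet_derivative \<phi> (at w) (frechet_derivative (field_comp A d V) (at w) (W p))" if V: "vf V" for V W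
  proof -
    have "(field_comp A c V has_derivative frechet_derivative (field_comp A c V) (at z)) (at (\<phi> w))"
      unfolding \<phi>w by (rule field_has_derivative[OF c V z])
    from has_derivative_compose[OF smooth_on_has_derivative[OF sm O(2)] this]
    have 1: "((\<lambda>y. field_comp A c V (\<phi> y)) has_derivative
        (\<lambda>h. frechet_derivative (field_comp A c V) (at z) (frechet_derivative \<phi> (at w) h))) (at w)" .
    have "((\<lambda>y. frechet_derivative \<phi> (at y) (field_comp A d V y)) has_derivative
       (\<lambda>h. frechet_derivative (\<lambda>y. frechet_derivative \<phi> (at y) (field_comp A d V w)) (at w) h
          + frechet_derivative \<phi> (at w) (frechet_derivative (field_comp A d V) (at w) h))) (at w)"
      by (rule frechet_apply_has_derivative[OF sm O field_has_derivative[OF d V wd]])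
    then have "((\<lambda>y. field_comp A c V (\<phi> y)) has_derivative
       (\<lambda>h. frechet_derivative (\<lambda>y. frechet_derivative \<phi> (at y) (field_comp A d V w)) (at w) h
          + frechet_derivative \<phi> (at w) (frechet_derivative (field_comp A d V) (at w) h))) (at w)"
      by (rule has_derivative_transform_within_open[OF _ O])
         (rule field_comp_change[OF d c, folded \<phi>_def, symmetric])
    from has_derivative_unique[OF 1 this] have "frechet_derivative (field_comp A c V) (at z) (frechet_derivative \<phi> (at w) h)
       = frechet_derivative (\<lambda>y. frechet_derivative \<phi> (at y) (V p)) (at w) h
          + frechet_derivative \<phi> (at w) (frechet_derivative (field_comp A d V) (at w) h)" for h
      unfolding val by (rule fun_cong)
    then show ?thesis by (simp add: val'[of W])
  qed
  have sym: "frechet_derivative (\<lambda>y. frechet_derivative \<phi> (at y) (Y p)) (at w) (X p)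
     = frechet_derivative (\<lambda>y. frechet_derivative \<phi> (at y) (X p)) (at w) (Y p)"
    by (rule frechet_second_symmetric[OF sm O])
  have "lie_bracket A X Y p = frechet_derivative (field_comp A d Y) (at w) (X p) - frechet_derivative (field_comp A d X) (at w) (Y p)"
    by (simp add: lie_bracket_def Let_def d_def w_def)
  then have "field_comp A c (lie_bracket A X Y) z =
      frechet_derivative \<phi> (at w) (frechet_derivative (field_comp A d Y) (at w) (X p))
      - frechet_derivative \<phi> (at w) (frechet_derivative (field_comp A d X) (at w) (Y p))"
    unfolding val'[of "lie_bracket A X Y"]
    by (simp add: linear_diff[OF linear_frechet_derivative[OF smooth_on_differentiable[OF sm O(2)]]])
  then show ?thesis unfolding key[OF X] key[OF Y] sym by simp
qed

section \<open>The curvature in coordinates\<close>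

definition curv_comp :: "('m, 'n) chart \<Rightarrow> real^'n \<Rightarrow> real^'n \<Rightarrow> real^'n \<Rightarrow> real^'n \<Rightarrow> real^'n" where
  "curv_comp c z u v w = dgam c z u v w - dgam c z v u w + gam c z u (gam c z v w) - gam c z v (gam c z u w)"

text \<open>The three bracketed groups are the derivative of the derivative term of
  \<open>nabla Y Z\<close>, the derivative of its Christoffel term, and the Christoffel term of the
  outer \<open>nabla\<close>.\<close>

lemma nabla2_comp:
  assumes c: "c \<in> A" and X: "vf X" and Y: "vf Y" and Z: "vf Z" and z: "z \<in> ran_chart c"
  shows "field_comp A c (nabla X (nabla Y Z)) z =
    (frechet_derivative (\<lambda>y. frechet_derivative (field_comp A c Z) (at y) (field_comp A c Y z)) (at z) (field_comp A c X z)
     + frechet_derivative (field_comp A c Z) (at z) (frechet_derivative (field_comp A c Y) (at z) (field_comp A c X z)))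
    + (dgam c z (field_comp A c X z) (field_comp A c Y z) (field_comp A c Z z)
       + gam c z (frechet_derivative (field_comp A c Y) (at z) (field_comp A c X z)) (field_comp A c Z z)
       + gam c z (field_comp A c Y z) (frechet_derivative (field_comp A c Z) (at z) (field_comp A c X z)))
    + (gam c z (field_comp A c X z) (frechet_derivative (field_comp A c Z) (at z) (field_comp A c Y z))
       + gam c z (field_comp A c X z) (gam c z (field_comp A c Y z) (field_comp A c Z z)))"
proof -
  have cd: "christ c i j differentiable at z" for i j
    by (rule smooth_on_differentiable[OF christ_smooth[OF c] z])
  note dY = field_has_derivative[OF c Y z] and dZ = field_has_derivative[OF c Z z]
  have "(field_comp A c (nabla Y Z) has_derivative
     (\<lambda>h. (frechet_derivative (\<lambda>y. frechet_derivative (field_comp A c Z) (at y) (field_comp A c Y z)) (at z) h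
       + frechet_derivative (field_comp A c Z) (at z) (frechet_derivative (field_comp A c Y) (at z) h))
     + (dgam c z h (field_comp A c Y z) (field_comp A c Z z)
       + gam c z (frechet_derivative (field_comp A c Y) (at z) h) (field_comp A c Z z)
       + gam c z (field_comp A c Y z) (frechet_derivative (field_comp A c Z) (at z) h)))) (at z)"
    by (rule has_derivative_transform_within_open[OF
          has_derivative_add[OF frechet_apply_has_derivative[OF vf_smooth[OF Z c] open_ran[OF c] z dY]
            coeff_sys_has_derivative[OF cd dY dZ]] open_ran[OF c] z])
       (rule nabla_comp[OF c Y Z, symmetric])
  from frechet_eqI[OF this] show ?thesis
    unfolding nabla_comp[OF c X nabla_vf[OF Y Z] z] nabla_comp[OF c Y Z z]
    by (simp add: linear_add[OF linear_coeff_sys2])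
qed

lemma vf_curvature: "vf X \<Longrightarrow> vf Y \<Longrightarrow> vf Z \<Longrightarrow> vf (curvature A nabla X Y Z)"
proof -
  assume v: "vf X" "vf Y" "vf Z"
  have "vf (\<lambda>p. nabla X (nabla Y Z) p - nabla Y (nabla X Z) p - nabla (lie_bracket A X Y) Z p)"
    by (intro vf_diff nabla_vf lie_bracket_vf v)
  then show ?thesis by (simp add: curvature_def[abs_def])
qed

text \<open>Upon antisymmetrisation in \<open>X\<close> and \<open>Y\<close> the second derivatives
  of \<open>Z\<close> cancel, as do the mixed terms with one Christoffel symbol and one derivative
  of \<open>Z\<close>. The terms with derivatives of \<open>X\<close> and \<open>Y\<close> are those
  of the bracket.\<close>

lemma curvature_comp:
  assumes c: "c \<in> A" and X: "vf X" and Y: "vf Y" and Z: "vf Z" and z: "z \<in> ran_chart c"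
  shows "field_comp A c (curvature A nabla X Y Z) z =
    curv_comp c z (field_comp A c X z) (field_comp A c Y z) (field_comp A c Z z)"
proof -
  have "field_comp A c (curvature A nabla X Y Z) z = field_comp A c (nabla X (nabla Y Z)) z
      - field_comp A c (nabla Y (nabla X Z)) z - field_comp A c (nabla (lie_bracket A X Y) Z) z"
    unfolding curvature_def[abs_def] field_comp_diff[OF c z] ..
  also have "\<dots> = curv_comp c z (field_comp A c X z) (field_comp A c Y z) (field_comp A c Z z)"
    unfolding nabla2_comp[OF c X Y Z z] nabla2_comp[OF c Y X Z z]
      nabla_comp[OF c lie_bracket_vf[OF X Y] Z z] lie_bracket_comp[OF c X Y z]
      frechet_second_symmetric[OF vf_smooth[OF Z c] open_ran[OF c] z, of "field_comp A c X z" "field_comp A c Y z"]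
      linear_diff[OF linear_frechet_derivative[OF smooth_on_differentiable[OF vf_smooth[OF Z c] z]]]
      linear_diff[OF linear_coeff_sys1] curv_comp_def
    by (simp add: algebra_simps)
  finally show ?thesis .
qed

lemma linear_curv_comp:
  assumes "c \<in> A" "z \<in> ran_chart c"
  shows "linear (\<lambda>u. curv_comp c z u v w)" "linear (\<lambda>v. curv_comp c z u v w)" "linear (\<lambda>w. curv_comp c z u v w)"
proof -
  have cd: "christ c i j differentiable at z" for i j
    by (rule smooth_on_differentiable[OF christ_smooth[OF assms(1)] assms(2)])
  note l1 = linear_coeff_sys1[of "christ c" z] and l2 = linear_coeff_sys2[of "christ c" z]
  note d1 = linear_coeff_sys_deriv1[OF cd] and d2 = linear_coeff_sys_deriv2[of "christ c" z] and d3 = linear_coeff_sys_deriv3[of "christ c" z]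
  note simps = curv_comp_def linear_add[OF l1] linear_add[OF l2] linear_scale[OF l1] linear_scale[OF l2]
    linear_add[OF d1] linear_add[OF d2] linear_add[OF d3] linear_scale[OF d1] linear_scale[OF d2] linear_scale[OF d3]
  show "linear (\<lambda>u. curv_comp c z u v w)" "linear (\<lambda>v. curv_comp c z u v w)" "linear (\<lambda>w. curv_comp c z u v w)"
    by (rule linearI; simp add: simps algebra_simps)+
qed

text \<open>In the chosen chart the components of a field at \<open>p\<close> are its value, so the
  curvature depends only on the values of its arguments and tensoriality reduces to
  \<open>linear_curv_comp\<close>.\<close>

lemma curvature_at:
  assumes X: "vf X" and Y: "vf Y" and Z: "vf Z"
  shows "curvature A nabla X Y Z p = curv_comp (chart_at A p) (map_chart (chart_at A p) p) (X p) (Y p) (Z p)"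
proof -
  note c = chart_at_in[of p] and p = in_chart_at[of p]
  have v: "field_comp A (chart_at A p) V (map_chart (chart_at A p) p) = V p" for V
    using field_comp_at[OF c p] by (simp add: tangent_comp_chart_at)
  show ?thesis using curvature_comp[OF c X Y Z map_in[OF p]] unfolding v .
qed

lemma tensorial_curvature: "tensorial 3 (curvature_tensor A nabla)"
  unfolding tensorial_def
proof (intro allI impI conjI)
  fix Ys :: "('m \<Rightarrow> real^'n) list" assume len: "length Ys = 3" and v: "\<forall>Y\<in>set Ys. vf Y"
  obtain a b d where Ys: "Ys = [a, b, d]" using len by (auto simp: numeral_3_eq_3 length_Suc_conv)
  have abd: "vf a" "vf b" "vf d" using v Ys by auto
  show "vf (curvature_tensor A nabla Ys)"
    unfolding curvature_tensor_def Ys by (simp add: vf_curvature abd)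
  note lin = linear_curv_comp[OF chart_at_in map_in[OF in_chart_at]]
  fix i assume "i < (3::nat)"
  then have i: "i = 0 \<or> i = 1 \<or> i = 2" by auto
  fix Y and p assume Y: "vf Y"
  show "curvature_tensor A nabla (Ys[i := (\<lambda>q. Y q + Y' q)]) p =
      curvature_tensor A nabla (Ys[i := Y]) p + curvature_tensor A nabla (Ys[i := Y']) p" if Y': "vf Y'" for Y'
    using i by (elim disjE) (simp_all add: curvature_tensor_def Ys curvature_at abd Y Y' vf_add linear_add[OF lin(1)]
       linear_add[OF lin(2)] linear_add[OF lin(3)])
  show "curvature_tensor A nabla (Ys[i := (\<lambda>q. f q *\<^sub>R Y q)]) p = f p *\<^sub>R curvature_tensor A nabla (Ys[i := Y]) p" if f: "sf f" for f
    using i by (elim disjE) (simp_all add: curvature_tensor_def Ys curvature_at abd Y f vf_scale linear_scale[OF lin(1)]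
       linear_scale[OF lin(2)] linear_scale[OF lin(3)])
qed

section \<open>Tensoriality of covariant derivatives\<close>

lemma cov_deriv_snoc: "cov_deriv nabla T (Ys @ [W]) =
    (\<lambda>p. nabla W (T Ys) p - (\<Sum>i<length Ys. T (Ys[i := nabla W (Ys ! i)]) p))"
  by (rule ext) (simp add: cov_deriv_def Let_def)

context
  fixes m T assumes T: "tensorial m T"
begin

lemma set_update_vf: "\<forall>Y\<in>set Ys. vf Y \<Longrightarrow> vf V \<Longrightarrow> \<forall>Y\<in>set (Ys[i := V]). vf Y"
  using set_update_subset_insert[of Ys i V] by blast

lemma cov_deriv_vf:
  assumes Ys: "length Ys = m" "\<forall>Y\<in>set Ys. vf Y" and W: "vf W"
  shows "vf (cov_deriv nabla T (Ys @ [W]))"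
proof -
  have "vf (T (Ys[i := nabla W (Ys ! i)]))" if "i < length Ys" for i
    using Ys W that by (intro tensorial_vf[OF T] set_update_vf nabla_vf) auto
  then show ?thesis unfolding cov_deriv_snoc
    by (intro vf_diff vf_sum nabla_vf W tensorial_vf[OF T Ys]) simp
qed

lemma cov_deriv_dir_add:
  assumes Ys: "length Ys = m" "\<forall>Y\<in>set Ys. vf Y" and W: "vf W" "vf W'"
  shows "cov_deriv nabla T (Ys @ [(\<lambda>q. W q + W' q)]) p = cov_deriv nabla T (Ys @ [W]) p + cov_deriv nabla T (Ys @ [W']) p"
proof -
  have "T (Ys[i := nabla (\<lambda>q. W q + W' q) (Ys ! i)]) p = T (Ys[i := nabla W (Ys ! i)]) p + T (Ys[i := nabla W' (Ys ! i)]) p"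
    if "i < length Ys" for i
  proof -
    have y: "vf (Ys ! i)" using Ys that by simp
    show ?thesis unfolding nabla_add1[OF W y]
      using that Ys by (intro tensorial_add[OF T Ys] nabla_vf W y) simp
  qed
  then show ?thesis
    by (simp add: cov_deriv_snoc nabla_add1[OF W tensorial_vf[OF T Ys]] sum.distrib)
qed

lemma cov_deriv_dir_scale:
  assumes Ys: "length Ys = m" "\<forall>Y\<in>set Ys. vf Y" and W: "vf W" and f: "sf f"
  shows "cov_deriv nabla T (Ys @ [(\<lambda>q. f q *\<^sub>R W q)]) p = f p *\<^sub>R cov_deriv nabla T (Ys @ [W]) p"
proof -
  have "T (Ys[i := nabla (\<lambda>q. f q *\<^sub>R W q) (Ys ! i)]) p = f p *\<^sub>R T (Ys[i := nabla W (Ys ! i)]) p"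
    if "i < length Ys" for i
  proof -
    have y: "vf (Ys ! i)" using Ys that by simp
    show ?thesis unfolding nabla_scale1[OF f W y]
      using that Ys by (intro tensorial_scale[OF T Ys] nabla_vf W y f) simp
  qed
  then show ?thesis
    by (simp add: cov_deriv_snoc nabla_scale1[OF f W tensorial_vf[OF T Ys]] scaleR_right_diff_distrib scaleR_sum_right)
qed

context
  fixes Ys i W assumes Ys: "length Ys = m" "\<forall>Y\<in>set Ys. vf Y" and i: "i < m" and W: "vf W"
begin

lemma other_slot:
  assumes "j < m" "j \<noteq> i"
  shows "(Ys[i := V])[j := nabla W (Ys[i := V] ! j)] = (Ys[j := nabla W (Ys ! j)])[i := V]"
  using assms by (simp add: list_update_swap)

lemma other_list:
  assumes "j < m"
  shows "length (Ys[j := nabla W (Ys ! j)]) = m" "\<forall>Y\<in>set (Ys[j := nabla W (Ys ! j)]). vf Y"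
proof -
  have "vf (Ys ! j)" using assms Ys by simp
  then show "\<forall>Y\<in>set (Ys[j := nabla W (Ys ! j)]). vf Y" by (intro set_update_vf Ys(2) nabla_vf W)
qed (simp add: Ys(1))

lemma cov_deriv_slot_add:
  assumes Y: "vf Y" "vf Y'"
  shows "cov_deriv nabla T (Ys[i := (\<lambda>q. Y q + Y' q)] @ [W]) p =
    cov_deriv nabla T (Ys[i := Y] @ [W]) p + cov_deriv nabla T (Ys[i := Y'] @ [W]) p"
proof -
  let ?S = "\<lambda>q. Y q + Y' q"
  let ?t = "\<lambda>V j. T ((Ys[i := V])[j := nabla W (Ys[i := V] ! j)]) p"
  have TS: "T (Ys[i := ?S]) = (\<lambda>p. T (Ys[i := Y]) p + T (Ys[i := Y']) p)"
    by (rule ext) (rule tensorial_add[OF T Ys i Y])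
  have vT: "vf (T (Ys[i := V]))" if "vf V" for V
    using Ys that by (intro tensorial_vf[OF T] set_update_vf) auto
  have t: "?t ?S j = ?t Y j + ?t Y' j" if j: "j < m" for j
  proof (cases "j = i")
    case True
    have "T (Ys[i := nabla W ?S]) p = T (Ys[i := nabla W Y]) p + T (Ys[i := nabla W Y']) p"
      unfolding nabla_add2[OF W Y] by (rule tensorial_add[OF T Ys i nabla_vf[OF W Y(1)] nabla_vf[OF W Y(2)]])
    then show ?thesis using True i Ys by simp
  next
    case False
    show ?thesis unfolding other_slot[OF j False]
      by (rule tensorial_add[OF T other_list[OF j] i Y])
  qed
  show ?thesis
    by (simp add: cov_deriv_snoc TS nabla_add2[OF W vT[OF Y(1)] vT[OF Y(2)]] Ys(1) t sum.distrib)
qed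

text \<open>The derivative of \<open>f\<close> arises twice, from the outer \<open>nabla W\<close>
  and from the summand \<open>j = i\<close>, with opposite signs.\<close>

lemma cov_deriv_slot_scale:
  assumes f: "sf f" and Y: "vf Y"
  shows "cov_deriv nabla T (Ys[i := (\<lambda>q. f q *\<^sub>R Y q)] @ [W]) p = f p *\<^sub>R cov_deriv nabla T (Ys[i := Y] @ [W]) p"
proof -
  let ?S = "\<lambda>q. f q *\<^sub>R Y q"
  let ?t = "\<lambda>V j. T ((Ys[i := V])[j := nabla W (Ys[i := V] ! j)]) p"
  let ?g = "field_deriv A W f"
  have g: "sf ?g" by (rule sf_field_deriv[OF f W])
  have TS: "T (Ys[i := ?S]) = (\<lambda>p. f p *\<^sub>R T (Ys[i := Y]) p)"
    by (rule ext) (rule tensorial_scale[OF T Ys i f Y])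
  have vT: "vf (T (Ys[i := Y]))"
    using Ys Y by (intro tensorial_vf[OF T] set_update_vf) auto
  have t: "?t ?S j = f p *\<^sub>R ?t Y j + (if j = i then ?g p *\<^sub>R T (Ys[i := Y]) p else 0)" if j: "j < m" for j
  proof (cases "j = i")
    case True
    have "T (Ys[i := nabla W ?S]) p = ?g p *\<^sub>R T (Ys[i := Y]) p + f p *\<^sub>R T (Ys[i := nabla W Y]) p"
      unfolding nabla_leibniz[OF f W Y]
        tensorial_add[OF T Ys i vf_scale[OF g Y] vf_scale[OF f nabla_vf[OF W Y]]]
        tensorial_scale[OF T Ys i g Y] tensorial_scale[OF T Ys i f nabla_vf[OF W Y]] ..
    then show ?thesis using True i Ys by simp
  next
    case False
    then show ?thesis unfolding other_slot[OF j False]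
      using tensorial_scale[OF T other_list[OF j] i f Y] by simp
  qed
  have "(\<Sum>j<m. ?t ?S j) = f p *\<^sub>R (\<Sum>j<m. ?t Y j) + ?g p *\<^sub>R T (Ys[i := Y]) p"
    using i by (simp add: t sum.distrib scaleR_sum_right)
  then show ?thesis
    by (simp add: cov_deriv_snoc TS nabla_leibniz[OF f W vT] Ys(1) scaleR_right_diff_distrib)
qed

end

lemma tensorial_cov_deriv: "tensorial (Suc m) (cov_deriv nabla T)"
  unfolding tensorial_def
proof (intro allI impI)
  fix Vs :: "('m \<Rightarrow> real^'n) list" assume len: "length Vs = Suc m" and v: "\<forall>Y\<in>set Vs. vf Y"
  obtain Ys W where Vs: "Vs = Ys @ [W]" using len by (metis length_0_conv nat.simps(3) rev_exhaust)
  have Ys: "length Ys = m" "\<forall>Y\<in>set Ys. vf Y" and W: "vf W" using len v Vs by auto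
  have upd: "Vs[i := V] = (if i < m then Ys[i := V] @ [W] else Ys @ [V])" if "i < Suc m" for i V
    using that Ys(1) by (auto simp: Vs list_update_append less_Suc_eq)
  show "vf (cov_deriv nabla T Vs) \<and>
     (\<forall>i<Suc m. \<forall>Y Y' p. vf Y \<longrightarrow> vf Y' \<longrightarrow> cov_deriv nabla T (Vs[i := (\<lambda>q. Y q + Y' q)]) p
        = cov_deriv nabla T (Vs[i := Y]) p + cov_deriv nabla T (Vs[i := Y']) p) \<and>
     (\<forall>i<Suc m. \<forall>f Y p. sf f \<longrightarrow> vf Y \<longrightarrow> cov_deriv nabla T (Vs[i := (\<lambda>q. f q *\<^sub>R Y q)]) p
        = f p *\<^sub>R cov_deriv nabla T (Vs[i := Y]) p)"
  proof (intro conjI allI impI)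
    show "vf (cov_deriv nabla T Vs)" unfolding Vs by (rule cov_deriv_vf[OF Ys W])
    fix i Y Y' p assume "i < Suc m" "vf Y" "vf Y'"
    then show "cov_deriv nabla T (Vs[i := (\<lambda>q. Y q + Y' q)]) p
        = cov_deriv nabla T (Vs[i := Y]) p + cov_deriv nabla T (Vs[i := Y']) p"
      by (simp add: upd cov_deriv_slot_add[OF Ys _ W] cov_deriv_dir_add[OF Ys])
  next
    fix i f Y p assume "i < Suc m" "sf f" "vf Y"
    then show "cov_deriv nabla T (Vs[i := (\<lambda>q. f q *\<^sub>R Y q)]) p = f p *\<^sub>R cov_deriv nabla T (Vs[i := Y]) p"
      by (simp add: upd cov_deriv_slot_scale[OF Ys _ W] cov_deriv_dir_scale[OF Ys])
  qed
qed

end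

lemma curvature_deriv_Suc: "curvature_deriv A nabla (Suc j) = cov_deriv nabla (curvature_deriv A nabla j)"
  by (simp add: curvature_deriv_def)

lemma tensorial_curvature_deriv: "tensorial (j + 3) (curvature_deriv A nabla j)"
proof (induction j)
  case 0 then show ?case using tensorial_curvature by (simp add: curvature_deriv_def)
next
  case (Suc j) show ?case unfolding curvature_deriv_Suc add_Suc by (rule tensorial_cov_deriv[OF Suc])
qed

end

section \<open>Vanishing of the curvature\<close>

text \<open>Vanishing to order \<open>k\<close> as a growth condition, which is stable under sums
  and continuous factors without any mention of iterated derivatives.\<close>

definition vanish_order :: "'a::real_normed_vector \<Rightarrow> nat \<Rightarrow> ('a \<Rightarrow> 'b::real_normed_vector) \<Rightarrow> bool" where
  "vanish_order a k f \<longleftrightarrow> (\<exists>C. \<forall>\<^sub>F z in nhds a. norm (f z) \<le> C * norm (z - a) ^ k)"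

lemma vanish_orderI: "\<forall>\<^sub>F z in nhds a. norm (f z) \<le> C * norm (z - a) ^ k \<Longrightarrow> vanish_order a k f"
  unfolding vanish_order_def by (rule exI)

lemma vanish_orderE:
  assumes "vanish_order a k f"
  obtains C where "C \<ge> 0" "\<forall>\<^sub>F z in nhds a. norm (f z) \<le> C * norm (z - a) ^ k"
proof -
  obtain C where C: "\<forall>\<^sub>F z in nhds a. norm (f z) \<le> C * norm (z - a) ^ k"
    using assms unfolding vanish_order_def by (rule exE)
  have "C * norm (z - a) ^ k \<le> max 0 C * norm (z - a) ^ k" for z
    by (intro mult_right_mono) auto
  then have "\<forall>\<^sub>F z in nhds a. norm (f z) \<le> max 0 C * norm (z - a) ^ k"
    using C by (rule_tac eventually_mono[OF C]) (rule order_trans)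
  then show ?thesis by (rule that[rotated]) simp
qed

lemma vanish_order_add:
  assumes "vanish_order a k f" "vanish_order a k g" shows "vanish_order a k (\<lambda>z. f z + g z)"
proof -
  obtain C where C: "C \<ge> 0" "\<forall>\<^sub>F z in nhds a. norm (f z) \<le> C * norm (z - a) ^ k" by (rule vanish_orderE[OF assms(1)])
  obtain D where D: "D \<ge> 0" "\<forall>\<^sub>F z in nhds a. norm (g z) \<le> D * norm (z - a) ^ k" by (rule vanish_orderE[OF assms(2)])
  have "\<forall>\<^sub>F z in nhds a. norm (f z + g z) \<le> (C + D) * norm (z - a) ^ k"
    using C(2) D(2)
  proof eventually_elim
    case (elim z)
    then show ?case using norm_triangle_mono[OF elim] by (simp add: distrib_right)
  qed
  then show ?thesis by (rule vanish_orderI)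
qed

lemma vanish_order_zero: "vanish_order a k (\<lambda>z. 0)"
  by (rule vanish_orderI[where C=0]) simp

lemma vanish_order_sum:
  "(\<And>i. i \<in> I \<Longrightarrow> vanish_order a k (f i)) \<Longrightarrow> vanish_order a k (\<lambda>z. \<Sum>i\<in>I. f i z)"
  by (induction I rule: infinite_finite_induct) (auto intro: vanish_order_zero vanish_order_add)

text \<open>A factor continuous at \<open>a\<close> is at most \<open>\<bar>h a\<bar> + 1\<close>
  nearby and only enlarges the constant.\<close>

lemma vanish_order_bounded:
  assumes f: "vanish_order a k f" and h: "continuous (at a) h"
    and g: "\<forall>\<^sub>F z in nhds a. norm (g z) \<le> h z * norm (f z)"
  shows "vanish_order a k g"
proof -
  obtain C where C: "C \<ge> 0" "\<forall>\<^sub>F z in nhds a. norm (f z) \<le> C * norm (z - a) ^ k" by (rule vanish_orderE[OF f])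
  have "(h \<longlongrightarrow> h a) (nhds a)" using h by (simp add: continuous_at tendsto_nhds_iff)
  then have "\<forall>\<^sub>F z in nhds a. h z < \<bar>h a\<bar> + 1" by (rule order_tendstoD) simp
  then have "\<forall>\<^sub>F z in nhds a. norm (g z) \<le> ((\<bar>h a\<bar> + 1) * C) * norm (z - a) ^ k"
    using C(2) g
  proof eventually_elim
    case (elim z)
    have "h z * norm (f z) \<le> (\<bar>h a\<bar> + 1) * (C * norm (z - a) ^ k)"
    proof -
      have "h z * norm (f z) \<le> (\<bar>h a\<bar> + 1) * norm (f z)" using elim(1) by (intro mult_right_mono) auto
      also have "\<dots> \<le> (\<bar>h a\<bar> + 1) * (C * norm (z - a) ^ k)" using elim(2) by (intro mult_left_mono) auto
      finally show ?thesis .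
    qed
    then show ?case using elim(3) by (simp add: mult.assoc)
  qed
  then show ?thesis by (rule vanish_orderI)
qed

lemma vanish_order_uminus: "vanish_order a k f \<Longrightarrow> vanish_order a k (\<lambda>z. - f z)"
  by (rule vanish_order_bounded[where h="\<lambda>_. 1"]) auto

lemma vanish_order_diff:
  "vanish_order a k f \<Longrightarrow> vanish_order a k g \<Longrightarrow> vanish_order a k (\<lambda>z. f z - g z)"
  using vanish_order_add[OF _ vanish_order_uminus, of a k f g] by simp

lemma vanish_order_divide:
  fixes \<psi> :: "'a::real_normed_vector \<Rightarrow> real"
  assumes v: "vanish_order a k f" and \<psi>: "continuous (at a) \<psi>" "\<psi> a > 0"
    and eq: "\<forall>\<^sub>F z in nhds a. \<psi> z *\<^sub>R g z = f z"
  shows "vanish_order a k g"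
proof (rule vanish_order_bounded[OF v, where h="\<lambda>z. inverse (\<psi> z)"])
  show "continuous (at a) (\<lambda>z. inverse (\<psi> z))" using \<psi> by (intro continuous_intros) auto
  have "(\<psi> \<longlongrightarrow> \<psi> a) (nhds a)" using \<psi>(1) by (simp add: continuous_at tendsto_nhds_iff)
  then have "\<forall>\<^sub>F z in nhds a. 0 < \<psi> z" using \<psi>(2) by (rule order_tendstoD)
  then show "\<forall>\<^sub>F z in nhds a. norm (g z) \<le> inverse (\<psi> z) * norm (f z)"
    using eq
  proof eventually_elim
    case (elim z)
    have "norm (f z) = \<psi> z * norm (g z)" using elim by (metis abs_of_pos norm_scaleR)
    then have "inverse (\<psi> z) * norm (f z) = norm (g z)" using elim(1) by (simp add: field_simps)
    then show ?case by simp
  qed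
qed

text \<open>The mean value inequality on the segment from \<open>a\<close>: the derivative
  contributes the power \<open>k\<close>, the length of the segment one more factor.\<close>

lemma vanish_order_primitive:
  fixes f :: "'a::euclidean_space \<Rightarrow> 'b::real_normed_vector"
  assumes S: "open S" "a \<in> S" and f: "\<And>z. z \<in> S \<Longrightarrow> f differentiable (at z)" "f a = 0"
    and v: "\<And>b. vanish_order a k (\<lambda>z. frechet_derivative f (at z) b)"
  shows "vanish_order a (Suc k) f"
proof -
  have "\<exists>C. C \<ge> 0 \<and> (\<forall>\<^sub>F z in nhds a. norm (frechet_derivative f (at z) b) \<le> C * norm (z - a) ^ k)" for b
    by (rule vanish_orderE[OF v[of b]]) (intro exI conjI)
  then obtain C where C: "\<And>b. C b \<ge> 0"
    "\<And>b. \<forall>\<^sub>F z in nhds a. norm (frechet_derivative f (at z) b) \<le> C b * norm (z - a) ^ k"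
    using choice[of "\<lambda>b C. C \<ge> 0 \<and> (\<forall>\<^sub>F z in nhds a. norm (frechet_derivative f (at z) b) \<le> C * norm (z - a) ^ k)"]
    by auto
  define K where "K = (\<Sum>b\<in>Basis. C b)"
  have K: "K \<ge> 0" by (simp add: K_def C sum_nonneg)
  have "\<forall>\<^sub>F z in nhds a. z \<in> S \<and> (\<forall>b\<in>Basis. norm (frechet_derivative f (at z) b) \<le> C b * norm (z - a) ^ k)"
    using eventually_nhds_in_open[OF S] C(2) by (intro eventually_conj eventually_ball_finite) auto
  then obtain d where d: "d > 0" "\<forall>z. dist z a < d \<longrightarrow> z \<in> S \<and> (\<forall>b\<in>Basis. norm (frechet_derivative f (at z) b) \<le> C b * norm (z - a) ^ k)"
    unfolding eventually_nhds_metric by (elim exE conjE) (rule that)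
  have dS: "z \<in> S" if "dist z a < d" for z
    by (rule conjunct1[OF mp[OF spec[OF d(2)] that]])
  have dB: "norm (frechet_derivative f (at z) b) \<le> C b * norm (z - a) ^ k" if "dist z a < d" "b \<in> Basis" for z b
    by (rule bspec[OF conjunct2[OF mp[OF spec[OF d(2)] that(1)]] that(2)])
  have Db: "norm (frechet_derivative f (at z) h) \<le> K * norm (z - a) ^ k * norm h" if z: "dist z a < d" for z h
  proof -
    have "frechet_derivative f (at z) h = (\<Sum>b\<in>Basis. (h \<bullet> b) *\<^sub>R frechet_derivative f (at z) b)"
      by (rule frechet_euclidean_sum[OF f(1)[OF dS[OF z]]])
    also have "norm \<dots> \<le> (\<Sum>b\<in>Basis. norm h * (C b * norm (z - a) ^ k))"
      using dB[OF z] by (intro sum_norm_le) (auto intro!: mult_mono simp: Basis_le_norm)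
    finally show ?thesis by (simp add: K_def sum_distrib_left sum_distrib_right mult_ac)
  qed
  have "norm (f z) \<le> K * norm (z - a) ^ Suc k" if z: "dist z a < d" for z
  proof -
    have seg: "dist y a < d" "norm (y - a) \<le> norm (z - a)" if "y \<in> closed_segment a z" for y
    proof -
      show "norm (y - a) \<le> norm (z - a)" by (rule segment_bound(1)[OF that])
      then show "dist y a < d" using z unfolding dist_norm by (rule le_less_trans)
    qed
    have "norm (f z - f a) \<le> (K * norm (z - a) ^ k) * norm (z - a)"
    proof (rule differentiable_bound[OF convex_closed_segment, of a z f "\<lambda>y. frechet_derivative f (at y)"])
      fix y assume y: "y \<in> closed_segment a z"
      show "(f has_derivative frechet_derivative f (at y)) (at y within closed_segment a z)"
        by (rule has_derivative_at_withinI[OF has_derivative_frechet[OF f(1)[OF dS[OF seg(1)[OF y]]]]])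
      show "onorm (frechet_derivative f (at y)) \<le> K * norm (z - a) ^ k"
      proof (rule onorm_le)
        fix h
        have "norm (frechet_derivative f (at y) h) \<le> K * norm (y - a) ^ k * norm h" by (rule Db[OF seg(1)[OF y]])
        also have "\<dots> \<le> K * norm (z - a) ^ k * norm h"
          using seg(2)[OF y] K by (intro mult_right_mono mult_left_mono power_mono) auto
        finally show "norm (frechet_derivative f (at y) h) \<le> K * norm (z - a) ^ k * norm h" .
      qed
    qed auto
    then show ?thesis using f(2) by (simp add: mult_ac)
  qed
  then show ?thesis using d(1)
    by (intro vanish_orderI[where C=K]) (auto simp: eventually_nhds_metric)
qed

section \<open>Scalar components of the curvature\<close>

lemma coeff_sys_axis1:
  "coeff_sys c z (axis i 1) v = (\<Sum>j\<in>UNIV. (v $ j) *\<^sub>R c i j z)"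
proof -
  have "coeff_sys c z (axis i 1) v = (\<Sum>k\<in>UNIV. if k = i then (\<Sum>j\<in>UNIV. (v $ j) *\<^sub>R c k j z) else 0)"
    unfolding coeff_sys_def by (intro sum.cong) (auto simp: axis_def)
  then show ?thesis by simp
qed

lemma coeff_sys_axis: "coeff_sys c z (axis i 1) (axis j 1) = c i j z"
proof -
  have "coeff_sys c z (axis i 1) (axis j 1) = (\<Sum>k\<in>UNIV. if k = j then c i k z else 0)"
    unfolding coeff_sys_axis1 by (intro sum.cong) (auto simp: axis_def)
  then show ?thesis by simp
qed

lemma coeff_sys_deriv_axis: "coeff_sys_deriv c z h (axis i 1) (axis j 1) = frechet_derivative (c i j) (at z) h"
  using coeff_sys_axis[of "\<lambda>i j z. frechet_derivative (c i j) (at z) h" z i j]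
  by (simp add: coeff_sys_def coeff_sys_deriv_def)

lemma linear_axis_zero:
  fixes f :: "real^'n \<Rightarrow> 'b::real_vector"
  assumes l: "linear f" and z: "\<And>i. f (axis i 1) = 0" shows "f u = 0"
proof -
  have "f u = f (\<Sum>i\<in>UNIV. u $ i *\<^sub>R axis i 1)"
    using basis_expansion[of u] by (simp add: scalar_mult_eq_scaleR)
  also have "\<dots> = 0" by (simp add: linear_sum[OF l] linear_scale[OF l] z)
  finally show ?thesis .
qed

lemma fps_expansion_sum_ex:
  fixes f :: "'i \<Rightarrow> real \<Rightarrow> real"
  assumes "\<And>i. i \<in> I \<Longrightarrow> \<exists>F. f i has_fps_expansion F"
  shows "\<exists>F. (\<lambda>t. \<Sum>i\<in>I. f i t) has_fps_expansion F"
  using assms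
proof (induction I rule: infinite_finite_induct)
  case (insert i I)
  obtain F where F: "f i has_fps_expansion F" using insert.prems[OF insertI1] by (rule exE)
  obtain G where G: "(\<lambda>t. \<Sum>i\<in>I. f i t) has_fps_expansion G" using insert.IH[OF insert.prems[OF insertI2]] by (rule exE)
  show ?case unfolding sum.insert[OF insert.hyps] by (rule exI, rule has_fps_expansion_add[OF F G])
qed (auto intro: exI[of _ 0])

context connection_manifold
begin

lemma field_with_comp:
  assumes "c \<in> A" "p \<in> dom_chart c"
  obtains V where "vf V" "field_comp A c V (map_chart c p) = u"
proof -
  obtain V where "vf V" "V p = tangent_vec c p u" by (rule field_through)
  then show ?thesis using that field_comp_at[OF assms, of V] tangent_comp_vec[OF assms] by simp
qed

lemma field_comp_sum:
  assumes "c \<in> A" "z \<in> ran_chart c"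
  shows "field_comp A c (\<lambda>q. \<Sum>i\<in>I. X i q) z = (\<Sum>i\<in>I. field_comp A c (X i) z)"
  by (simp add: field_comp_def linear_sum[OF linear_tangent_comp[OF assms(1) inv_in[OF assms(2)]]])

text \<open>The components of \<open>curv_comp\<close> on the standard basis, rewritten through
  scalar components of the Christoffel symbols, since the facts on analytic derivatives and on lines
  concern real-valued functions.\<close>

definition curv_frame :: "('m, 'n) chart \<Rightarrow> 'n \<Rightarrow> 'n \<Rightarrow> 'n \<Rightarrow> 'n \<Rightarrow> real^'n \<Rightarrow> real" where
  "curv_frame c i j l m z =
     frechet_derivative (\<lambda>y. christ c j l y $ m) (at z) (axis i 1)
     - frechet_derivative (\<lambda>y. christ c i l y $ m) (at z) (axis j 1)
     + (\<Sum>p\<in>UNIV. christ c j l z $ p * christ c i p z $ m)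
     - (\<Sum>p\<in>UNIV. christ c i l z $ p * christ c j p z $ m)"

lemma curv_frame_eq:
  assumes "c \<in> A" "z \<in> ran_chart c"
  shows "curv_comp c z (axis i 1) (axis j 1) (axis l 1) $ m = curv_frame c i j l m z"
proof -
  have "frechet_derivative (christ c i j) (at z) v $ m = frechet_derivative (\<lambda>y. christ c i j y $ m) (at z) v" for i j v
    using frechet_linear_compose[OF bounded_linear_vec_nth smooth_on_differentiable[OF christ_smooth[OF assms(1)] assms(2)]] by simp
  then show ?thesis
    by (simp add: curv_comp_def curv_frame_def coeff_sys_deriv_axis coeff_sys_axis) (simp add: coeff_sys_axis1)
qed

text \<open>Each ingredient is restricted to the line before being multiplied, so only products of
  power series in one variable occur.\<close>

lemma curv_frame_line:
  assumes c: "c \<in> A" and z: "z \<in> ran_chart c"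
  shows "\<exists>F. (\<lambda>t. curv_frame c i j l m (z + t *\<^sub>R w)) has_fps_expansion F"
proof -
  have an: "real_analytic_on (ran_chart c) (\<lambda>y. christ c i j y $ m)" for i j m
    by (rule real_analytic_on_nth[OF christ(2)[OF c]])
  have 1: "\<exists>F. (\<lambda>t. christ c i j (z + t *\<^sub>R w) $ m) has_fps_expansion F" for i j m
    by (rule analytic_along_line[OF bspec[OF an[unfolded real_analytic_on_def] z]])
  have 2: "\<exists>F. (\<lambda>t. frechet_derivative (\<lambda>y. christ c i j y $ m) (at (z + t *\<^sub>R w)) v) has_fps_expansion F" for i j m v
    by (rule analytic_along_line[OF bspec[OF real_analytic_on_frechet[OF an, unfolded real_analytic_on_def] z]])
  have 3: "\<exists>F. (\<lambda>t. \<Sum>p\<in>UNIV. christ c i j (z + t *\<^sub>R w) $ p * christ c k p (z + t *\<^sub>R w) $ m) has_fps_expansion F" for i j k m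
  proof (rule fps_expansion_sum_ex)
    fix p
    obtain F where F: "(\<lambda>t. christ c i j (z + t *\<^sub>R w) $ p) has_fps_expansion F" using 1[of i j p] by (rule exE)
    obtain G where G: "(\<lambda>t. christ c k p (z + t *\<^sub>R w) $ m) has_fps_expansion G" using 1[of k p m] by (rule exE)
    show "\<exists>F. (\<lambda>t. christ c i j (z + t *\<^sub>R w) $ p * christ c k p (z + t *\<^sub>R w) $ m) has_fps_expansion F"
      by (rule exI, rule has_fps_expansion_mult[OF F G])
  qed
  obtain F1 where F1: "(\<lambda>t. frechet_derivative (\<lambda>y. christ c j l y $ m) (at (z + t *\<^sub>R w)) (axis i 1)) has_fps_expansion F1"
    using 2[of j l m "axis i 1"] by (rule exE)
  obtain F2 where F2: "(\<lambda>t. frechet_derivative (\<lambda>y. christ c i l y $ m) (at (z + t *\<^sub>R w)) (axis j 1)) has_fps_expansion F2"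
    using 2[of i l m "axis j 1"] by (rule exE)
  obtain F3 where F3: "(\<lambda>t. \<Sum>p\<in>UNIV. christ c j l (z + t *\<^sub>R w) $ p * christ c i p (z + t *\<^sub>R w) $ m) has_fps_expansion F3"
    using 3[of j l i m] by (rule exE)
  obtain F4 where F4: "(\<lambda>t. \<Sum>p\<in>UNIV. christ c i l (z + t *\<^sub>R w) $ p * christ c j p (z + t *\<^sub>R w) $ m) has_fps_expansion F4"
    using 3[of i l j m] by (rule exE)
  show ?thesis unfolding curv_frame_def
    by (rule exI, rule has_fps_expansion_diff[OF has_fps_expansion_add[OF has_fps_expansion_diff[OF F1 F2] F3] F4])
qed

definition flat_at :: "'m \<Rightarrow> bool" where
  "flat_at p \<longleftrightarrow> (\<forall>X Y Z. vf X \<longrightarrow> vf Y \<longrightarrow> vf Z \<longrightarrow> curvature A nabla X Y Z p = 0)"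

lemma curv_comp_zero:
  assumes c: "c \<in> A" and z: "z \<in> ran_chart c" and 0: "\<And>i j l m. curv_frame c i j l m z = 0"
  shows "curv_comp c z u v w = 0"
proof -
  note lin = linear_curv_comp[OF c z]
  have "curv_comp c z (axis i 1) (axis j 1) (axis l 1) = 0" for i j l
    by (simp add: vec_eq_iff curv_frame_eq[OF c z] 0)
  then have "curv_comp c z (axis i 1) (axis j 1) w = 0" for i j w by (rule linear_axis_zero[OF lin(3)])
  then have "curv_comp c z (axis i 1) v w = 0" for i v w by (rule linear_axis_zero[OF lin(2)])
  then show ?thesis by (rule linear_axis_zero[OF lin(1)])
qed

text \<open>The left-hand side mentions no chart. This is how vanishing passes from the components
  in one chart to those in another.\<close>

lemma flat_at_iff:
  assumes c: "c \<in> A" and p: "p \<in> dom_chart c"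
  shows "flat_at p \<longleftrightarrow> (\<forall>i j l m. curv_frame c i j l m (map_chart c p) = 0)"
proof
  let ?z = "map_chart c p"
  note z = map_in[OF p]
  assume f: "flat_at p"
  show "\<forall>i j l m. curv_frame c i j l m ?z = 0"
  proof (intro allI)
    fix i j l m
    obtain X where X: "vf X" "field_comp A c X ?z = axis i 1" by (rule field_with_comp[OF c p])
    obtain Y where Y: "vf Y" "field_comp A c Y ?z = axis j 1" by (rule field_with_comp[OF c p])
    obtain Z where Z: "vf Z" "field_comp A c Z ?z = axis l 1" by (rule field_with_comp[OF c p])
    have "curvature A nabla X Y Z p = 0" using f X Y Z by (simp add: flat_at_def)
    then have "field_comp A c (curvature A nabla X Y Z) ?z = 0"
      by (simp add: field_comp_at[OF c p] linear_0[OF linear_tangent_comp[OF c p]])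
    then have "curv_comp c ?z (axis i 1) (axis j 1) (axis l 1) = 0"
      by (simp add: curvature_comp[OF c X(1) Y(1) Z(1) z] X Y Z)
    then show "curv_frame c i j l m ?z = 0" by (simp add: curv_frame_eq[OF c z, symmetric])
  qed
next
  let ?z = "map_chart c p"
  note z = map_in[OF p]
  assume 0: "\<forall>i j l m. curv_frame c i j l m ?z = 0"
  show "flat_at p" unfolding flat_at_def
  proof (intro allI impI)
    fix X Y Z assume v: "vf X" "vf Y" "vf Z"
    have "field_comp A c (curvature A nabla X Y Z) ?z = 0"
      unfolding curvature_comp[OF c v z] by (rule curv_comp_zero[OF c z]) (use 0 in simp)
    then have "tangent_comp A c p (curvature A nabla X Y Z p) = tangent_comp A c p 0"
      by (simp add: field_comp_at[OF c p] linear_0[OF linear_tangent_comp[OF c p]])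
    then show "curvature A nabla X Y Z p = 0" by (rule tangent_comp_inject[OF c p])
  qed
qed

text \<open>Convexity of \<open>B\<close> keeps the segment inside the chart, where the component
  has a power series around every parameter.\<close>

lemma curv_frame_propagate:
  assumes c: "c \<in> A" and B: "convex B" "B \<subseteq> ran_chart c" "a \<in> B" "b \<in> B"
    and ev: "\<forall>\<^sub>F t in nhds 0. curv_frame c i j l m (a + t *\<^sub>R (b - a)) = 0"
  shows "curv_frame c i j l m b = 0"
proof -
  have "curv_frame c i j l m (a + 1 *\<^sub>R (b - a)) = 0"
  proof (rule analytic_line_vanish[where \<phi>="\<lambda>t. curv_frame c i j l m (a + t *\<^sub>R (b - a))"])
    fix t :: real assume t: "t \<in> {0..1}"
    have "a + t *\<^sub>R (b - a) \<in> B" using convexD_alt[OF B(1,3,4), of t] t by (simp add: algebra_simps)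
    then have z: "a + t *\<^sub>R (b - a) \<in> ran_chart c" using B(2) by blast
    have e: "a + (t + s) *\<^sub>R (b - a) = (a + t *\<^sub>R (b - a)) + s *\<^sub>R (b - a)" for s
      by (simp add: scaleR_left_distrib add.assoc)
    show "\<exists>F. (\<lambda>s. curv_frame c i j l m (a + (t + s) *\<^sub>R (b - a))) has_fps_expansion F"
      unfolding e by (rule curv_frame_line[OF c z])
  qed (use ev in auto)
  then show ?thesis by simp
qed

context
  fixes x
  assumes conn: "connected (UNIV :: 'm set)"
    and curv0: "\<And>j Ys. length Ys = j + 3 \<Longrightarrow> (\<forall>Y\<in>set Ys. vf Y) \<Longrightarrow> curvature_deriv A nabla j Ys x = 0"
begin

lemma curvature_deriv_vanish_order:
  assumes c: "c \<in> A" and x: "x \<in> dom_chart c"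
  shows "length Ys = j + 3 \<Longrightarrow> (\<forall>Y\<in>set Ys. vf Y) \<Longrightarrow>
    vanish_order (map_chart c x) k (field_comp A c (curvature_deriv A nabla j Ys))"
proof (induction k arbitrary: j Ys)
  case 0
  let ?f = "field_comp A c (curvature_deriv A nabla j Ys)"
  have "vf (curvature_deriv A nabla j Ys)" by (rule tensorial_vf[OF tensorial_curvature_deriv 0])
  then have "continuous_on (ran_chart c) ?f" by (intro smooth_on_continuous vf_smooth c)
  then have "isCont ?f (map_chart c x)"
    using continuous_on_eq_continuous_at[OF open_ran[OF c]] map_in[OF x] by blast
  then have cn: "continuous (at (map_chart c x)) (\<lambda>z. norm (?f z))" by (intro continuous_norm)
  have v1: "vanish_order (map_chart c x) 0 (\<lambda>z. 1::real)" by (rule vanish_orderI[where C=1]) simp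
  show ?case by (rule vanish_order_bounded[OF v1 cn]) simp
next
  case (Suc k)
  let ?T = "curvature_deriv A nabla j"
  let ?a = "map_chart c x"
  let ?f = "field_comp A c (?T Ys)"
  note len = Suc.prems(1) and Ys = Suc.prems(2)
  note oc = open_ran[OF c] and a = map_in[OF x]
  have vT: "vf (?T Ys)" by (rule tensorial_vf[OF tensorial_curvature_deriv len Ys])
  note sm = vf_smooth[OF vT c]
  show ?case
  proof (rule vanish_order_primitive[OF oc a])
    show "?f differentiable at z" if "z \<in> ran_chart c" for z by (rule smooth_on_differentiable[OF sm that])
    show "?f ?a = 0"
      by (simp add: field_comp_at[OF c x] curv0[OF len Ys] linear_0[OF linear_tangent_comp[OF c x]])
    fix b
    obtain \<psi> W where \<psi>: "smooth_on (ran_chart c) \<psi>" "\<psi> ?a > (0::real)" and W: "\<forall>v. vf (W v)"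
      "\<forall>v. \<forall>z\<in>ran_chart c. field_comp A c (W v) z = \<psi> z *\<^sub>R (v :: real^'n)"
      by (rule field_germ[OF c x]) (rule that)
    have Wb: "vf (W b)" using W(1) by blast
    let ?U = "\<lambda>i. Ys[i := nabla (W b) (Ys ! i)]"
    have U: "length (?U i) = j + 3" "\<forall>Y\<in>set (?U i). vf Y" if i: "i < length Ys" for i
    proof -
      have "vf (Ys ! i)" using Ys i by simp
      then show "\<forall>Y\<in>set (?U i). vf Y" by (intro set_update_vf[OF tensorial_curvature_deriv] Ys nabla_vf Wb)
    qed (simp add: len)
    \<comment> \<open>This is \<open>\<psi>\<close> times the derivative of \<open>?f\<close> in the
      direction \<open>b\<close>, solved for in the definition of the next covariant derivative and
      the coordinate formula of \<open>nabla\<close>. Each of its summands falls under the induction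
      hypothesis for \<open>k\<close>.\<close>
    let ?h = "\<lambda>z. field_comp A c (curvature_deriv A nabla (Suc j) (Ys @ [W b])) z
        + (\<Sum>i<length Ys. field_comp A c (?T (?U i)) z) - gam c z (\<psi> z *\<^sub>R b) (?f z)"
    have cont: "continuous (at ?a) g" if "smooth_on (ran_chart c) g" for g :: "real^'n \<Rightarrow> 'z::real_normed_vector"
      using smooth_on_continuous[OF that] continuous_on_eq_continuous_at[OF oc] a by blast
    have vf0: "vanish_order ?a k ?f" by (rule Suc.IH[OF len Ys])
    have "vanish_order ?a k ?h"
    proof (intro vanish_order_diff vanish_order_add vanish_order_sum)
      show "vanish_order ?a k (field_comp A c (curvature_deriv A nabla (Suc j) (Ys @ [W b])))"
        by (rule Suc.IH) (use len Ys Wb in auto)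
      show "vanish_order ?a k (field_comp A c (?T (?U i)))" if "i \<in> {..<length Ys}" for i
        by (rule Suc.IH[OF U]) (use that in auto)
      show "vanish_order ?a k (\<lambda>z. gam c z (\<psi> z *\<^sub>R b) (?f z))"
      proof (rule vanish_order_bounded[OF vf0])
        show "continuous (at ?a) (\<lambda>z. (\<Sum>i\<in>UNIV. \<Sum>j\<in>UNIV. norm (christ c i j z)) * norm (\<psi> z *\<^sub>R b))"
          by (intro continuous_mult continuous_sum continuous_norm continuous_scaleR continuous_const
              cont \<psi>(1) christ_smooth[OF c])
        show "\<forall>\<^sub>F z in nhds ?a. norm (gam c z (\<psi> z *\<^sub>R b) (?f z))
            \<le> (\<Sum>i\<in>UNIV. \<Sum>j\<in>UNIV. norm (christ c i j z)) * norm (\<psi> z *\<^sub>R b) * norm (?f z)"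
          unfolding coeff_sys_def by (intro always_eventually allI double_sum_bound order_refl)
      qed
    qed
    then show "vanish_order ?a k (\<lambda>z. frechet_derivative ?f (at z) b)"
    proof (rule vanish_order_divide[where \<psi>=\<psi>])
      show "continuous (at ?a) \<psi>" by (rule cont[OF \<psi>(1)])
      show "\<psi> ?a > 0" by (rule \<psi>(2))
      have "\<psi> z *\<^sub>R frechet_derivative ?f (at z) b = ?h z" if z: "z \<in> ran_chart c" for z
      proof -
        have Wz: "field_comp A c (W b) z = \<psi> z *\<^sub>R b" using W(2) z by blast
        have "field_comp A c (nabla (W b) (?T Ys)) z = \<psi> z *\<^sub>R frechet_derivative ?f (at z) b + gam c z (\<psi> z *\<^sub>R b) (?f z)"
          unfolding nabla_comp[OF c Wb vT z] Wz
          by (simp add: linear_scale[OF linear_frechet_derivative[OF smooth_on_differentiable[OF sm z]]])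
        moreover have "field_comp A c (curvature_deriv A nabla (Suc j) (Ys @ [W b])) z
          = field_comp A c (nabla (W b) (?T Ys)) z - (\<Sum>i<length Ys. field_comp A c (?T (?U i)) z)"
          unfolding curvature_deriv_Suc cov_deriv_snoc field_comp_diff[OF c z] field_comp_sum[OF c z] ..
        ultimately show ?thesis by simp
      qed
      then show "\<forall>\<^sub>F z in nhds ?a. \<psi> z *\<^sub>R frechet_derivative ?f (at z) b = ?h z"
        by (rule eventually_mono[OF eventually_nhds_in_open[OF oc a]])
    qed
  qed
qed

lemma curv_frame_vanish_order:
  assumes c: "c \<in> A" and x: "x \<in> dom_chart c"
  shows "vanish_order (map_chart c x) k (curv_frame c i j l m)"
proof -
  let ?a = "map_chart c x"
  note oc = open_ran[OF c] and a = map_in[OF x]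
  obtain \<psi> W where \<psi>: "smooth_on (ran_chart c) \<psi>" "\<psi> ?a > (0::real)" and W: "\<forall>v. vf (W v)"
    "\<forall>v. \<forall>z\<in>ran_chart c. field_comp A c (W v) z = \<psi> z *\<^sub>R (v :: real^'n)"
    by (rule field_germ[OF c x]) (rule that)
  let ?Ys = "[W (axis i 1), W (axis j 1), W (axis l 1)]"
  let ?f = "field_comp A c (curvature_deriv A nabla 0 ?Ys)"
  have v: "vf (W v)" for v using W(1) by blast
  have "vanish_order ?a k ?f"
    by (rule curvature_deriv_vanish_order[OF c x]) (simp_all add: v)
  then have "vanish_order ?a k (\<lambda>z. ?f z $ m)"
    by (rule vanish_order_bounded[where h="\<lambda>_. 1"]) (auto simp: component_le_norm_cart)
  then show ?thesis
  \<comment> \<open>The third power comes from the three arguments of the curvature, each of which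
    is \<open>\<psi>\<close> times a basis vector.\<close>
  proof (rule vanish_order_divide[where \<psi>="\<lambda>z. \<psi> z ^ 3"])
    have "continuous (at ?a) \<psi>"
      using smooth_on_continuous[OF \<psi>(1)] continuous_on_eq_continuous_at[OF oc] a by blast
    then show "continuous (at ?a) (\<lambda>z. \<psi> z ^ 3)" by (rule continuous_power)
    show "\<psi> ?a ^ 3 > 0" using \<psi>(2) by simp
    have "\<psi> z ^ 3 *\<^sub>R curv_frame c i j l m z = ?f z $ m" if z: "z \<in> ran_chart c" for z
    proof -
      note lin = linear_curv_comp[OF c z]
      have Wz: "field_comp A c (W v) z = \<psi> z *\<^sub>R v" for v using W(2) z by blast
      have "?f z = curv_comp c z (\<psi> z *\<^sub>R axis i 1) (\<psi> z *\<^sub>R axis j 1) (\<psi> z *\<^sub>R axis l 1)"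
        by (simp add: curvature_deriv_def curvature_tensor_def curvature_comp[OF c v v v z] Wz)
      also have "\<dots> = \<psi> z *\<^sub>R \<psi> z *\<^sub>R \<psi> z *\<^sub>R curv_comp c z (axis i 1) (axis j 1) (axis l 1)"
        by (simp only: linear_scale[OF lin(1)] linear_scale[OF lin(2)] linear_scale[OF lin(3)])
      finally show ?thesis by (simp add: curv_frame_eq[OF c z] power3_eq_cube)
    qed
    then show "\<forall>\<^sub>F z in nhds ?a. \<psi> z ^ 3 *\<^sub>R curv_frame c i j l m z = ?f z $ m"
      by (rule eventually_mono[OF eventually_nhds_in_open[OF oc a]])
  qed
qed

lemma flat_everywhere: "flat_at p"
proof -
  \<comment> \<open>Flatness in a neighbourhood is the property to propagate: vanishing at a single
    point would not spread by analyticity.\<close>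
  let ?P = "\<lambda>p. \<exists>U. open U \<and> p \<in> U \<and> (\<forall>q\<in>U. flat_at q)"
  have chart: "?P q" if c: "c \<in> A" and B: "open B" "B \<subseteq> ran_chart c" "q \<in> inv_chart c ` B"
    and 0: "\<And>b i j l m. b \<in> B \<Longrightarrow> curv_frame c i j l m b = 0" for c B q
  proof (intro exI[of _ "inv_chart c ` B"] conjI ballI)
    show "open (inv_chart c ` B)" by (rule open_inv_image[OF c B(1,2)])
    show "q \<in> inv_chart c ` B" by (rule B(3))
    fix r assume "r \<in> inv_chart c ` B"
    then obtain b where b: "b \<in> B" "r = inv_chart c b" by blast
    have bz: "b \<in> ran_chart c" using b(1) B(2) by blast
    have "map_chart c r = b" "r \<in> dom_chart c" using map_inv[OF bz] inv_in[OF bz] b(2) by simp_all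
    then show "flat_at r" using flat_at_iff[OF c, of r] 0[OF b(1)] by simp
  qed
  have Px: "?P x"
  proof -
    define c where "c = chart_at A x"
    have c: "c \<in> A" and xc: "x \<in> dom_chart c" by (simp_all add: c_def chart_at_in in_chart_at)
    let ?a = "map_chart c x"
    obtain r where r: "r > 0" "cball ?a r \<subseteq> ran_chart c" using chart_ball[OF c xc] by blast
    have B: "ball ?a r \<subseteq> ran_chart c" using r(2) ball_subset_cball by blast
    have aB: "?a \<in> ball ?a r" using r(1) by simp
    show ?thesis
    proof (rule chart[OF c open_ball B])
      show "x \<in> inv_chart c ` ball ?a r" by (rule image_eqI[of x "inv_chart c" ?a, OF inv_map[OF c xc, symmetric] aB])
      fix b i j l m assume b: "b \<in> ball ?a r"
      let ?\<phi> = "\<lambda>t. curv_frame c i j l m (?a + t *\<^sub>R (b - ?a))"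
      obtain F where F: "?\<phi> has_fps_expansion F" using curv_frame_line[OF c map_in[OF xc]] by (rule exE)
      show "curv_frame c i j l m b = 0"
      proof (rule curv_frame_propagate[OF c convex_ball B aB b])
        show "\<forall>\<^sub>F t in nhds 0. ?\<phi> t = 0"
        proof (rule fps_expansion_flat_zero[OF F])
          fix k
          obtain C where C: "C \<ge> 0" "\<forall>\<^sub>F z in nhds ?a. norm (curv_frame c i j l m z) \<le> C * norm (z - ?a) ^ k"
            by (rule vanish_orderE[OF curv_frame_vanish_order[OF c xc]])
          have "((\<lambda>t. ?a + t *\<^sub>R (b - ?a)) \<longlongrightarrow> ?a + 0 *\<^sub>R (b - ?a)) (nhds 0)" by (intro tendsto_intros filterlim_ident)
          then have "filterlim (\<lambda>t. ?a + t *\<^sub>R (b - ?a)) (nhds ?a) (nhds 0)" by simp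
          from eventually_compose_filterlim[OF C(2) this]
          have "\<forall>\<^sub>F t in nhds 0. \<bar>?\<phi> t\<bar> \<le> (C * norm (b - ?a) ^ k) * \<bar>t\<bar> ^ k"
            by (simp add: power_mult_distrib mult_ac)
          then show "\<exists>C. \<forall>\<^sub>F t in nhds 0. \<bar>?\<phi> t\<bar> \<le> C * \<bar>t\<bar> ^ k" by (rule exI)
        qed
      qed
    qed
  qed
  have "?P p"
  proof (rule connected_induction_simple[OF conn, of x p ?P])
    fix q :: 'm
    define c where "c = chart_at A q"
    have c: "c \<in> A" and qc: "q \<in> dom_chart c" by (simp_all add: c_def chart_at_in in_chart_at)
    let ?a = "map_chart c q"
    obtain r where r: "r > 0" "cball ?a r \<subseteq> ran_chart c" using chart_ball[OF c qc] by blast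
    let ?B = "ball ?a r"
    have B: "?B \<subseteq> ran_chart c" using r(2) ball_subset_cball by blast
    let ?T = "inv_chart c ` ?B"
    have oT: "open ?T" by (rule open_inv_image[OF c open_ball B])
    \<comment> \<open>On the segment from the coordinates \<open>y\<close> of \<open>s\<close> to
      any \<open>b\<close> in the ball, the components vanish for small parameters, hence up to
      \<open>b\<close>.\<close>
    have step: "?P s'" if s: "s \<in> ?T" "s' \<in> ?T" "?P s" for s s'
    proof (rule chart[OF c open_ball B s(2)])
      fix b i j l m assume b: "b \<in> ?B"
      obtain y where y: "y \<in> ?B" "s = inv_chart c y" using s(1) by blast
      have yz: "y \<in> ran_chart c" using y(1) B by blast
      obtain U where U: "open U" "s \<in> U" "\<forall>q\<in>U. flat_at q" using s(3) by (elim exE conjE) (rule that)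
      have "y \<in> overlap c U" using yz y(2) U(2) by (simp add: overlap_def)
      moreover have "open (overlap c U)" by (rule open_overlap[OF c U(1)])
      ultimately have "\<forall>\<^sub>F z in nhds y. z \<in> overlap c U" by (intro eventually_nhds_in_open)
      moreover have "((\<lambda>t. y + t *\<^sub>R (b - y)) \<longlongrightarrow> y + 0 *\<^sub>R (b - y)) (nhds 0)" by (intro tendsto_intros filterlim_ident)
      then have "filterlim (\<lambda>t. y + t *\<^sub>R (b - y)) (nhds y) (nhds 0)" by simp
      ultimately have "\<forall>\<^sub>F t in nhds 0. y + t *\<^sub>R (b - y) \<in> overlap c U" by (rule eventually_compose_filterlim)
      then have "\<forall>\<^sub>F t in nhds 0. curv_frame c i j l m (y + t *\<^sub>R (b - y)) = 0"
      proof (rule eventually_mono)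
        fix t assume "y + t *\<^sub>R (b - y) \<in> overlap c U"
        then have z: "y + t *\<^sub>R (b - y) \<in> ran_chart c" "inv_chart c (y + t *\<^sub>R (b - y)) \<in> U"
          by (simp_all add: overlap_def)
        have "flat_at (inv_chart c (y + t *\<^sub>R (b - y)))" using U(3) z(2) by blast
        then show "curv_frame c i j l m (y + t *\<^sub>R (b - y)) = 0"
          using flat_at_iff[OF c inv_in[OF z(1)]] map_inv[OF z(1)] by simp
      qed
      then show "curv_frame c i j l m b = 0" by (rule curv_frame_propagate[OF c convex_ball B y(1) b])
    qed
    have qT: "q \<in> ?T" using r(1) by (intro image_eqI[of q "inv_chart c" ?a, OF inv_map[OF c qc, symmetric]]) simp
    have "\<forall>s\<in>?T. \<forall>s'\<in>?T. ?P s \<longrightarrow> ?P s'" by (intro ballI impI) (rule step)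
    then show "\<exists>T. openin (top_of_set UNIV) T \<and> q \<in> T \<and> (\<forall>s\<in>T. \<forall>s'\<in>T. ?P s \<longrightarrow> ?P s')"
      using oT qT by (intro exI[of _ ?T] conjI) simp_all
  qed (simp_all only: UNIV_I Px)
  then obtain U where "p \<in> U" "\<forall>q\<in>U. flat_at q" by (elim exE conjE) (rule that)
  then show ?thesis by blast
qed

end

end

section \<open>Parallel covectors and the metric\<close>

text \<open>For fixed \<open>z\<close> and \<open>u\<close>, the transpose of the map given by
  \<open>c\<close>. It has no minus sign because the equation for a parallel covector is
  \<open>d\<theta>(Y) = \<theta>(\<nabla>Y)\<close>, with the Christoffel term on the right.\<close>

definition adj_coeff :: "('n::finite \<Rightarrow> 'n \<Rightarrow> 'a \<Rightarrow> real^'n) \<Rightarrow> 'n \<Rightarrow> 'n \<Rightarrow> 'a \<Rightarrow> real^'n" where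
  "adj_coeff c i j z = (\<chi> k. c i k z $ j)"

lemma coeff_sys_adj: "coeff_sys (adj_coeff c) z u \<eta> \<bullet> v = \<eta> \<bullet> coeff_sys c z u v"
proof -
  have "coeff_sys (adj_coeff c) z u \<eta> \<bullet> v = (\<Sum>i\<in>UNIV. \<Sum>j\<in>UNIV. \<Sum>k\<in>UNIV. u $ i * \<eta> $ j * (c i k z $ j * v $ k))"
  proof -
    have "adj_coeff c i j z \<bullet> v = (\<Sum>k\<in>UNIV. c i k z $ j * v $ k)" for i j
      by (simp add: inner_vec_def adj_coeff_def)
    then show ?thesis by (simp add: coeff_sys_def inner_sum_left sum_distrib_left)
  qed
  also have "\<dots> = (\<Sum>i\<in>UNIV. \<Sum>k\<in>UNIV. \<Sum>j\<in>UNIV. u $ i * \<eta> $ j * (c i k z $ j * v $ k))"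
    by (intro sum.cong refl sum.swap)
  also have "\<dots> = \<eta> \<bullet> coeff_sys c z u v"
  proof -
    have "\<eta> \<bullet> coeff_sys c z u v = (\<Sum>i\<in>UNIV. \<Sum>k\<in>UNIV. (u $ i * v $ k) * (\<eta> \<bullet> c i k z))"
      by (simp add: coeff_sys_def inner_sum_right)
    then show ?thesis by (simp add: inner_vec_def sum_distrib_left mult_ac)
  qed
  finally show ?thesis .
qed

lemma adj_coeff_smooth:
  assumes "open S" "\<And>i j. smooth_on S (c i j)" shows "smooth_on S (adj_coeff c i j)"
  by (rule smooth_on_vecI[OF assms(1)]) (simp add: adj_coeff_def smooth_on_nth assms)

lemma coeff_sys_deriv_adj:
  assumes S: "open S" "z \<in> S" and c: "\<And>i j. smooth_on S (c i j)"
  shows "coeff_sys_deriv (adj_coeff c) z h u \<eta> \<bullet> v = \<eta> \<bullet> coeff_sys_deriv c z h u v"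
proof -
  have "frechet_derivative (adj_coeff c i j) (at z) h = adj_coeff (\<lambda>i j z. frechet_derivative (c i j) (at z) h) i j z" for i j
  proof (rule vec_eq_iff[THEN iffD2], rule allI)
    fix k
    have "frechet_derivative (adj_coeff c i j) (at z) h $ k = frechet_derivative (\<lambda>y. adj_coeff c i j y $ k) (at z) h"
      by (rule frechet_linear_compose[OF bounded_linear_vec_nth smooth_on_differentiable[OF adj_coeff_smooth[OF S(1) c] S(2)], symmetric])
    also have "\<dots> = frechet_derivative (\<lambda>y. c i k y $ j) (at z) h" by (simp add: adj_coeff_def)
    also have "\<dots> = frechet_derivative (c i k) (at z) h $ j"
      by (rule frechet_linear_compose[OF bounded_linear_vec_nth smooth_on_differentiable[OF c S(2)]])
    finally show "frechet_derivative (adj_coeff c i j) (at z) h $ k = adj_coeff (\<lambda>i j z. frechet_derivative (c i j) (at z) h) i j z $ k"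
      by (simp add: adj_coeff_def)
  qed
  then show ?thesis
    using coeff_sys_adj[of "\<lambda>i j z. frechet_derivative (c i j) (at z) h" z u \<eta> v]
    by (simp add: coeff_sys_def coeff_sys_deriv_def)
qed

text \<open>The derivative of a solution is polynomial in the coefficients and the solution itself,
  so each order of differentiability yields the next.\<close>

lemma Ck_on_coeff_solution:
  fixes c :: "'n::finite \<Rightarrow> 'n \<Rightarrow> real^'n \<Rightarrow> real^'n"
  assumes S: "open S" and c: "\<And>i j. smooth_on S (c i j)"
    and \<eta>: "\<And>z. z \<in> S \<Longrightarrow> (\<eta> has_derivative (\<lambda>u. coeff_sys c z u (\<eta> z))) (at z)"
  shows "Ck_on k S \<eta>"
proof (induction k)
  case 0
  have "continuous (at z) \<eta>" if "z \<in> S" for z by (rule has_derivative_continuous[OF \<eta>[OF that]])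
  then show ?case by (simp add: continuous_at_imp_continuous_on)
next
  case (Suc k)
  have ck: "Ck_on k S (c i j)" for i j using c by (simp add: smooth_on_def)
  show ?case
  proof (rule Ck_on_SucI[OF S \<eta>])
    fix v
    show "Ck_on k S (\<lambda>z. coeff_sys c z v (\<eta> z))"
      unfolding coeff_sys_def
      by (intro Ck_on_sum Ck_on_bilinear[OF bounded_bilinear_scaleR] Ck_on_bilinear[OF bounded_bilinear_mult]
          Ck_on_const Ck_on_linear_compose[OF bounded_linear_vec_nth] S Suc ck)
  qed
qed

context connection_manifold
begin

text \<open>The adjoint of \<open>tangent_vec\<close> makes the inner product of components equal to
  the inner product of the chosen representatives, in every chart; see
  \<open>cov_comp_pair\<close>.\<close>

definition cov_comp :: "('m, 'n) chart \<Rightarrow> ('m \<Rightarrow> real^'n) \<Rightarrow> real^'n \<Rightarrow> real^'n" where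
  "cov_comp c \<theta> z = adjoint (tangent_vec c (inv_chart c z)) (\<theta> (inv_chart c z))"

text \<open>
  A covector field is represented, like a vector field, in the charts chosen by \<open>chart_at\<close>, its
  value on a tangent vector being the inner product.
\<close>

definition parallel_at :: "'m \<Rightarrow> ('m \<Rightarrow> real^'n) \<Rightarrow> bool" where
  "parallel_at p \<theta> \<longleftrightarrow> (\<forall>Y. vf Y \<longrightarrow>
     ((\<lambda>q. \<theta> q \<bullet> Y q) \<circ> inv_chart (chart_at A p)) differentiable (at (map_chart (chart_at A p) p)) \<and>
     (\<forall>X. vf X \<longrightarrow> field_deriv A X (\<lambda>q. \<theta> q \<bullet> Y q) p = \<theta> p \<bullet> nabla X Y p))"

lemma cov_comp_pair:
  assumes "c \<in> A" "z \<in> ran_chart c"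
  shows "cov_comp c \<theta> z \<bullet> field_comp A c Y z = \<theta> (inv_chart c z) \<bullet> Y (inv_chart c z)"
proof -
  note p = inv_in[OF assms(2)]
  show ?thesis
    unfolding cov_comp_def field_comp_def
    by (subst inner_commute)
       (simp add: adjoint_works[OF linear_tangent_vec[OF assms(1) p]] tangent_vec_comp[OF assms(1) p] inner_commute)
qed

lemma cov_comp_add: "c \<in> A \<Longrightarrow> z \<in> ran_chart c \<Longrightarrow>
    cov_comp c (\<lambda>q. \<theta> q + \<theta>' q) z = cov_comp c \<theta> z + cov_comp c \<theta>' z"
  by (simp add: cov_comp_def linear_add[OF adjoint_linear[OF linear_tangent_vec]] inv_in)

lemma cov_comp_scale: "c \<in> A \<Longrightarrow> z \<in> ran_chart c \<Longrightarrow>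
    cov_comp c (\<lambda>q. k *\<^sub>R \<theta> q) z = k *\<^sub>R cov_comp c \<theta> z"
  by (simp add: cov_comp_def linear_scale[OF adjoint_linear[OF linear_tangent_vec]] inv_in)

lemma adjoint_tangent:
  assumes "c \<in> A" "q \<in> dom_chart c"
  shows "adjoint (tangent_comp A c q) (adjoint (tangent_vec c q) v) = v"
    "adjoint (tangent_vec c q) (adjoint (tangent_comp A c q) v) = v"
proof -
  note lc = linear_tangent_comp[OF assms] and lv = linear_tangent_vec[OF assms]
  show "adjoint (tangent_comp A c q) (adjoint (tangent_vec c q) v) = v"
    by (rule vector_eq_ldot[THEN iffD1]) (simp add: adjoint_works[OF lc] adjoint_works[OF lv] tangent_vec_comp[OF assms])
  show "adjoint (tangent_vec c q) (adjoint (tangent_comp A c q) v) = v"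
    by (rule vector_eq_ldot[THEN iffD1]) (simp add: adjoint_works[OF lc] adjoint_works[OF lv] tangent_comp_vec[OF assms])
qed

abbreviation cov_sys :: "('m, 'n) chart \<Rightarrow> real^'n \<Rightarrow> real^'n \<Rightarrow> real^'n \<Rightarrow> real^'n" where
  "cov_sys c \<equiv> coeff_sys (adj_coeff (christ c))"

text \<open>Parallelism prescribes the derivative along fields. As every vector \<open>u\<close>
  occurs as the components of some field at \<open>p\<close>, the whole linear map is
  determined.\<close>

lemma parallel_chart_derivative:
  assumes c: "c \<in> A" and p: "p \<in> dom_chart c" and par: "parallel_at p \<theta>" and Y: "vf Y"
  shows "(((\<lambda>q. \<theta> q \<bullet> Y q) \<circ> inv_chart c) has_derivative
    (\<lambda>u. cov_comp c \<theta> (map_chart c p) \<bullet> (frechet_derivative (field_comp A c Y) (at (map_chart c p)) u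
        + gam c (map_chart c p) u (field_comp A c Y (map_chart c p))))) (at (map_chart c p))"
proof -
  let ?z = "map_chart c p" and ?f = "\<lambda>q. \<theta> q \<bullet> Y q"
  note z = map_in[OF p]
  have "(?f \<circ> inv_chart (chart_at A p)) differentiable (at (map_chart (chart_at A p) p))"
    using par Y by (simp add: parallel_at_def)
  from chain_inv[OF chart_at_in c in_chart_at p has_derivative_frechet[OF this]]
  obtain D where D: "((?f \<circ> inv_chart c) has_derivative D) (at ?z)" by (rule that)
  have "D u = cov_comp c \<theta> ?z \<bullet> (frechet_derivative (field_comp A c Y) (at ?z) u + gam c ?z u (field_comp A c Y ?z))" for u
  proof -
    obtain X where X: "vf X" "field_comp A c X ?z = u" by (rule field_with_comp[OF c p])
    have "D u = field_deriv A X ?f p"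
      using field_deriv_chart[OF c p D, of X] X(2) by (simp add: field_comp_at[OF c p])
    also have "\<dots> = \<theta> p \<bullet> nabla X Y p" using par Y X(1) by (simp add: parallel_at_def)
    also have "\<dots> = cov_comp c \<theta> ?z \<bullet> field_comp A c (nabla X Y) ?z"
      using cov_comp_pair[OF c z, of \<theta> "nabla X Y"] by (simp add: inv_map[OF c p])
    finally show ?thesis unfolding nabla_comp[OF c X(1) Y z] X(2) .
  qed
  then have "D = (\<lambda>u. cov_comp c \<theta> ?z \<bullet> (frechet_derivative (field_comp A c Y) (at ?z) u + gam c ?z u (field_comp A c Y ?z)))"
    by (rule ext)
  then show ?thesis using D by simp
qed

text \<open>Turns the invariant notion into a total differential equation for the components in any
  one chart.\<close>

lemma parallel_chart:
  assumes c: "c \<in> A" and p: "p \<in> dom_chart c"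
  shows "parallel_at p \<theta> \<longleftrightarrow>
    (cov_comp c \<theta> has_derivative (\<lambda>u. cov_sys c (map_chart c p) u (cov_comp c \<theta> (map_chart c p)))) (at (map_chart c p))"
proof
  let ?z = "map_chart c p"
  let ?\<eta> = "cov_comp c \<theta>"
  note z = map_in[OF p] and oc = open_ran[OF c]
  assume par: "parallel_at p \<theta>"
  obtain \<psi> W where \<psi>: "smooth_on (ran_chart c) \<psi>" "\<psi> ?z > (0::real)" and W: "\<forall>v. vf (W v)"
    "\<forall>v. \<forall>z\<in>ran_chart c. field_comp A c (W v) z = \<psi> z *\<^sub>R (v :: real^'n)"
    by (rule field_germ[OF c p]) (rule that)
  note d\<psi> = smooth_on_has_derivative[OF \<psi>(1) z]
  have comp: "((\<lambda>y. ?\<eta> y $ k) has_derivative (\<lambda>u. cov_sys c ?z u (?\<eta> ?z) $ k)) (at ?z)" for k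
  proof -
    let ?e = "axis k (1::real) :: real^'n"
    have We: "vf (W ?e)" using W(1) by (rule spec)
    have Wc: "field_comp A c (W ?e) y = \<psi> y *\<^sub>R ?e" if "y \<in> ran_chart c" for y
      by (rule bspec[OF spec[OF W(2)] that])
    let ?f = "(\<lambda>q. \<theta> q \<bullet> W ?e q) \<circ> inv_chart c"
    have f: "?f y = \<psi> y * ?\<eta> y $ k" if "y \<in> ran_chart c" for y
      using cov_comp_pair[OF c that, of \<theta> "W ?e"] by (simp add: Wc[OF that] inner_axis)
    have "((\<lambda>y. \<psi> y *\<^sub>R ?e) has_derivative (\<lambda>u. frechet_derivative \<psi> (at ?z) u *\<^sub>R ?e)) (at ?z)"
      by (rule has_derivative_scaleR_left[OF d\<psi>])
    then have "(field_comp A c (W ?e) has_derivative (\<lambda>u. frechet_derivative \<psi> (at ?z) u *\<^sub>R ?e)) (at ?z)"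
      by (rule has_derivative_transform_within_open[OF _ oc z]) (simp add: Wc)
    note dW = frechet_eqI[OF this]
    have df: "(?f has_derivative (\<lambda>u. frechet_derivative \<psi> (at ?z) u * ?\<eta> ?z $ k + \<psi> ?z * (cov_sys c ?z u (?\<eta> ?z) $ k))) (at ?z)"
    proof -
      have "cov_sys c ?z u (?\<eta> ?z) $ k = ?\<eta> ?z \<bullet> gam c ?z u ?e" for u
        using coeff_sys_adj[of "christ c" ?z u "?\<eta> ?z" ?e] by (simp add: inner_axis)
      then show ?thesis
        using parallel_chart_derivative[OF c p par We]
        by (simp add: dW Wc[OF z] inner_add_right inner_axis linear_scale[OF linear_coeff_sys2])
    qed
    \<comment> \<open>The test field has components \<open>\<psi>\<close> times a basis vector; the
      quotient rule cancels the derivative of \<open>\<psi>\<close> and leaves the equation for the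
      \<open>k\<close>-th component.\<close>
    have "((\<lambda>y. ?f y / \<psi> y) has_derivative (\<lambda>u. ((frechet_derivative \<psi> (at ?z) u * ?\<eta> ?z $ k + \<psi> ?z * (cov_sys c ?z u (?\<eta> ?z) $ k)) * \<psi> ?z
        - ?f ?z * frechet_derivative \<psi> (at ?z) u) / (\<psi> ?z * \<psi> ?z))) (at ?z)"
      by (rule has_derivative_divide'[OF df d\<psi>]) (use \<psi>(2) in simp)
    moreover have "((frechet_derivative \<psi> (at ?z) u * ?\<eta> ?z $ k + \<psi> ?z * (cov_sys c ?z u (?\<eta> ?z) $ k)) * \<psi> ?z
        - ?f ?z * frechet_derivative \<psi> (at ?z) u) / (\<psi> ?z * \<psi> ?z) = cov_sys c ?z u (?\<eta> ?z) $ k" for u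
      using \<psi>(2) unfolding f[OF z] by (simp add: field_simps)
    ultimately have d: "((\<lambda>y. ?f y / \<psi> y) has_derivative (\<lambda>u. cov_sys c ?z u (?\<eta> ?z) $ k)) (at ?z)" by simp
    have "isCont \<psi> ?z" by (rule has_derivative_continuous[OF d\<psi>])
    then have "\<forall>\<^sub>F y in nhds ?z. \<psi> y > 0"
      using \<psi>(2) by (intro order_tendstoD) (simp_all add: continuous_at tendsto_nhds_iff)
    then obtain U where U: "open U" "?z \<in> U" "\<forall>y\<in>U. \<psi> y > 0" unfolding eventually_nhds by (elim exE conjE) (rule that)
    show ?thesis
    proof (rule has_derivative_transform_within_open[OF d])
      show "open (U \<inter> ran_chart c)" using U oc by (intro open_Int)
      show "?z \<in> U \<inter> ran_chart c" using U z by simp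
      fix y assume y: "y \<in> U \<inter> ran_chart c"
      then have "\<psi> y \<noteq> 0" using U(3) by force
      then show "?f y / \<psi> y = ?\<eta> y $ k" using f[of y] y by simp
    qed
  qed
  show "(?\<eta> has_derivative (\<lambda>u. cov_sys c ?z u (?\<eta> ?z))) (at ?z)"
  proof (rule has_derivative_componentwise_within[THEN iffD2], rule ballI)
    fix b :: "real^'n" assume "b \<in> Basis"
    then obtain k where b: "b = axis k 1" by (auto simp: Basis_vec_def)
    show "((\<lambda>y. ?\<eta> y \<bullet> b) has_derivative (\<lambda>u. cov_sys c ?z u (?\<eta> ?z) \<bullet> b)) (at ?z)"
      using comp[of k] by (simp add: b inner_axis)
  qed
next
  let ?z = "map_chart c p"
  let ?\<eta> = "cov_comp c \<theta>"
  note z = map_in[OF p] and oc = open_ran[OF c]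
  assume d: "(?\<eta> has_derivative (\<lambda>u. cov_sys c ?z u (?\<eta> ?z))) (at ?z)"
  show "parallel_at p \<theta>" unfolding parallel_at_def
  proof (intro allI impI)
    fix Y assume Y: "vf Y"
    let ?f = "\<lambda>q. \<theta> q \<bullet> Y q"
    let ?D = "\<lambda>u. ?\<eta> ?z \<bullet> frechet_derivative (field_comp A c Y) (at ?z) u + cov_sys c ?z u (?\<eta> ?z) \<bullet> field_comp A c Y ?z"
    have "((\<lambda>y. ?\<eta> y \<bullet> field_comp A c Y y) has_derivative ?D) (at ?z)"
      by (rule has_derivative_inner[OF d field_has_derivative[OF c Y z]])
    then have D: "((?f \<circ> inv_chart c) has_derivative ?D) (at ?z)"
      by (rule has_derivative_transform_within_open[OF _ oc z]) (simp add: cov_comp_pair[OF c])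
    have "(?f \<circ> inv_chart (chart_at A p)) differentiable at (map_chart (chart_at A p) p)"
      by (rule differentiableI[OF chain_inv[OF c chart_at_in p in_chart_at D]])
    moreover have "field_deriv A X ?f p = \<theta> p \<bullet> nabla X Y p" if X: "vf X" for X
    proof -
      have "field_deriv A X ?f p = ?D (field_comp A c X ?z)"
        using field_deriv_chart[OF c p D, of X] by (simp add: field_comp_at[OF c p])
      also have "\<dots> = ?\<eta> ?z \<bullet> field_comp A c (nabla X Y) ?z"
        unfolding nabla_comp[OF c X Y z] by (simp add: coeff_sys_adj inner_add_right)
      also have "\<dots> = \<theta> p \<bullet> nabla X Y p"
        using cov_comp_pair[OF c z, of \<theta> "nabla X Y"] by (simp add: inv_map[OF c p])
      finally show ?thesis .
    qed
    ultimately show "(?f \<circ> inv_chart (chart_at A p)) differentiable at (map_chart (chart_at A p) p) \<and>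
       (\<forall>X. vf X \<longrightarrow> field_deriv A X ?f p = \<theta> p \<bullet> nabla X Y p)" by simp
  qed
qed

section \<open>The vector space and the sheaf of parallel covectors\<close>

lemma parallel_add:
  assumes "parallel_at p \<theta>" "parallel_at p \<theta>'" shows "parallel_at p (\<lambda>q. \<theta> q + \<theta>' q)"
proof -
  define c where "c = chart_at A p"
  have c: "c \<in> A" and p: "p \<in> dom_chart c" by (simp_all add: c_def chart_at_in in_chart_at)
  let ?z = "map_chart c p"
  have "((\<lambda>y. cov_comp c \<theta> y + cov_comp c \<theta>' y) has_derivative
     (\<lambda>u. cov_sys c ?z u (cov_comp c \<theta> ?z)
        + cov_sys c ?z u (cov_comp c \<theta>' ?z)))
     (at ?z)"
    using assms unfolding parallel_chart[OF c p] by (rule has_derivative_add)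
  then have "((\<lambda>y. cov_comp c \<theta> y + cov_comp c \<theta>' y) has_derivative
     (\<lambda>u. cov_sys c ?z u (cov_comp c (\<lambda>q. \<theta> q + \<theta>' q) ?z)))
     (at ?z)"
    by (simp add: cov_comp_add[OF c map_in[OF p]] linear_add[OF linear_coeff_sys2])
  then show ?thesis unfolding parallel_chart[OF c p]
    by (rule has_derivative_transform_within_open[OF _ open_ran[OF c] map_in[OF p]]) (simp add: cov_comp_add[OF c])
qed

lemma parallel_scale:
  assumes "parallel_at p \<theta>" shows "parallel_at p (\<lambda>q. k *\<^sub>R \<theta> q)"
proof -
  define c where "c = chart_at A p"
  have c: "c \<in> A" and p: "p \<in> dom_chart c" by (simp_all add: c_def chart_at_in in_chart_at)
  let ?z = "map_chart c p"
  have "((\<lambda>y. k *\<^sub>R cov_comp c \<theta> y) has_derivative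
     (\<lambda>u. k *\<^sub>R cov_sys c ?z u (cov_comp c \<theta> ?z)))
     (at ?z)"
    using assms unfolding parallel_chart[OF c p] by (rule has_derivative_scaleR_right)
  then have "((\<lambda>y. k *\<^sub>R cov_comp c \<theta> y) has_derivative
     (\<lambda>u. cov_sys c ?z u (cov_comp c (\<lambda>q. k *\<^sub>R \<theta> q) ?z)))
     (at ?z)"
    by (simp add: cov_comp_scale[OF c map_in[OF p]] linear_scale[OF linear_coeff_sys2])
  then show ?thesis unfolding parallel_chart[OF c p]
    by (rule has_derivative_transform_within_open[OF _ open_ran[OF c] map_in[OF p]]) (simp add: cov_comp_scale[OF c])
qed

lemma parallel_zero: "parallel_at p (\<lambda>q. 0)"
proof -
  define c where "c = chart_at A p"
  have c: "c \<in> A" and p: "p \<in> dom_chart c" by (simp_all add: c_def chart_at_in in_chart_at)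
  let ?z = "map_chart c p"
  have "cov_comp c (\<lambda>q. 0) z = 0" if "z \<in> ran_chart c" for z
    using cov_comp_scale[OF c that, of 0 "\<lambda>_. 0"] by simp
  note 0 = this
  have "((\<lambda>y. 0) has_derivative (\<lambda>u. cov_sys c ?z u (cov_comp c (\<lambda>q. 0) ?z)))
     (at ?z)"
    by (simp add: 0[OF map_in[OF p]] linear_0[OF linear_coeff_sys2])
  then show ?thesis unfolding parallel_chart[OF c p]
    by (rule has_derivative_transform_within_open[OF _ open_ran[OF c] map_in[OF p]]) (simp add: 0)
qed

lemma parallel_sum:
  "(\<And>i. i \<in> I \<Longrightarrow> parallel_at p (\<theta> i)) \<Longrightarrow> parallel_at p (\<lambda>q. \<Sum>i\<in>I. \<theta> i q)"
  by (induction I rule: infinite_finite_induct) (auto intro: parallel_zero parallel_add)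

lemma parallel_comp_smooth:
  assumes c: "c \<in> A" and par: "\<And>p. parallel_at p \<theta>" shows "smooth_on (ran_chart c) (cov_comp c \<theta>)"
  unfolding smooth_on_def
proof
  fix k
  show "Ck_on k (ran_chart c) (cov_comp c \<theta>)"
  proof (rule Ck_on_coeff_solution[OF open_ran[OF c], of "adj_coeff (christ c)"])
    show "smooth_on (ran_chart c) (adj_coeff (christ c) i j)" for i j
      by (rule adj_coeff_smooth[OF open_ran[OF c] christ_smooth[OF c]])
    fix z assume z: "z \<in> ran_chart c"
    show "(cov_comp c \<theta> has_derivative (\<lambda>u. cov_sys c z u (cov_comp c \<theta> z))) (at z)"
      using par[of "inv_chart c z"] unfolding parallel_chart[OF c inv_in[OF z]] map_inv[OF z] .
  qed
qed

lemma parallel_germ: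
  assumes U: "open U" "p \<in> U" and eq: "\<And>q. q \<in> U \<Longrightarrow> \<theta> q = \<theta>' q" and par: "parallel_at p \<theta>"
  shows "parallel_at p \<theta>'"
proof -
  define c where "c = chart_at A p"
  have c: "c \<in> A" and p: "p \<in> dom_chart c" by (simp_all add: c_def chart_at_in in_chart_at)
  let ?z = "map_chart c p"
  have e: "cov_comp c \<theta> z = cov_comp c \<theta>' z" if "z \<in> overlap c U" for z
    using that eq by (simp add: overlap_def cov_comp_def)
  note z = overlap_mem[OF c p U(2)]
  have "(cov_comp c \<theta> has_derivative
      (\<lambda>u. cov_sys c ?z u (cov_comp c \<theta>' ?z)))
      (at ?z)"
    using par unfolding parallel_chart[OF c p] e[OF z] .
  then show ?thesis unfolding parallel_chart[OF c p]
    by (rule has_derivative_transform_within_open[OF _ open_overlap[OF c U(1)] z e])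
qed

lemma parallel_good:
  assumes flat: "\<And>p. flat_at p" and N: "open N" "p \<in> N"
  shows "\<exists>U. p \<in> U \<and> U \<subseteq> N \<and> good_nbhd parallel_at U"
proof -
  define c where "c = chart_at A p"
  have c: "c \<in> A" and p: "p \<in> dom_chart c" by (simp_all add: c_def chart_at_in in_chart_at)
  let ?a = "map_chart c p"
  let ?S = "overlap c N"
  let ?t = "adj_coeff (christ c)"
  have S: "open ?S" "?a \<in> ?S" using open_overlap[OF c N(1)] overlap_mem[OF c p N(2)] by simp_all
  have SR: "?S \<subseteq> ran_chart c" by (auto simp: overlap_def)
  have ts: "smooth_on ?S (?t i j)" for i j
    by (rule smooth_on_subset[OF adj_coeff_smooth[OF open_ran[OF c] christ_smooth[OF c]] SR])
  have fl: "coeff_sys ?t z u (coeff_sys ?t z h v) - coeff_sys ?t z h (coeff_sys ?t z u v)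
       + coeff_sys_deriv ?t z h u v - coeff_sys_deriv ?t z u h v = 0" if zS: "z \<in> ?S" for z h u v
  proof -
    have z: "z \<in> ran_chart c" using zS SR by blast
    \<comment> \<open>Transposition reverses the order of composition, which is why the curvature
      occurs with \<open>h\<close> before \<open>u\<close>: paired with \<open>w\<close>, the
      integrability condition is \<open>v \<bullet> curv_comp c z h u w = 0\<close>.\<close>
    have "curv_comp c z h u w = 0" for w
    proof (rule curv_comp_zero[OF c z])
      show "curv_frame c i j l m z = 0" for i j l m
        using flat[of "inv_chart c z"] unfolding flat_at_iff[OF c inv_in[OF z]] map_inv[OF z] by blast
    qed
    then have "(coeff_sys ?t z u (coeff_sys ?t z h v) - coeff_sys ?t z h (coeff_sys ?t z u v)
       + coeff_sys_deriv ?t z h u v - coeff_sys_deriv ?t z u h v) \<bullet> w = 0" for w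
      by (simp add: inner_diff_left inner_add_left coeff_sys_adj
          coeff_sys_deriv_adj[OF open_ran[OF c] z christ_smooth[OF c]] curv_comp_def
          inner_diff_right[symmetric] inner_add_right[symmetric] algebra_simps del: inner_diff_right inner_add_right)
    then show ?thesis using inner_eq_zero_iff by blast
  qed
  have "\<exists>r>0. ball ?a r \<subseteq> ?S \<and> (\<exists>M M' C. flat_system (ball ?a r) (coeff_sys ?t) (coeff_sys_deriv ?t) M M' C)"
    by (rule flat_system_ball[OF S ts]) (rule fl)
  then obtain r M M' C where r: "r > 0" "ball ?a r \<subseteq> ?S"
    and fs: "flat_system (ball ?a r) (coeff_sys ?t) (coeff_sys_deriv ?t) M M' C"
    by (elim exE conjE) (rule that)
  let ?B = "ball ?a r"
  interpret fs: flat_system ?B "coeff_sys ?t" "coeff_sys_deriv ?t" M M' C by (rule fs)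
  have BR: "?B \<subseteq> ran_chart c" using r(2) SR by blast
  let ?U = "inv_chart c ` ?B"
  have mem: "q \<in> dom_chart c" "map_chart c q \<in> ?B" if qU: "q \<in> ?U" for q
  proof -
    obtain z where z: "z \<in> ?B" "q = inv_chart c z" using qU by blast
    have zr: "z \<in> ran_chart c" using z(1) BR by blast
    show "q \<in> dom_chart c" "map_chart c q \<in> ?B" using z inv_in[OF zr] map_inv[OF zr] by simp_all
  qed
  have sol: "section_on parallel_at ?U \<theta> \<longleftrightarrow> fs.solves ?B (cov_comp c \<theta>)" for \<theta>
    unfolding section_on_def fs.solves_def
  proof (intro iffI ballI)
    fix z assume par: "\<forall>r\<in>?U. parallel_at r \<theta>" and z: "z \<in> ?B"
    have zr: "z \<in> ran_chart c" using z BR by blast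
    have "parallel_at (inv_chart c z) \<theta>" using par z by blast
    then show "(cov_comp c \<theta> has_derivative (\<lambda>u. cov_sys c z u (cov_comp c \<theta> z))) (at z)"
      unfolding parallel_chart[OF c inv_in[OF zr]] map_inv[OF zr] .
  next
    fix q assume s: "\<forall>z\<in>?B. (cov_comp c \<theta> has_derivative (\<lambda>u. cov_sys c z u (cov_comp c \<theta> z))) (at z)" and q: "q \<in> ?U"
    show "parallel_at q \<theta>" unfolding parallel_chart[OF c mem(1)[OF q]] by (rule bspec[OF s mem(2)[OF q]])
  qed
  have "good_nbhd parallel_at ?U" unfolding good_nbhd_def
  proof (intro conjI ballI allI impI)
    show "open ?U" by (rule open_inv_image[OF c open_ball BR])
    show "path_connected ?U"
      by (rule path_connected_continuous_image[OF continuous_on_subset[OF homeomorphism_cont2[OF chart_hom[OF c]] BR]])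
         (simp add: convex_imp_path_connected)
    fix q and v :: "real^'n" assume q: "q \<in> ?U"
    obtain \<eta> where \<eta>: "\<eta> (map_chart c q) = adjoint (tangent_vec c q) v" "fs.solves ?B \<eta>"
      using fs.solves_exists[OF mem(2)[OF q], of "adjoint (tangent_vec c q) v"] by (elim exE conjE) (rule that)
    \<comment> \<open>The covector field whose components in \<open>c\<close> are
      \<open>\<eta>\<close>; the two adjoints are inverse to each other.\<close>
    define \<theta> where "\<theta> s = adjoint (tangent_comp A c s) (\<eta> (map_chart c s))" for s
    have ce: "cov_comp c \<theta> z = \<eta> z" if "z \<in> ran_chart c" for z
      using adjoint_tangent(2)[OF c inv_in[OF that]] by (simp add: cov_comp_def \<theta>_def map_inv[OF that])
    have "fs.solves ?B (cov_comp c \<theta>)" unfolding fs.solves_def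
    proof
      fix z assume z: "z \<in> ?B"
      then have zr: "z \<in> ran_chart c" using BR by blast
      have "(\<eta> has_derivative (\<lambda>u. cov_sys c z u (\<eta> z))) (at z)" using \<eta>(2) z by (simp add: fs.solves_def)
      then show "(cov_comp c \<theta> has_derivative (\<lambda>u. cov_sys c z u (cov_comp c \<theta> z))) (at z)"
        unfolding ce[OF zr] by (rule has_derivative_transform_within_open[OF _ open_ran[OF c] zr]) (rule ce[symmetric])
    qed
    then have "section_on parallel_at ?U \<theta>" by (simp only: sol)
    moreover have "\<theta> q = v" by (simp add: \<theta>_def \<eta>(1) adjoint_tangent(1)[OF c mem(1)[OF q]])
    ultimately show "\<exists>\<theta>. \<theta> q = v \<and> section_on parallel_at ?U \<theta>" by (intro exI[of _ \<theta>] conjI)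
  next
    fix \<theta> \<theta>' q s
    assume s: "section_on parallel_at ?U \<theta>" "section_on parallel_at ?U \<theta>'" and q: "q \<in> ?U" and s': "s \<in> ?U" and eq: "\<theta> q = \<theta>' q"
    have "cov_comp c \<theta> (map_chart c q) = cov_comp c \<theta>' (map_chart c q)"
      using eq by (simp add: cov_comp_def inv_map[OF c mem(1)[OF q]])
    then have "cov_comp c \<theta> (map_chart c s) = cov_comp c \<theta>' (map_chart c s)"
      by (rule fs.solves_unique[OF s[unfolded sol] mem(2)[OF q] mem(2)[OF s']])
    then have "adjoint (tangent_vec c s) (\<theta> s) = adjoint (tangent_vec c s) (\<theta>' s)"
      by (simp add: cov_comp_def inv_map[OF c mem(1)[OF s']])
    then have "adjoint (tangent_comp A c s) (adjoint (tangent_vec c s) (\<theta> s)) = adjoint (tangent_comp A c s) (adjoint (tangent_vec c s) (\<theta>' s))"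
      by (rule arg_cong)
    then show "\<theta> s = \<theta>' s" unfolding adjoint_tangent(1)[OF c mem(1)[OF s']] .
  qed
  moreover have "p \<in> ?U" by (rule image_eqI[of p "inv_chart c" ?a]) (use r(1) inv_map[OF c p] in simp_all)
  moreover have "?U \<subseteq> N"
  proof
    fix q assume "q \<in> ?U"
    then obtain z where "z \<in> ?B" "q = inv_chart c z" by blast
    then show "q \<in> N" using r(2) by (auto simp: overlap_def)
  qed
  ultimately show ?thesis by (intro exI[of _ ?U] conjI)
qed

section \<open>The metric of a parallel coframe\<close>

context
  fixes \<Theta> :: "'n \<Rightarrow> 'm \<Rightarrow> real^'n" and P :: "'n set"
  assumes par: "\<And>k q. parallel_at q (\<Theta> k)"
    and indep: "\<And>q a. (\<Sum>k\<in>UNIV. (a k) *\<^sub>R \<Theta> k q) = 0 \<Longrightarrow> a = (\<lambda>k. 0)"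
begin

definition frame_metric :: "'m \<Rightarrow> real^'n \<Rightarrow> real^'n \<Rightarrow> real" where
  "frame_metric q u v = (\<Sum>k\<in>UNIV. (if k \<in> P then 1 else - 1) * ((\<Theta> k q \<bullet> u) * (\<Theta> k q \<bullet> v)))"

text \<open>In the basis dual to the coframe the metric is diagonal with entries 1 and -1, which
  gives the signature; separation of vectors by the coframe gives nondegeneracy.\<close>

lemma dual_basis:
  obtains b where "inj b" "independent (range b)" "\<forall>k j. \<Theta> k q \<bullet> b j = (if k = j then 1 else 0)"
    "\<forall>u. (\<forall>k. \<Theta> k q \<bullet> u = 0) \<longrightarrow> u = 0"
proof -
  let ?E = "\<lambda>a::real^'n. \<Sum>k\<in>UNIV. (a $ k) *\<^sub>R \<Theta> k q"
  have lE: "linear ?E" by (rule linearI) (simp_all add: scaleR_left_distrib sum.distrib scaleR_sum_right)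
  have "a = 0" if "?E a = 0" for a
    using fun_cong[OF indep[of "\<lambda>k. a $ k" q]] that by (simp add: vec_eq_iff)
  then have "inj ?E" using lE by (simp add: linear_injective_0)
  then have sE: "surj ?E" by (intro linear_injective_imp_surjective[OF lE] refl)
  have sep: "u = 0" if zero: "\<forall>k. \<Theta> k q \<bullet> u = 0" for u
  proof -
    obtain a where a: "u = ?E a" using surjD[OF sE, of u] by (rule exE) (rule that)
    \<comment> \<open>Since the coframe spans, a vector annihilated by all of it is orthogonal to
      itself.\<close>
    have "?E a \<bullet> u = 0" by (simp add: inner_sum_left zero)
    then show ?thesis unfolding a[symmetric] by simp
  qed
  let ?L = "\<lambda>u. \<chi> k. \<Theta> k q \<bullet> u"
  have lL: "linear ?L" by (rule linearI) (simp_all add: vec_eq_iff inner_add_right)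
  have "u = 0" if "?L u = 0" for u
    by (rule sep) (use that in \<open>simp add: vec_eq_iff\<close>)
  then have iL: "inj ?L" using lL by (simp add: linear_injective_0)
  obtain g where g: "linear g" "\<forall>u. g (?L u) = u" "\<forall>a. ?L (g a) = a"
    using linear_injective_isomorphism[OF lL iL refl] by (elim exE conjE) (rule that)
  define b where "b j = g (axis j 1)" for j
  have val: "\<Theta> k q \<bullet> b j = (if k = j then 1 else 0)" for k j
    using spec[OF g(3), of "axis j 1"] by (simp add: vec_eq_iff axis_def b_def)
  have "inj b"
  proof (rule injI)
    fix i j assume "b i = b j"
    then show "i = j" using val[of i i] val[of i j] by (auto split: if_splits)
  qed
  moreover have "independent (range b)"
  proof -
    have ig: "inj g" by (rule inj_on_inverseI[where g="?L"]) (rule spec[OF g(3)])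
    have "independent (g ` Basis)"
      by (rule linear_independent_injective_image[OF g(1) independent_Basis inj_on_subset[OF ig subset_UNIV]])
    moreover have "g ` Basis = range b" by (auto simp: Basis_vec_def b_def)
    ultimately show ?thesis by simp
  qed
  ultimately show ?thesis using val sep by (intro that[of b]) auto
qed

lemma frame_metric_bilinear: "bilinear (frame_metric q)"
  unfolding bilinear_def frame_metric_def
  by (intro conjI allI linearI) (simp_all add: inner_add_right sum.distrib sum_distrib_left algebra_simps)

lemma frame_metric_dual:
  assumes "\<forall>k j. \<Theta> k q \<bullet> b j = (if k = j then 1 else 0)"
  shows "frame_metric q u (b j) = (if j \<in> P then 1 else - 1) * (\<Theta> j q \<bullet> u)"
proof -
  have "frame_metric q u (b j) = (\<Sum>k\<in>UNIV. if k = j then (if j \<in> P then 1 else - 1) * (\<Theta> j q \<bullet> u) else 0)"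
    unfolding frame_metric_def using assms by (intro sum.cong) auto
  then show ?thesis by simp
qed

lemma frame_metric_nondegenerate:
  assumes "\<forall>v. frame_metric q u v = 0" shows "u = 0"
proof -
  obtain b where b: "inj b" "independent (range b)" "\<forall>k j. \<Theta> k q \<bullet> b j = (if k = j then 1 else 0)"
    "\<forall>u. (\<forall>k. \<Theta> k q \<bullet> u = 0) \<longrightarrow> u = 0" by (rule dual_basis) (rule that)
  have "\<Theta> j q \<bullet> u = 0" for j
    using frame_metric_dual[OF b(3), of u j] assms by (auto split: if_splits)
  then show ?thesis using b(4) by simp
qed

lemma frame_metric_signature: "has_signature (frame_metric q) (card P) (card (- P))"
proof -
  obtain b where b: "inj b" "independent (range b)" "\<forall>k j. \<Theta> k q \<bullet> b j = (if k = j then 1 else 0)"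
    "\<forall>u. (\<forall>k. \<Theta> k q \<bullet> u = 0) \<longrightarrow> u = 0" by (rule dual_basis) (rule that)
  show ?thesis unfolding has_signature_def
    by (rule exI[of _ b], rule exI[of _ P]) (use b in \<open>simp add: frame_metric_dual[OF b(3)]\<close>)
qed

lemma frame_metric_smooth:
  assumes X: "vf X" and Y: "vf Y" shows "sf (\<lambda>q. frame_metric q (X q) (Y q))"
  unfolding smooth_function_def
proof
  fix c assume c: "c \<in> A"
  note o = open_ran[OF c]
  have s: "smooth_on (ran_chart c) (\<lambda>z. cov_comp c (\<Theta> k) z \<bullet> field_comp A c V z)" if "vf V" for k V
    by (intro smooth_on_inner o parallel_comp_smooth[OF c par] vf_smooth[OF that c])
  show "smooth_on (ran_chart c) ((\<lambda>q. frame_metric q (X q) (Y q)) \<circ> inv_chart c)"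
  proof (rule smooth_on_cong[OF o])
    show "smooth_on (ran_chart c) (\<lambda>z. \<Sum>k\<in>UNIV. (if k \<in> P then 1 else - 1) *
        ((cov_comp c (\<Theta> k) z \<bullet> field_comp A c X z) * (cov_comp c (\<Theta> k) z \<bullet> field_comp A c Y z)))"
      by (intro smooth_on_sum smooth_on_mult smooth_on_const o s X Y)
  qed (simp add: frame_metric_def cov_comp_pair[OF c])
qed

lemma frame_metric_pseudo_riemannian: "pseudo_riemannian_metric A frame_metric"
  unfolding pseudo_riemannian_metric_def
  using frame_metric_bilinear frame_metric_nondegenerate frame_metric_smooth
  by (auto simp: frame_metric_def mult.commute)

lemma frame_metric_compatible:
  assumes X: "vf X" and Y: "vf Y" and Z: "vf Z"
  shows "field_deriv A X (\<lambda>q. frame_metric q (Y q) (Z q)) p =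
    frame_metric p (nabla X Y p) (Z p) + frame_metric p (Y p) (nabla X Z p)"
proof -
  let ?c = "chart_at A p"
  let ?z = "map_chart ?c p"
  have ip: "inv_chart ?c ?z = p" by (rule inv_map[OF chart_at_in in_chart_at])
  let ?f = "\<lambda>k V. (\<lambda>q. \<Theta> k q \<bullet> V q) \<circ> inv_chart ?c"
  have d: "(?f k V has_derivative frechet_derivative (?f k V) (at ?z)) (at ?z)" if "vf V" for k V
    using par[of p k] that by (intro has_derivative_frechet) (simp add: parallel_at_def)
  have v: "frechet_derivative (?f k V) (at ?z) (X p) = \<Theta> k p \<bullet> nabla X V p" if "vf V" for k V
    using par[of p k] that X by (simp add: parallel_at_def field_deriv_def)
  let ?e = "\<lambda>k. if k \<in> P then 1 else - 1 :: real"
  have "((\<lambda>z. \<Sum>k\<in>UNIV. ?e k * (?f k Y z * ?f k Z z)) has_derivative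
     (\<lambda>h. \<Sum>k\<in>UNIV. ?e k * (?f k Y ?z * frechet_derivative (?f k Z) (at ?z) h + frechet_derivative (?f k Y) (at ?z) h * ?f k Z ?z))) (at ?z)"
    by (intro has_derivative_sum has_derivative_mult_right has_derivative_mult d Y Z)
  then have "(((\<lambda>q. frame_metric q (Y q) (Z q)) \<circ> inv_chart ?c) has_derivative
     (\<lambda>h. \<Sum>k\<in>UNIV. ?e k * (?f k Y ?z * frechet_derivative (?f k Z) (at ?z) h + frechet_derivative (?f k Y) (at ?z) h * ?f k Z ?z))) (at ?z)"
    by (simp add: frame_metric_def o_def)
  from frechet_eqI[OF this]
  have "field_deriv A X (\<lambda>q. frame_metric q (Y q) (Z q)) p =
     (\<Sum>k\<in>UNIV. ?e k * (?f k Y ?z * frechet_derivative (?f k Z) (at ?z) (X p) + frechet_derivative (?f k Y) (at ?z) (X p) * ?f k Z ?z))"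
    by (simp add: field_deriv_def)
  then show ?thesis
    unfolding v[OF Y] v[OF Z] by (simp add: ip frame_metric_def sum.distrib[symmetric] distrib_left add.commute)
qed

end

end

theorem corollary4p2:
  fixes A :: "('m::{t2_space,second_countable_topology}, 'n::finite) chart set"
    and nabla :: "('m, 'n) connection"
    and x :: 'm and k0 :: nat
  assumes "analytic_atlas A"
    and "connected (UNIV :: 'm set)"
    and "simply_connected (UNIV :: 'm set)"
    and "analytic_connection A nabla"
    and "k0 \<le> CARD('n) ^ 2"
    and "\<And>k. k \<ge> k0 \<Longrightarrow> curvature_lie_algebra A nabla x k0 = curvature_lie_algebra A nabla x k"
    and "curvature_lie_algebra A nabla x k0 = {\<lambda>u. 0}"
  shows "\<forall>p \<le> CARD('n). \<exists>g. pseudo_riemannian_metric A g \<and>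
           metric_signature g p (CARD('n) - p) \<and> levi_civita_connection A g nabla"
proof (intro allI impI)
  fix p assume p: "p \<le> CARD('n)"
  interpret connection_manifold A nabla
    by unfold_locales (fact assms(1) assms(4))+
  have endo: "curvature_endo A nabla x j v1 v2 vs = (\<lambda>u. 0)" if "length vs = j" for j v1 v2 vs
  proof -
    \<comment> \<open>The index \<open>max k0 j\<close> is large enough both to contain the
      generators of order \<open>j\<close> and for the stabilisation hypothesis to apply.\<close>
    have "curvature_endo A nabla x j v1 v2 vs \<in> curvature_lie_algebra A nabla x (max k0 j)"
      unfolding curvature_lie_algebra_def using that by (intro hull_inc) (auto intro!: exI)
    moreover have "curvature_lie_algebra A nabla x (max k0 j) = {\<lambda>u. 0}"
      by (rule trans[OF assms(6)[symmetric] assms(7)]) simp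
    ultimately show ?thesis by (metis singletonD)
  qed
  \<comment> \<open>The Lie algebras only see the chosen extensions of tangent vectors; tensoriality
    carries the vanishing over to arbitrary fields.\<close>
  have curv0: "curvature_deriv A nabla j Ys x = 0" if Ys: "length Ys = j + 3" "\<forall>Y\<in>set Ys. vf Y" for j Ys
  proof -
    obtain Y1 Y2 Y3 Vs where Y: "Ys = Y1 # Y2 # Y3 # Vs" "length Vs = j"
      using Ys(1) by (auto simp: numeral_3_eq_3 length_Suc_conv)
    let ?Zs = "map (extend_vector A x) (map (\<lambda>Y. Y x) Ys)"
    have "curvature_deriv A nabla j Ys x = curvature_deriv A nabla j ?Zs x"
      by (rule tensorial_cong[OF tensorial_curvature_deriv Ys]) (use Ys in \<open>auto simp: extend_vector\<close>)
    also have "\<dots> = curvature_endo A nabla x j (Y1 x) (Y2 x) (map (\<lambda>Y. Y x) Vs) (Y3 x)"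
      by (simp add: curvature_endo_def tensor_at_def Y(1))
    also have "\<dots> = 0" using endo[of "map (\<lambda>Y. Y x) Vs" j] Y(2) by simp
    finally show ?thesis .
  qed
  have flat: "flat_at q" for q by (rule flat_everywhere[OF assms(2) curv0])
  interpret ls: local_system parallel_at
    by (rule local_system.intro) (rule parallel_germ, assumption+, rule parallel_good[OF flat], assumption+)
  have "\<exists>\<theta>. \<theta> x = axis k 1 \<and> (\<forall>q. parallel_at q \<theta>)" for k :: 'n
    by (rule ls.global_section_exists[OF assms(3)])
  then obtain \<Theta> where \<Theta>: "\<And>k::'n. \<Theta> k x = axis k 1" "\<And>k q. parallel_at q (\<Theta> k)" by metis
  \<comment> \<open>A linear combination that is 0 at \<open>q\<close> is a parallel covector field,
    so it agrees with the zero field everywhere, and at \<open>x\<close> the coframe is the standard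
    basis.\<close>
  have indep: "a = (\<lambda>k. 0)" if 0: "(\<Sum>k\<in>UNIV. (a k) *\<^sub>R \<Theta> k q) = 0" for q and a :: "'n \<Rightarrow> real"
  proof -
    have ps: "parallel_at s (\<lambda>s. \<Sum>k\<in>UNIV. (a k) *\<^sub>R \<Theta> k s)" for s
      by (rule parallel_sum) (rule parallel_scale[OF \<Theta>(2)])
    have "(\<lambda>s. \<Sum>k\<in>UNIV. (a k) *\<^sub>R \<Theta> k s) x = (\<lambda>s. 0) x"
      by (rule ls.global_section_unique[OF assms(2) ps parallel_zero 0])
    then have "(\<Sum>k\<in>UNIV. (a k) *\<^sub>R axis k (1::real)) = 0" by (simp add: \<Theta>(1))
    moreover have "(\<Sum>k\<in>UNIV. (a k) *\<^sub>R axis k (1::real)) = (\<chi> k. a k)"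
      using basis_expansion[of "\<chi> k. a k"] by (simp add: scalar_mult_eq_scaleR)
    ultimately show ?thesis by (simp add: vec_eq_iff fun_eq_iff)
  qed
  obtain P :: "'n set" where P: "card P = p" using obtain_subset_with_card_n[OF p] by metis
  have nP: "card (- P) = CARD('n) - p" using P by (simp add: Compl_eq_Diff_UNIV card_Diff_subset)
  let ?g = "frame_metric \<Theta> P"
  have "pseudo_riemannian_metric A ?g" by (rule frame_metric_pseudo_riemannian[where \<Theta>=\<Theta> and P=P, OF \<Theta>(2) indep])
  moreover have "metric_signature ?g p (CARD('n) - p)"
    unfolding metric_signature_def using frame_metric_signature[where \<Theta>=\<Theta> and P=P, OF \<Theta>(2) indep] by (simp add: P nP)
  moreover have "levi_civita_connection A ?g nabla"
    unfolding levi_civita_connection_def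
    using affine_conn analytic_conn frame_metric_compatible[where \<Theta>=\<Theta> and P=P, OF \<Theta>(2) indep] by (simp add: analytic_connection_def)
  ultimately show "\<exists>g. pseudo_riemannian_metric A g \<and>
           metric_signature g p (CARD('n) - p) \<and> levi_civita_connection A g nabla" by (intro exI[of _ ?g] conjI)
qed

end
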